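(* Let $n\geq 2$. Then: (i) $J_{2,n}$ is a countably infinite antichain, and $J_{3,n}$ (with the order induced from $H_n$) is order-isomorphic to $Q'$; (ii) every element of $J_{2,n}$ has an element of $J_{1,n}$ below it, and every element of $J_{3,n}$ has an element of $J_{2,n}$ below it; (iii) for $i,j\in\{1,2,3\}$, if $x\in J_{i,n}$, $y\in J_{j,n}$ and $x\leq y$, then $i\leq j$.
   Context: For $n\geq 1$ let $F_n$ be the set of propositional formulas in the variables $x_1,\ldots,x_n$ (built with $\wedge,\vee,\rightarrow,\bot,\top$), and let $H_n=F_n/\simeq$, where $\simeq$ is intuitionistic provable equivalence; $H_n$ is the free Heyting algebra on $n$ generators, ordered by $[\phi]\leq[\psi]$ iff $\phi\vdash\psi$ intuitionistically. An element $a\in H_n$ is join-irreducible if $a\neq\bot$ and $a=b\vee c$ implies $a=b$ or $a=c$. $J_n$ is the poset of join-irreducible elements of $H_n$. Let $J_{1,n}=\{\phi\in J_n : \text{only finitely many } \psi\in J_n \text{ satisfy } \psi<\phi\}$, let $J_{2,n}$ be the set of minimal elements of $J_n\setminus J_{1,n}$, and $J_{3,n}=J_n\setminus(J_{1,n}\cup J_{2,n})$. A quasisemilattice (qsl) is a poset $P$ such that for any $p,q\in P$ the set of common lower bounds $\{r: r\leq p, r\leq q\}$ has only finitely many maximal elements and every common lower bound lies below at least one of these maximal elements. It is bounded (a bqsl) if it has a minimum element. It is locally finite if every finite subset is contained in a finite subset closed under the operation "take a maximal common lower bound of two elements". A bqsl embedding $Q_1\to Q_2$ is an order-embedding preserving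 the minimum and such that for all $p,q\in Q_1$ the maximal common lower bounds of the images are exactly the images of the maximal common lower bounds of $p,q$. $Q$ denotes the (unique up to isomorphism, Fraïssé limit) universal countable homogeneous locally finite bounded qsl: it is countable, bounded, locally finite, every countable bounded locally finite qsl bqsl-embeds into it, and every isomorphism between finite sub-bqsls extends to an automorphism. $Q'$ is the poset obtained from $Q$ by removing its minimum element and adding a new maximum element. *)

theory Defs
  imports Main "HOL-Library.Countable_Set"
begin

section \<open>Intuitionistic propositional logic\<close>

datatype form =
    Var nat
  | Bot
  | Top
  | And form form
  | Or form form
  | Imp form form

inductive prov :: "form set \<Rightarrow> form \<Rightarrow> bool"  (infix \<open>\<turnstile>\<close> 50)
  where
    Ax: "\<phi> \<in> \<Gamma> \<Longrightarrow> \<Gamma> \<turnstile> \<phi>"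
  | TopI: "\<Gamma> \<turnstile> Top"
  | BotE: "\<Gamma> \<turnstile> Bot \<Longrightarrow> \<Gamma> \<turnstile> \<phi>"
  | AndI: "\<Gamma> \<turnstile> \<phi> \<Longrightarrow> \<Gamma> \<turnstile> \<psi> \<Longrightarrow> \<Gamma> \<turnstile> And \<phi> \<psi>"
  | AndE1: "\<Gamma> \<turnstile> And \<phi> \<psi> \<Longrightarrow> \<Gamma> \<turnstile> \<phi>"
  | AndE2: "\<Gamma> \<turnstile> And \<phi> \<psi> \<Longrightarrow> \<Gamma> \<turnstile> \<psi>"
  | OrI1: "\<Gamma> \<turnstile> \<phi> \<Longrightarrow> \<Gamma> \<turnstile> Or \<phi> \<psi>"
  | OrI2: "\<Gamma> \<turnstile> \<psi> \<Longrightarrow> \<Gamma> \<turnstile> Or \<phi> \<psi>"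
  | OrE: "\<Gamma> \<turnstile> Or \<phi> \<psi> \<Longrightarrow> insert \<phi> \<Gamma> \<turnstile> \<chi> \<Longrightarrow> insert \<psi> \<Gamma> \<turnstile> \<chi> \<Longrightarrow> \<Gamma> \<turnstile> \<chi>"
  | ImpI: "insert \<phi> \<Gamma> \<turnstile> \<psi> \<Longrightarrow> \<Gamma> \<turnstile> Imp \<phi> \<psi>"
  | ImpE: "\<Gamma> \<turnstile> Imp \<phi> \<psi> \<Longrightarrow> \<Gamma> \<turnstile> \<phi> \<Longrightarrow> \<Gamma> \<turnstile> \<psi>"

lemma prov_weaken: "\<Gamma> \<turnstile> \<phi> \<Longrightarrow> \<Gamma> \<subseteq> \<Delta> \<Longrightarrow> \<Delta> \<turnstile> \<phi>"
proof (induction arbitrary: \<Delta> rule: prov.induct)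
  case (OrE \<Gamma> \<phi> \<psi> \<chi>)
  show ?case
    using OrE.IH(1)[OF OrE.prems] OrE.IH(2)[OF insert_mono[OF OrE.prems]]
      OrE.IH(3)[OF insert_mono[OF OrE.prems]]
    by (rule prov.OrE)
next
  case (ImpI \<phi> \<Gamma> \<psi>)
  then show ?case by (metis insert_mono prov.ImpI)
qed (blast intro: prov.intros)+

lemma prov_trans:
  assumes "{\<phi>} \<turnstile> \<psi>" and "{\<psi>} \<turnstile> \<chi>"
  shows "{\<phi>} \<turnstile> \<chi>"
proof -
  have "insert \<psi> {\<phi>} \<turnstile> \<chi>" using assms(2) by (rule prov_weaken) simp
  then show ?thesis using assms(1) by (blast intro: prov.ImpI prov.ImpE)
qed


section \<open>The free Heyting algebra on \<open>n\<close> generators\<close>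

fun vars :: "form \<Rightarrow> nat set" where
  "vars (Var i) = {i}"
| "vars Bot = {}"
| "vars Top = {}"
| "vars (And \<phi> \<psi>) = vars \<phi> \<union> vars \<psi>"
| "vars (Or \<phi> \<psi>) = vars \<phi> \<union> vars \<psi>"
| "vars (Imp \<phi> \<psi>) = vars \<phi> \<union> vars \<psi>"

definition F :: "nat \<Rightarrow> form set"
  where "F n = {\<phi>. vars \<phi> \<subseteq> {1..n}}"

definition prov_equiv :: "nat \<Rightarrow> form rel"
  where "prov_equiv n = {(\<phi>, \<psi>). \<phi> \<in> F n \<and> \<psi> \<in> F n \<and> {\<phi>} \<turnstile> \<psi> \<and> {\<psi>} \<turnstile> \<phi>}"

definition H :: "nat \<Rightarrow> form set set"
  where "H n = F n // prov_equiv n"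

definition H_le :: "nat \<Rightarrow> form set rel"
  where "H_le n = {(a, b). a \<in> H n \<and> b \<in> H n \<and> (\<exists>\<phi>\<in>a. \<exists>\<psi>\<in>b. {\<phi>} \<turnstile> \<psi>)}"

definition H_bot :: "nat \<Rightarrow> form set"
  where "H_bot n = prov_equiv n `` {Bot}"

definition H_join :: "nat \<Rightarrow> form set \<Rightarrow> form set \<Rightarrow> form set"
  where "H_join n a b = (\<Union>\<phi>\<in>a. \<Union>\<psi>\<in>b. prov_equiv n `` {Or \<phi> \<psi>})"

lemma equiv_prov_equiv: "equiv (F n) (prov_equiv n)"
  by (rule equivI)
    (auto simp: prov_equiv_def refl_on_def sym_def trans_def intro: prov.Ax prov_trans)

lemma H_le_class_iff:
  assumes "\<phi> \<in> F n" and "\<psi> \<in> F n"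
  shows "(prov_equiv n `` {\<phi>}, prov_equiv n `` {\<psi>}) \<in> H_le n \<longleftrightarrow> {\<phi>} \<turnstile> \<psi>"
proof -
  have "prov_equiv n `` {\<phi>} \<in> H n" "prov_equiv n `` {\<psi>} \<in> H n"
    using assms by (auto simp: H_def intro: quotientI)
  then show ?thesis
    using assms by (auto simp: H_le_def) (auto simp: prov_equiv_def intro: prov.Ax prov_trans)
qed

lemma H_join_class:
  assumes "\<phi> \<in> F n" and "\<psi> \<in> F n"
  shows "H_join n (prov_equiv n `` {\<phi>}) (prov_equiv n `` {\<psi>}) = prov_equiv n `` {Or \<phi> \<psi>}"
proof -
  have mono: "{Or \<alpha> \<beta>} \<turnstile> Or \<alpha>' \<beta>'" if "{\<alpha>} \<turnstile> \<alpha>'" "{\<beta>} \<turnstile> \<beta>'" for \<alpha> \<beta> \<alpha>' \<beta>'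
    by (rule prov.OrE[of _ \<alpha> \<beta>])
      (auto intro: prov.Ax prov.OrI1 prov.OrI2 prov_weaken[OF that(1)] prov_weaken[OF that(2)])
  have "congruent2 (prov_equiv n) (prov_equiv n) (\<lambda>\<phi> \<psi>. prov_equiv n `` {Or \<phi> \<psi>})"
    by (intro congruent2I' equiv_class_eq[OF equiv_prov_equiv])
      (auto simp: prov_equiv_def F_def intro: mono)
  then show ?thesis
    unfolding H_join_def
    by (rule UN_equiv_class2[OF equiv_prov_equiv equiv_prov_equiv _ assms])
qed


section \<open>Join-irreducible elements\<close>

definition J :: "nat \<Rightarrow> form set set"
  where "J n = {a \<in> H n. a \<noteq> H_bot n \<and>
    (\<forall>b\<in>H n. \<forall>c\<in>H n. a = H_join n b c \<longrightarrow> a = b \<or> a = c)}"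

definition J1 :: "nat \<Rightarrow> form set set"
  where "J1 n = {a \<in> J n. finite {b \<in> J n. b \<noteq> a \<and> (b, a) \<in> H_le n}}"

definition J2 :: "nat \<Rightarrow> form set set"
  where "J2 n = {a \<in> J n - J1 n. \<forall>b\<in>J n - J1 n. (b, a) \<in> H_le n \<longrightarrow> b = a}"

definition J3 :: "nat \<Rightarrow> form set set"
  where "J3 n = J n - (J1 n \<union> J2 n)"

text \<open>Indexed form of the three parts; only the indices 1, 2, 3 are meaningful.\<close>

definition J_part :: "nat \<Rightarrow> nat \<Rightarrow> form set set"
  where "J_part i n = (if i = 1 then J1 n else if i = 2 then J2 n else J3 n)"


section \<open>Posets\<close>

text \<open>
  A poset is represented by its (reflexive) order relation \<open>r\<close> with \<^prop>\<open>Partial_order r\<close>;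
  its carrier is \<^term>\<open>Field r\<close>, and \<open>Restr r A\<close> is the order induced on a subset \<open>A\<close>.
\<close>

definition antichain :: "'a rel \<Rightarrow> 'a set \<Rightarrow> bool"
  where "antichain r A \<longleftrightarrow> (\<forall>x\<in>A. \<forall>y\<in>A. (x, y) \<in> r \<longrightarrow> x = y)"

definition order_iso :: "'a rel \<Rightarrow> 'b rel \<Rightarrow> ('a \<Rightarrow> 'b) \<Rightarrow> bool"
  where "order_iso r s f \<longleftrightarrow> bij_betw f (Field r) (Field s) \<and>
    (\<forall>x\<in>Field r. \<forall>y\<in>Field r. (x, y) \<in> r \<longleftrightarrow> (f x, f y) \<in> s)"

definition order_isomorphic :: "'a rel \<Rightarrow> 'b rel \<Rightarrow> bool"
  where "order_isomorphic r s \<longleftrightarrow> (\<exists>f. order_iso r s f)"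

definition is_minimum :: "'a rel \<Rightarrow> 'a \<Rightarrow> bool"
  where "is_minimum r m \<longleftrightarrow> m \<in> Field r \<and> (\<forall>x\<in>Field r. (m, x) \<in> r)"


section \<open>Quasisemilattices\<close>

definition common_lower_bounds :: "'a rel \<Rightarrow> 'a \<Rightarrow> 'a \<Rightarrow> 'a set"
  where "common_lower_bounds r p q = {x \<in> Field r. (x, p) \<in> r \<and> (x, q) \<in> r}"

definition max_lower_bounds :: "'a rel \<Rightarrow> 'a \<Rightarrow> 'a \<Rightarrow> 'a set"
  where "max_lower_bounds r p q = {x \<in> common_lower_bounds r p q.
    \<forall>y\<in>common_lower_bounds r p q. (x, y) \<in> r \<longrightarrow> y = x}"

definition qsl :: "'a rel \<Rightarrow> bool"
  where "qsl r \<longleftrightarrow> Partial_order r \<and>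
    (\<forall>p\<in>Field r. \<forall>q\<in>Field r.
      finite (max_lower_bounds r p q) \<and>
      (\<forall>x\<in>common_lower_bounds r p q. \<exists>m\<in>max_lower_bounds r p q. (x, m) \<in> r))"

definition bqsl :: "'a rel \<Rightarrow> bool"
  where "bqsl r \<longleftrightarrow> qsl r \<and> (\<exists>m. is_minimum r m)"

definition max_lower_bound_closed :: "'a rel \<Rightarrow> 'a set \<Rightarrow> bool"
  where "max_lower_bound_closed r A \<longleftrightarrow> (\<forall>p\<in>A. \<forall>q\<in>A. max_lower_bounds r p q \<subseteq> A)"

definition qsl_locally_finite :: "'a rel \<Rightarrow> bool"
  where "qsl_locally_finite r \<longleftrightarrow> (\<forall>A. finite A \<and> A \<subseteq> Field r \<longrightarrow>
    (\<exists>B. finite B \<and> A \<subseteq> B \<and> B \<subseteq> Field r \<and> max_lower_bound_closed r B))"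

definition bqsl_embedding :: "'a rel \<Rightarrow> 'b rel \<Rightarrow> ('a \<Rightarrow> 'b) \<Rightarrow> bool"
  where "bqsl_embedding r s f \<longleftrightarrow>
    f ` Field r \<subseteq> Field s \<and>
    (\<forall>x\<in>Field r. \<forall>y\<in>Field r. (x, y) \<in> r \<longleftrightarrow> (f x, f y) \<in> s) \<and>
    (\<forall>m. is_minimum r m \<longrightarrow> is_minimum s (f m)) \<and>
    (\<forall>p\<in>Field r. \<forall>q\<in>Field r. max_lower_bounds s (f p) (f q) = f ` max_lower_bounds r p q)"

definition sub_bqsl :: "'a rel \<Rightarrow> 'a set \<Rightarrow> bool"
  where "sub_bqsl r A \<longleftrightarrow> A \<subseteq> Field r \<and> (\<exists>m\<in>A. is_minimum r m) \<and> max_lower_bound_closed r A"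

text \<open>
  In the universality clause the test objects live on subsets of the natural numbers; up to
  isomorphism these are all the countable ones.  In the homogeneity clause an isomorphism of
  sub-bqsls is an order isomorphism of the induced orders: minimum and maximal common lower bounds
  are determined by the order, and on a sub-bqsl they agree with those of the ambient poset.
\<close>

definition universal_homogeneous_bqsl :: "'a rel \<Rightarrow> bool"
  where "universal_homogeneous_bqsl r \<longleftrightarrow>
    bqsl r \<and> countable (Field r) \<and> qsl_locally_finite r \<and>
    (\<forall>s::nat rel. bqsl s \<and> qsl_locally_finite s \<longrightarrow> (\<exists>f. bqsl_embedding s r f)) \<and>
    (\<forall>A B f. finite A \<and> finite B \<and> sub_bqsl r A \<and> sub_bqsl r B \<and>
        order_iso (Restr r A) (Restr r B) f \<longrightarrow>
        (\<exists>g. order_iso r r g \<and> (\<forall>x\<in>A. g x = f x)))"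

text \<open>Remove the minimum and add a new maximum, represented by \<^term>\<open>None\<close>.\<close>

definition shift_poset :: "'a rel \<Rightarrow> 'a option rel"
  where "shift_poset r =
    {(Some x, Some y) | x y. (x, y) \<in> r \<and> \<not> is_minimum r x \<and> \<not> is_minimum r y} \<union>
    {(Some x, None) | x. x \<in> Field r \<and> \<not> is_minimum r x} \<union>
    {(None, None)}"

end

theory Submission
  imports Defs
begin

text \<open>
  By completeness for finite tree models, \<open>H n\<close> is the lattice of the sets of trees that are closed
  under one of the finite-depth simulation preorders \<open>le d\<close>, and its join-irreducible elements are
  the principal down-sets \<open>C d t\<close> of these preorders.  Gluing trees under a new root shows that the
  principal sets remain join-irreducible at every greater depth.  The elements of \<open>J1\<close> are the sets
  \<open>cone t\<close> of trees bisimilar to points of one tree \<open>t\<close>.  Below an infinite \<open>C d t\<close> one finds a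
  copy of the Rieger--Nishimura ladder over a finite base; its proper definable subsets are
  finitely generated, so it lies in \<open>J2\<close>.  Infinitely many different ladders arise below the top.

  The universal homogeneous bounded quasisemilattice is characterised by one-point extensions, by
  a back-and-forth argument.  In \<open>J3\<close> these extensions exist: below \<open>c = C d t\<close> take the trees all
  of whose points have type \<open>t\<close> or lie in a prescribed definable set of points of smaller type.
\<close>

section \<open>Finite tree models\<close>

text \<open>A definable set has no preferred depth: if it is closed at one level it is closed at all
  greater ones, while types keep splitting as the level grows. Irreducibility is therefore expressed
  by directedness with respect to genuine bisimilarity, which mentions no level and makes
  irreducible sets prime for all finite unions of definable sets. Finite trees are isolated at some
  level, so having infinitely many irreducibles below turns into lying in no \<open>cone s\<close>,
  a condition that is easy to transport.

  The one-point extensions rest on what \<open>JJ3\<close> cannot see. A member of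
  \<open>JJ3\<close> is contained neither in a \<open>cone s\<close> nor in a member of
  \<open>JJ2\<close>. Sets of these two kinds can therefore be added to a new element as padding, to
  make it infinite and to give its roots the right type, without creating new lower bounds inside
  \<open>JJ3\<close>.

  The bound on the number of generators enters through the top: with one generator the top is itself
  the ladder, and the third part is empty.\<close>

datatype tree = Node (lbl: "nat set") (kids: "tree list")

fun pts :: "tree \<Rightarrow> tree set" where
  "pts (Node v ts) = insert (Node v ts) (\<Union>t\<in>set ts. pts t)"

lemma pts_refl [simp, intro]: "t \<in> pts t"
  by (cases t) simp

lemma pts_trans: "u \<in> pts t \<Longrightarrow> v \<in> pts u \<Longrightarrow> v \<in> pts t"
  by (induction t arbitrary: u rule: pts.induct) auto

lemma finite_pts [simp, intro]: "finite (pts t)"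
  by (induction t rule: pts.induct) auto

lemma pts_size: "u \<in> pts t \<Longrightarrow> u = t \<or> size u < size t"
proof (induction t arbitrary: u rule: pts.induct)
  case (1 v ts)
  show ?case
  proof (cases "u = Node v ts")
    case False
    then obtain k where k: "k \<in> set ts" "u \<in> pts k" using 1(2) by auto
    then have "size u \<le> size k" using 1(1) by fastforce
    moreover have "size k < size (Node v ts)"
      using size_list_estimation'[OF k(1), of "size k" size] by simp
    ultimately show ?thesis by simp
  qed simp
qed

primrec forces :: "tree \<Rightarrow> form \<Rightarrow> bool"  (infix \<open>\<tturnstile>\<close> 50)
  where
    "t \<tturnstile> Var i \<longleftrightarrow> (\<forall>u\<in>pts t. i \<in> lbl u)"
  | "t \<tturnstile> Bot \<longleftrightarrow> False"
  | "t \<tturnstile> Top \<longleftrightarrow> True"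
  | "t \<tturnstile> And \<phi> \<psi> \<longleftrightarrow> t \<tturnstile> \<phi> \<and> t \<tturnstile> \<psi>"
  | "t \<tturnstile> Or \<phi> \<psi> \<longleftrightarrow> t \<tturnstile> \<phi> \<or> t \<tturnstile> \<psi>"
  | "t \<tturnstile> Imp \<phi> \<psi> \<longleftrightarrow> (\<forall>u\<in>pts t. u \<tturnstile> \<phi> \<longrightarrow> u \<tturnstile> \<psi>)"

lemma forces_pts: "t \<tturnstile> \<phi> \<Longrightarrow> u \<in> pts t \<Longrightarrow> u \<tturnstile> \<phi>"
  by (induction \<phi>) (auto intro: pts_trans)

lemma soundness: "\<Gamma> \<turnstile> \<phi> \<Longrightarrow> \<forall>\<gamma>\<in>\<Gamma>. t \<tturnstile> \<gamma> \<Longrightarrow> t \<tturnstile> \<phi>"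
proof (induction arbitrary: t rule: prov.induct)
  case (ImpI \<phi> \<Gamma> \<psi>)
  then show ?case by (auto intro: forces_pts)
next
  case (OrE \<Gamma> \<phi> \<psi> \<chi>)
  then show ?case by (metis forces.simps(5) insert_iff)
next
  case (ImpE \<Gamma> \<phi> \<psi>)
  then show ?case using pts_refl by (metis forces.simps(6))
qed auto

section \<open>Completeness for finite trees\<close>

primrec subfm :: "form \<Rightarrow> form set" where
  "subfm (Var i) = {Var i}"
| "subfm Bot = {Bot}"
| "subfm Top = {Top}"
| "subfm (And \<phi> \<psi>) = insert (And \<phi> \<psi>) (subfm \<phi> \<union> subfm \<psi>)"
| "subfm (Or \<phi> \<psi>) = insert (Or \<phi> \<psi>) (subfm \<phi> \<union> subfm \<psi>)"
| "subfm (Imp \<phi> \<psi>) = insert (Imp \<phi> \<psi>) (subfm \<phi> \<union> subfm \<psi>)"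

lemma finite_subfm: "finite (subfm \<phi>)"
  by (induction \<phi>) auto

lemma subfm_refl [simp]: "\<phi> \<in> subfm \<phi>"
  by (cases \<phi>) auto

lemma subfm_trans: "\<psi> \<in> subfm \<phi> \<Longrightarrow> subfm \<psi> \<subseteq> subfm \<phi>"
  by (induction \<phi>) auto

lemma prov_cut: "\<Gamma> \<turnstile> \<phi> \<Longrightarrow> insert \<phi> \<Gamma> \<turnstile> \<psi> \<Longrightarrow> \<Gamma> \<turnstile> \<psi>"
  by (blast intro: prov.ImpI prov.ImpE)

text \<open>A maximal theory \<open>\<Delta>\<close> inside the finite set \<open>S\<close> labels
  the root, and each kid refutes one missing implication. The theory of a kid gains an antecedent,
  so \<open>card (S - \<Gamma>)\<close> drops and the tree has finite depth.\<close>

lemma tree_countermodel: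
  assumes "finite S" and sub: "\<And>\<phi>. \<phi> \<in> S \<Longrightarrow> subfm \<phi> \<subseteq> S"
  shows "\<Gamma> \<subseteq> S \<Longrightarrow> \<psi> \<in> S \<Longrightarrow> \<not> \<Gamma> \<turnstile> \<psi> \<Longrightarrow>
    \<exists>t. (\<forall>\<gamma>\<in>\<Gamma>. t \<tturnstile> \<gamma>) \<and> \<not> t \<tturnstile> \<psi>"
proof (induction "card (S - \<Gamma>)" arbitrary: \<Gamma> \<psi> rule: less_induct)
  case less
  let ?T = "{\<Delta>. \<Gamma> \<subseteq> \<Delta> \<and> \<Delta> \<subseteq> S \<and> \<not> \<Delta> \<turnstile> \<psi>}"
  have "finite ?T" using \<open>finite S\<close> by (auto intro: finite_subset[of _ "Pow S"])
  moreover have "\<Gamma> \<in> ?T" using less.prems by auto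
  ultimately obtain \<Delta> where \<Delta>: "\<Delta> \<in> ?T" "\<And>\<Delta>'. \<Delta>' \<in> ?T \<Longrightarrow> \<Delta> \<subseteq> \<Delta>' \<Longrightarrow> \<Delta> = \<Delta>'"
    using finite_has_maximal2[of ?T \<Gamma>] by (metis (no_types, lifting))
  then have sub\<Delta>: "\<Gamma> \<subseteq> \<Delta>" "\<Delta> \<subseteq> S" and np: "\<not> \<Delta> \<turnstile> \<psi>" by auto
  have max: "insert \<sigma> \<Delta> \<turnstile> \<psi>" if "\<sigma> \<in> S" "\<sigma> \<notin> \<Delta>" for \<sigma>
    using \<Delta>(2)[of "insert \<sigma> \<Delta>"] that sub\<Delta> by auto
  have ded: "\<sigma> \<in> \<Delta>" if "\<sigma> \<in> S" "\<Delta> \<turnstile> \<sigma>" for \<sigma>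
    using max[OF that(1)] prov_cut[OF that(2)] np by blast
  \<comment> \<open>Antecedents already in \<open>\<Delta>\<close> are left out: the root itself
    refutes such an implication, and a kid for it need not decrease the measure.\<close>
  let ?I = "{(\<alpha>, \<beta>). Imp \<alpha> \<beta> \<in> S \<and> Imp \<alpha> \<beta> \<notin> \<Delta> \<and> \<alpha> \<notin> \<Delta>}"
  have kid: "\<exists>t. (\<forall>\<gamma>\<in>insert \<alpha> \<Delta>. t \<tturnstile> \<gamma>) \<and> \<not> t \<tturnstile> \<beta>" if "(\<alpha>, \<beta>) \<in> ?I" for \<alpha> \<beta>
  proof (rule less.hyps)
    have "\<alpha> \<in> S" "\<beta> \<in> S" using that sub[of "Imp \<alpha> \<beta>"] by auto
    then show "insert \<alpha> \<Delta> \<subseteq> S" "\<beta> \<in> S" using sub\<Delta> by auto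
    show "\<not> insert \<alpha> \<Delta> \<turnstile> \<beta>" using that ded prov.ImpI by blast
    have "S - insert \<alpha> \<Delta> \<subset> S - \<Gamma>" using \<open>\<alpha> \<in> S\<close> that sub\<Delta> by auto
    then show "card (S - insert \<alpha> \<Delta>) < card (S - \<Gamma>)"
      using \<open>finite S\<close> by (meson finite_Diff psubset_card_mono)
  qed
  have "\<forall>p\<in>?I. \<exists>t. (\<forall>\<gamma>\<in>insert (fst p) \<Delta>. t \<tturnstile> \<gamma>) \<and> \<not> t \<tturnstile> snd p"
    using kid by (metis (no_types, lifting) prod.collapse)
  from bchoice[OF this] obtain k where
    k_all: "\<forall>p\<in>?I. (\<forall>\<gamma>\<in>insert (fst p) \<Delta>. k p \<tturnstile> \<gamma>) \<and> \<not> k p \<tturnstile> snd p" ..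
  note k = bspec[OF k_all]
  have "finite ((\<lambda>(\<alpha>, \<beta>). Imp \<alpha> \<beta>) ` ?I)"
    using \<open>finite S\<close> by (rule finite_subset[rotated]) auto
  then have "finite ?I" by (rule finite_imageD) (auto simp: inj_on_def)
  then obtain ks where ks: "set ks = k ` ?I"
    using finite_list finite_imageI by meson
  define t where "t = Node {i. Var i \<in> \<Delta>} ks"
  have pt: "pts t = insert t (\<Union>(pts ` set ks))" by (simp add: t_def)
  have kd: "u \<tturnstile> \<gamma>" if uk: "u \<in> pts k'" "k' \<in> set ks" "\<gamma> \<in> \<Delta>" for u k' \<gamma>
  proof -
    obtain p where "p \<in> ?I" "k' = k p" using uk(2) ks by blast
    then have "k' \<tturnstile> \<gamma>" using k[of p] uk(3) by blast
    then show ?thesis using forces_pts uk(1) by blast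
  qed
  have truth: "t \<tturnstile> \<sigma> \<longleftrightarrow> \<sigma> \<in> \<Delta>" if "\<sigma> \<in> S" for \<sigma>
    using that
  proof (induction \<sigma>)
    case (Var i)
    have "i \<in> lbl u" if "u \<in> pts k'" "k' \<in> set ks" "Var i \<in> \<Delta>" for u k'
      using kd[OF that] by auto
    then show ?case unfolding forces.simps pt by (auto simp: t_def)
  next
    case Bot
    then show ?case using np by (auto intro: prov.BotE prov.Ax)
  next
    case Top
    then show ?case using ded prov.TopI by auto
  next
    case (And \<alpha> \<beta>)
    have "\<alpha> \<in> S" "\<beta> \<in> S" using sub[OF And.prems] by auto
    then show ?case using And.IH ded[OF And.prems] ded[of \<alpha>] ded[of \<beta>]
      by (auto intro: prov.AndI prov.AndE1 prov.AndE2 prov.Ax)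
  next
    case (Or \<alpha> \<beta>)
    have S: "\<alpha> \<in> S" "\<beta> \<in> S" using sub[OF Or.prems] by auto
    have "\<alpha> \<in> \<Delta> \<or> \<beta> \<in> \<Delta>" if "Or \<alpha> \<beta> \<in> \<Delta>"
      using max[OF S(1)] max[OF S(2)] prov.OrE[OF prov.Ax[OF that]] np by blast
    then show ?case using S Or.IH ded[OF Or.prems] by (auto intro: prov.OrI1 prov.OrI2 prov.Ax)
  next
    case (Imp \<alpha> \<beta>)
    have S: "\<alpha> \<in> S" "\<beta> \<in> S" using sub[OF Imp.prems] by auto
    show ?case
    proof
      assume L: "t \<tturnstile> Imp \<alpha> \<beta>"
      show "Imp \<alpha> \<beta> \<in> \<Delta>"
      proof (rule ccontr)
        assume N: "Imp \<alpha> \<beta> \<notin> \<Delta>"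
        show False
        proof (cases "\<alpha> \<in> \<Delta>")
          case True
          then have "t \<tturnstile> \<beta>" using L Imp.IH(1)[OF S(1)] pts_refl by auto
          then have "insert \<alpha> \<Delta> \<turnstile> \<beta>" using Imp.IH(2)[OF S(2)] by (auto intro: prov.Ax)
          then show False using N ded[OF Imp.prems] prov.ImpI by blast
        next
          case False
          then have I: "(\<alpha>, \<beta>) \<in> ?I" using N Imp.prems by auto
          then have "k (\<alpha>, \<beta>) \<in> set ks" using ks by blast
          then have "k (\<alpha>, \<beta>) \<in> pts t" unfolding pt using pts_refl by blast
          then show False using k[OF I] L by simp blast
        qed
      qed
    next
      assume R: "Imp \<alpha> \<beta> \<in> \<Delta>"
      have "u \<tturnstile> \<beta>" if u: "u \<in> pts t" "u \<tturnstile> \<alpha>" for u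
      proof (cases "u = t")
        case True
        then have "\<Delta> \<turnstile> \<beta>" using Imp.IH(1)[OF S(1)] u R by (blast intro: prov.ImpE prov.Ax)
        then show ?thesis using ded S Imp.IH(2)[OF S(2)] True by auto
      next
        case False
        then have "u \<tturnstile> Imp \<alpha> \<beta>" using u kd R unfolding pt by blast
        then show ?thesis using u pts_refl by auto
      qed
      then show "t \<tturnstile> Imp \<alpha> \<beta>" by auto
    qed
  qed
  have "\<psi> \<notin> \<Delta>" using np by (auto intro: prov.Ax)
  then show ?case using truth less.prems sub\<Delta> by blast
qed

theorem prov_iff_forces: "{\<phi>} \<turnstile> \<psi> \<longleftrightarrow> (\<forall>t. t \<tturnstile> \<phi> \<longrightarrow> t \<tturnstile> \<psi>)"
proof
  show "{\<phi>} \<turnstile> \<psi> \<Longrightarrow> \<forall>t. t \<tturnstile> \<phi> \<longrightarrow> t \<tturnstile> \<psi>" using soundness by blast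
  assume "\<forall>t. t \<tturnstile> \<phi> \<longrightarrow> t \<tturnstile> \<psi>"
  moreover have "subfm \<chi> \<subseteq> subfm \<phi> \<union> subfm \<psi>" if "\<chi> \<in> subfm \<phi> \<union> subfm \<psi>" for \<chi>
    using that subfm_trans by blast
  ultimately show "{\<phi>} \<turnstile> \<psi>"
    using tree_countermodel[of "subfm \<phi> \<union> subfm \<psi>" "{\<phi>}" \<psi>]
    by (auto simp: finite_subfm)
qed

section \<open>Bounded simulations\<close>

locale gens =
  fixes n :: nat
begin

text \<open>Labels need not grow along branches. Forcing a variable looks at all points, and
  \<open>val\<close> is the part of the label that persists, cut down to the generators.\<close>

definition val :: "tree \<Rightarrow> nat set"
  where "val t = {i \<in> {1..n}. \<forall>u\<in>pts t. i \<in> lbl u}"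

text \<open>A depth-bounded form of bisimulation: \<open>t\<close> forces every formula over the
  generators of implication depth at most \<open>d\<close> that \<open>u\<close> forces. The points
  of a tree force more than its root and are therefore smaller.\<close>

fun le :: "nat \<Rightarrow> tree \<Rightarrow> tree \<Rightarrow> bool" where
  "le 0 t u \<longleftrightarrow> val u \<subseteq> val t"
| "le (Suc d) t u \<longleftrightarrow> val u \<subseteq> val t \<and> (\<forall>t'\<in>pts t. \<exists>u'\<in>pts u. le d t' u' \<and> le d u' t')"

definition eqv :: "nat \<Rightarrow> tree \<Rightarrow> tree \<Rightarrow> bool"
  where "eqv d t u \<longleftrightarrow> le d t u \<and> le d u t"

lemma le_Suc_iff:
  "le (Suc d) t u \<longleftrightarrow> val u \<subseteq> val t \<and> (\<forall>t'\<in>pts t. \<exists>u'\<in>pts u. eqv d t' u')"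
  by (simp add: eqv_def)

declare le.simps(2) [simp del]

lemma val_pts: "u \<in> pts t \<Longrightarrow> val t \<subseteq> val u"
  unfolding val_def using pts_trans by blast

lemma finite_val [simp]: "finite (val t)"
  unfolding val_def by simp

lemma le_val: "le d t u \<Longrightarrow> val u \<subseteq> val t"
  by (cases d) (auto simp: le_Suc_iff)

lemma eqv_sym: "eqv d t u \<Longrightarrow> eqv d u t"
  by (simp add: eqv_def)

lemma le_refl [simp]: "le d t t"
  by (induction d arbitrary: t) (auto simp: le_Suc_iff eqv_def)

lemma eqv_refl [simp]: "eqv d t t"
  by (simp add: eqv_def)

lemma le_trans: "le d t u \<Longrightarrow> le d u v \<Longrightarrow> le d t v"
proof (induction d arbitrary: t u v)
  case (Suc d)
  have "\<exists>v'\<in>pts v. eqv d t' v'" if t': "t' \<in> pts t" for t'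
  proof -
    obtain u' where u': "u' \<in> pts u" "eqv d t' u'" using Suc.prems(1) t' by (auto simp: le_Suc_iff)
    then obtain v' where "v' \<in> pts v" "eqv d u' v'" using Suc.prems(2) by (auto simp: le_Suc_iff)
    then show ?thesis using u' Suc.IH unfolding eqv_def by blast
  qed
  then show ?case using Suc.prems by (auto simp: le_Suc_iff)
qed auto

lemma eqv_trans: "eqv d t u \<Longrightarrow> eqv d u v \<Longrightarrow> eqv d t v"
  unfolding eqv_def using le_trans by blast

lemma eqv_val: "eqv d t u \<Longrightarrow> val t = val u"
  unfolding eqv_def using le_val by blast

lemma le_Suc_D: "le (Suc d) t u \<Longrightarrow> le d t u"
proof (induction d arbitrary: t u)
  case (Suc d)
  then have "\<exists>u'\<in>pts u. eqv d t' u'" if "t' \<in> pts t" for t'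
    using that le_Suc_iff[of "Suc d"] unfolding eqv_def by blast
  then show ?case using Suc.prems by (auto simp: le_Suc_iff)
qed (simp add: le_Suc_iff)

lemma le_mono:
  assumes "le e t u" "d \<le> e"
  shows "le d t u"
proof -
  have "le (d + k) t u \<Longrightarrow> le d t u" for k by (induction k) (auto dest: le_Suc_D)
  then show ?thesis using assms le_Suc_ex by blast
qed

lemma eqv_mono: "eqv e t u \<Longrightarrow> d \<le> e \<Longrightarrow> eqv d t u"
  unfolding eqv_def using le_mono by blast

lemma le_pts: "u \<in> pts t \<Longrightarrow> le d u t"
proof (cases d)
  case (Suc k)
  assume "u \<in> pts t"
  then show ?thesis unfolding Suc le_Suc_iff using val_pts pts_trans eqv_refl by blast
qed (use val_pts in auto)

lemma le_ptsD: "le d t u \<Longrightarrow> t' \<in> pts t \<Longrightarrow> k < d \<Longrightarrow> \<exists>u'\<in>pts u. eqv k t' u'"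
proof (cases d)
  case (Suc e)
  assume "le d t u" "t' \<in> pts t" "k < d"
  then obtain u' where "u' \<in> pts u" "eqv e t' u'" unfolding Suc le_Suc_iff by blast
  moreover have "k \<le> e" using \<open>k < d\<close> Suc by simp
  ultimately show ?thesis using eqv_mono by blast
qed auto

text \<open>A type of depth \<open>Suc d\<close> is fixed by a valuation and the set of types of
  depth \<open>d\<close> occurring at points, so finiteness passes from \<open>d\<close> to
  \<open>Suc d\<close>.\<close>

lemma finite_eqv: "\<exists>R. finite R \<and> (\<forall>t. \<exists>r\<in>R. eqv d t r)"
proof -
  have key: "\<exists>R. finite R \<and> (\<forall>t. \<exists>r\<in>R. eqv e t r)"
    if "finite (range f)" "\<And>t u. f t = f u \<Longrightarrow> eqv e t u" for f :: "tree \<Rightarrow> 'x" and e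
  proof (intro exI conjI allI)
    show "finite (inv f ` range f)" using that by blast
    fix t
    have "f (inv f (f t)) = f t" by (simp add: f_inv_into_f)
    then show "\<exists>r\<in>inv f ` range f. eqv e t r" using that(2) by (metis imageI rangeI)
  qed
  show ?thesis
  proof (induction d)
    case 0
    have "finite (range val)"
      by (rule finite_subset[of _ "Pow {1..n}"]) (auto simp: val_def)
    then show ?case by (rule key) (auto simp: eqv_def)
  next
    case (Suc d)
    then obtain R where R: "finite R" "\<And>t. \<exists>r\<in>R. eqv d t r" by blast
    define f where "f t = (val t, {r \<in> R. \<exists>t'\<in>pts t. eqv d t' r})" for t
    have le: "le (Suc d) t u" if "f t = f u" for t u
    proof -
      have "\<exists>u'\<in>pts u. eqv d t' u'" if "t' \<in> pts t" for t'
      proof -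
        obtain r where "r \<in> R" "eqv d t' r" using R(2) by blast
        then have "r \<in> snd (f u)" using \<open>f t = f u\<close>[symmetric] that unfolding f_def by auto
        then obtain u' where "u' \<in> pts u" "eqv d u' r" unfolding f_def by auto
        then show ?thesis using \<open>eqv d t' r\<close> eqv_trans eqv_sym by meson
      qed
      then show ?thesis using that by (auto simp: le_Suc_iff f_def)
    qed
    have "finite (range f)"
      by (rule finite_subset[of _ "Pow {1..n} \<times> Pow R"]) (auto simp: f_def val_def R(1))
    then show ?case by (rule key) (simp add: eqv_def le)
  qed
qed

section \<open>Definable sets\<close>

definition C :: "nat \<Rightarrow> tree \<Rightarrow> tree set"
  where "C d t = {u. le d u t}"

definition lvl_closed :: "nat \<Rightarrow> tree set \<Rightarrow> bool"
  where "lvl_closed d X \<longleftrightarrow> (\<forall>u v. v \<in> X \<longrightarrow> le d u v \<longrightarrow> u \<in> X)"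

definition Def :: "tree set \<Rightarrow> bool"
  where "Def X \<longleftrightarrow> (\<exists>d. lvl_closed d X)"

text \<open>The largest proper subset of \<open>C d t\<close> that is closed at level
  \<open>d\<close>: exactly the trees of the \<open>d\<close>-type of \<open>t\<close> are left
  out.\<close>

definition lower :: "nat \<Rightarrow> tree \<Rightarrow> tree set"
  where "lower d t = {u. le d u t \<and> \<not> le d t u}"

lemma C_self [simp]: "t \<in> C d t"
  by (simp add: C_def)

lemma lvl_closed_C [simp]: "lvl_closed d (C d t)"
  using le_trans by (auto simp: lvl_closed_def C_def)

lemma lvl_closed_lower: "lvl_closed d (lower d t)"
  using le_trans unfolding lvl_closed_def lower_def by blast

lemma lvl_closed_mono: "lvl_closed d X \<Longrightarrow> d \<le> e \<Longrightarrow> lvl_closed e X"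
  using le_mono unfolding lvl_closed_def by blast

lemma lvl_closed_pts: "lvl_closed d X \<Longrightarrow> t \<in> X \<Longrightarrow> u \<in> pts t \<Longrightarrow> u \<in> X"
  using le_pts unfolding lvl_closed_def by blast

lemma lvl_closed_C_subset: "lvl_closed d X \<Longrightarrow> t \<in> X \<Longrightarrow> C d t \<subseteq> X"
  unfolding lvl_closed_def C_def by blast

lemma lvl_closed_Int: "lvl_closed d X \<Longrightarrow> lvl_closed d Y \<Longrightarrow> lvl_closed d (X \<inter> Y)"
  unfolding lvl_closed_def by blast

lemma Def_C [simp]: "Def (C d t)"
  unfolding Def_def by (rule exI[of _ d]) simp

lemma finite_C: "finite (range (C d))"
proof -
  obtain R where R: "finite R" "\<And>t. \<exists>r\<in>R. eqv d t r" using finite_eqv by blast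
  have "C d t \<in> C d ` R" for t
  proof -
    obtain r where "r \<in> R" "eqv d t r" using R(2) by blast
    then have "C d t = C d r" using le_trans unfolding C_def eqv_def by blast
    then show ?thesis using \<open>r \<in> R\<close> by blast
  qed
  then have "range (C d) \<subseteq> C d ` R" by blast
  then show ?thesis using R(1) finite_subset by blast
qed

lemma finite_C_image: "finite (C d ` X)"
  by (rule finite_subset[OF _ finite_C]) blast

lemma lvl_closed_eq_Union: "lvl_closed d X \<Longrightarrow> X = \<Union>(C d ` X)"
  unfolding lvl_closed_def C_def using le_refl by fast

lemma common_level:
  assumes "finite \<X>" "\<And>X. X \<in> \<X> \<Longrightarrow> Def X"
  shows "\<exists>d\<ge>e. \<forall>X\<in>\<X>. lvl_closed d X"
  using assms
proof (induction \<X>)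
  case (insert X \<X>)
  then obtain d where d: "d \<ge> e" "\<forall>Y\<in>\<X>. lvl_closed d Y" by auto
  obtain k where k: "lvl_closed k X" using insert.prems unfolding Def_def by auto
  have "lvl_closed (max d k) Y" if "Y \<in> insert X \<X>" for Y
    using that d(2) k lvl_closed_mono[of d Y "max d k"] lvl_closed_mono[of k X "max d k"] by auto
  moreover have "max d k \<ge> e" using d(1) by simp
  ultimately show ?case by blast
qed auto

lemma Def_Union: "finite \<X> \<Longrightarrow> (\<And>X. X \<in> \<X> \<Longrightarrow> Def X) \<Longrightarrow> Def (\<Union>\<X>)"
  using common_level[of \<X> 0] unfolding Def_def lvl_closed_def by blast

lemma Def_Un: "Def X \<Longrightarrow> Def Y \<Longrightarrow> Def (X \<union> Y)"
  using Def_Union[of "{X, Y}"] by auto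

lemma Def_Int: "Def X \<Longrightarrow> Def Y \<Longrightarrow> Def (X \<inter> Y)"
  using common_level[of "{X, Y}" 0] lvl_closed_Int unfolding Def_def by auto

lemma Def_pts: "Def X \<Longrightarrow> t \<in> X \<Longrightarrow> u \<in> pts t \<Longrightarrow> u \<in> X"
  using lvl_closed_pts unfolding Def_def by blast

text \<open>Points of \<open>t\<close> that look like \<open>t\<close> are matched with the new root
  itself, hence their exemption in \<open>cover\<close>. Matching them for level
  \<open>Suc k\<close> uses the equivalence of the two roots at level \<open>k\<close>, which is why
  the proof climbs through all \<open>k \<le> d\<close>.\<close>

lemma root_eqv:
  assumes le: "\<And>m. m \<in> set ms \<Longrightarrow> le d m t"
    and cover: "\<And>k t'. k < d \<Longrightarrow> t' \<in> pts t \<Longrightarrow> eqv k t' t \<or> (\<exists>m\<in>set ms. \<exists>v\<in>pts m. eqv k t' v)"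
  shows "eqv d (Node (val t) ms) t"
proof -
  define w where "w = Node (val t) ms"
  have pw: "pts w = insert w (\<Union>m\<in>set ms. pts m)" by (simp add: w_def)
  have "val t \<subseteq> lbl u" if "m \<in> set ms" "u \<in> pts m" for m u
  proof -
    have "val t \<subseteq> val u" using le_val[OF le[OF that(1)]] val_pts[OF that(2)] by blast
    then show ?thesis unfolding val_def by auto
  qed
  then have "val t \<subseteq> lbl u" if "u \<in> pts w" for u
    using that unfolding pw by (auto simp: w_def)
  then have "val t \<subseteq> val w" by (auto simp: val_def)
  moreover have "val w \<subseteq> lbl w" by (auto simp: val_def)
  ultimately have vw: "val w = val t" by (auto simp: w_def)
  have "eqv k w t" if "k \<le> d" for k
    using that
  proof (induction k)
    case 0
    then show ?case using vw by (simp add: eqv_def)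
  next
    case (Suc k)
    then have IH: "eqv k w t" and kd: "k < d" by auto
    have "\<exists>u'\<in>pts t. eqv k v u'" if v: "v \<in> pts w" for v
    proof -
      consider "v = w" | m where "m \<in> set ms" "v \<in> pts m" using v pw by auto
      then show ?thesis
      proof cases
        case 1
        then show ?thesis using IH by blast
      next
        case 2
        then show ?thesis using le_ptsD[OF le _ kd] by blast
      qed
    qed
    moreover have "\<exists>v\<in>pts w. eqv k t' v" if t': "t' \<in> pts t" for t'
    proof -
      consider "eqv k t' t" | m v where "m \<in> set ms" "v \<in> pts m" "eqv k t' v"
        using cover[OF kd t'] by blast
      then show ?thesis
      proof cases
        case 1
        then have "eqv k t' w" using IH eqv_sym eqv_trans by blast
        then show ?thesis using pts_refl by blast
      next
        case 2
        then show ?thesis unfolding pw by blast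
      qed
    qed
    ultimately show ?case using vw by (auto simp: le_Suc_iff eqv_def[of "Suc k"])
  qed
  then show ?thesis by (simp add: w_def)
qed

text \<open>A point of a kid below \<open>t\<close> is already matched by a point of
  \<open>t\<close> at every level under \<open>d\<close>, so further kids do not disturb the type of
  the root. Arbitrary members of \<open>C d t\<close> can thus be joined under one root of type
  \<open>t\<close>.\<close>

lemma root_extend:
  assumes "eqv d (Node (val t) ms) t" "set ms \<subseteq> set ms'" "\<And>m. m \<in> set ms' \<Longrightarrow> le d m t"
  shows "eqv d (Node (val t) ms') t"
proof (rule root_eqv[OF assms(3)])
  fix k t' assume k: "k < d" "t' \<in> pts t"
  have "le d t (Node (val t) ms)" using assms(1) by (simp add: eqv_def)
  from le_ptsD[OF this k(2,1)] obtain v where v: "v \<in> pts (Node (val t) ms)" "eqv k t' v"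
    by blast
  show "eqv k t' t \<or> (\<exists>m\<in>set ms'. \<exists>v\<in>pts m. eqv k t' v)"
  proof (cases "v = Node (val t) ms")
    case True
    then have "eqv k t' t" using v(2) eqv_mono[OF assms(1)] k eqv_trans by (metis less_imp_le)
    then show ?thesis ..
  next
    case False
    then show ?thesis using v assms(2) by auto
  qed
qed

section \<open>Bisimilarity and finitely generated sets\<close>

definition bis :: "tree \<Rightarrow> tree \<Rightarrow> bool"
  where "bis t u \<longleftrightarrow> (\<forall>d. eqv d t u)"

definition cone :: "tree \<Rightarrow> tree set"
  where "cone t = {u. \<exists>v\<in>pts t. bis u v}"

lemma bis_refl [simp]: "bis t t" by (simp add: bis_def)

lemma bis_sym: "bis t u \<Longrightarrow> bis u t" by (auto simp: bis_def intro: eqv_sym)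

lemma bis_trans: "bis t u \<Longrightarrow> bis u v \<Longrightarrow> bis t v"
  unfolding bis_def using eqv_trans by blast

lemma cone_self [simp]: "t \<in> cone t" by (auto simp: cone_def intro: bis_refl)

lemma cone_pts: "u \<in> pts t \<Longrightarrow> u \<in> cone t" by (auto simp: cone_def intro: bis_refl)

lemma finite_separate:
  assumes "finite S"
  shows "\<exists>D. \<forall>u\<in>S. \<forall>v\<in>S. eqv D u v \<longrightarrow> bis u v"
proof -
  have "\<exists>k. eqv k (fst p) (snd p) \<longrightarrow> bis (fst p) (snd p)" for p
    unfolding bis_def by blast
  then obtain K where K: "\<And>p. eqv (K p) (fst p) (snd p) \<Longrightarrow> bis (fst p) (snd p)" by metis
  show ?thesis
  proof (intro exI ballI impI)
    \<comment> \<open>The sum serves as a common upper bound of the separating levels of all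
      pairs.\<close>
    fix u v assume uv: "u \<in> S" "v \<in> S" and e: "eqv (sum K (S \<times> S)) u v"
    have "K (u, v) \<le> sum K (S \<times> S)"
      using assms uv by (intro member_le_sum) auto
    then show "bis u v" using K[of "(u, v)"] eqv_mono[OF e] by simp
  qed
qed

text \<open>This yields the characteristic formula of a finite tree. Level \<open>D\<close>
  separates the points of \<open>t\<close>. With two levels more, every point of \<open>u\<close>
  has a partner in \<open>t\<close> at level \<open>Suc D\<close>, so equivalence at level
  \<open>D\<close> between points of \<open>u\<close> and of \<open>t\<close> already gives
  equivalence at level \<open>Suc D\<close>, and matchings propagate to all levels.\<close>

lemma cone_eq_C: "\<exists>d. cone t = C d t"
proof -
  obtain D where D: "\<And>u v. u \<in> pts t \<Longrightarrow> v \<in> pts t \<Longrightarrow> eqv D u v \<Longrightarrow> bis u v"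
    using finite_separate[of "pts t"] by blast
  have "u \<in> cone t" if u: "le (Suc (Suc D)) u t" for u
  proof -
    have a: "\<exists>s\<in>pts t. eqv (Suc D) u' s" if "u' \<in> pts u" for u'
      using u that by (auto simp: le_Suc_iff[of "Suc D"])
    have b: "eqv (Suc D) x y" if xy: "eqv D x y" "x \<in> pts u" "y \<in> pts t" for x y
    proof -
      obtain s where s: "s \<in> pts t" "eqv (Suc D) x s" using a xy by blast
      then have "eqv D s y" using eqv_mono[of "Suc D" x s D] xy eqv_sym eqv_trans
        by (metis lessI less_imp_le)
      then have "bis s y" using D s xy by blast
      then show ?thesis using s eqv_trans unfolding bis_def by blast
    qed
    have c: "\<forall>x\<in>pts u. \<forall>y\<in>pts t. eqv (Suc D) x y \<longrightarrow> eqv k x y" for k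
    proof (induction k)
      case 0
      show ?case using eqv_mono[of "Suc D" _ _ 0] by simp
    next
      case (Suc k)
      show ?case
      proof (intro ballI impI)
        fix x y assume x: "x \<in> pts u" and y: "y \<in> pts t" and e: "eqv (Suc D) x y"
        have "\<exists>y'\<in>pts y. eqv k x' y'" if x': "x' \<in> pts x" for x'
        proof -
          obtain y' where y': "y' \<in> pts y" "eqv D x' y'"
            using e x' by (auto simp: eqv_def[of "Suc D"] le_Suc_iff)
          have "x' \<in> pts u" "y' \<in> pts t" using x x' y y'(1) pts_trans by auto
          then have "eqv k x' y'" using b[OF y'(2)] Suc by auto
          then show ?thesis using y'(1) by auto
        qed
        moreover have "\<exists>x'\<in>pts x. eqv k y' x'" if y': "y' \<in> pts y" for y'
        proof -
          obtain x' where x': "x' \<in> pts x" "eqv D y' x'"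
            using e y' by (auto simp: eqv_def[of "Suc D"] le_Suc_iff)
          have "x' \<in> pts u" "y' \<in> pts t" using x x'(1) y y' pts_trans by auto
          then have "eqv k x' y'" using b[OF eqv_sym[OF x'(2)]] Suc by auto
          then show ?thesis using x'(1) eqv_sym by auto
        qed
        ultimately show "eqv (Suc k) x y"
          using eqv_val[OF e] by (auto simp: eqv_def[of "Suc k"] le_Suc_iff)
      qed
    qed
    obtain s where "s \<in> pts t" "eqv (Suc D) u s" using a by blast
    then show ?thesis using c unfolding cone_def bis_def by blast
  qed
  moreover have "le d u t" if "u \<in> cone t" for u d
    using that le_pts le_trans unfolding cone_def bis_def eqv_def by blast
  ultimately show ?thesis unfolding C_def by blast
qed

lemma Def_cone [simp]: "Def (cone t)"
  using cone_eq_C Def_C by metis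

lemma Def_cone_subset: "Def X \<Longrightarrow> t \<in> X \<Longrightarrow> cone t \<subseteq> X"
  using le_pts le_trans unfolding cone_def bis_def eqv_def Def_def lvl_closed_def by blast

lemma cone_trans: "u \<in> cone t \<Longrightarrow> cone u \<subseteq> cone t"
  using Def_cone_subset by simp

lemma bis_cone: "bis u v \<Longrightarrow> u \<in> cone v"
  by (auto simp: cone_def)

lemma cone_bis: "bis u v \<Longrightarrow> cone u = cone v"
  using cone_trans bis_cone bis_sym by blast

lemma cone_Node: "cone (Node v ts) = {u. bis u (Node v ts)} \<union> (\<Union>t\<in>set ts. cone t)"
  by (auto simp: cone_def)

text \<open>Membership in \<open>cone t\<close>, decided at level \<open>d\<close>, makes
  \<open>u\<close> bisimilar to some point of \<open>t\<close>; level \<open>D\<close> then forces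
  that point to be bisimilar to the root.\<close>

lemma eqv_imp_bis: "\<exists>D. \<forall>u. eqv D u t \<longrightarrow> bis u t"
proof -
  obtain D where D: "\<And>u v. u \<in> pts t \<Longrightarrow> v \<in> pts t \<Longrightarrow> eqv D u v \<Longrightarrow> bis u v"
    using finite_separate[of "pts t"] by blast
  obtain d where d: "cone t = C d t" using cone_eq_C by blast
  show ?thesis
  proof (intro exI allI impI)
    fix u assume e: "eqv (max D d) u t"
    then have "u \<in> C d t" using le_mono unfolding eqv_def C_def by auto
    then obtain v where v: "v \<in> pts t" "bis u v" using d unfolding cone_def by blast
    have "eqv D v t" using v e eqv_mono[OF e, of D] eqv_sym eqv_trans unfolding bis_def
      by (meson max.cobounded1)
    then show "bis u t" using D v bis_trans by blast
  qed
qed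

text \<open>Proper points find their partners in the cones; the roots are partners of each other by
  induction on the level.\<close>

lemma bisI:
  assumes "val u = val v"
    and "\<And>x. x \<in> pts u \<Longrightarrow> x = u \<or> x \<in> cone v" and "\<And>y. y \<in> pts v \<Longrightarrow> y = v \<or> y \<in> cone u"
  shows "bis u v"
proof -
  have "eqv k u v" for k
  proof (induction k)
    case 0
    then show ?case using assms by (simp add: eqv_def)
  next
    case (Suc k)
    have "\<exists>y\<in>pts v. eqv k x y" if "x \<in> pts u" for x
      using assms(2)[OF that] Suc unfolding cone_def bis_def by blast
    moreover have "\<exists>x\<in>pts u. eqv k y x" if "y \<in> pts v" for y
      using assms(3)[OF that] Suc eqv_sym unfolding cone_def bis_def by blast
    ultimately show ?case using assms(1) by (auto simp: eqv_def[of "Suc k"] le_Suc_iff)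
  qed
  then show ?thesis by (simp add: bis_def)
qed

text \<open>Definable sets are closed downwards and so not under complement. Invariance at some
  level is closed under negation, and \<open>Def_all_pts\<close> turns such a predicate into a
  definable set at the cost of one level. The sets \<open>rho\<close> and \<open>b\<close> below are
  shown definable in this way.\<close>

definition lvl_inv :: "(tree \<Rightarrow> bool) \<Rightarrow> bool"
  where "lvl_inv P \<longleftrightarrow> (\<exists>e. \<forall>u v. eqv e u v \<longrightarrow> P u \<longrightarrow> P v)"

lemma lvl_inv_max:
  assumes "lvl_inv P" "lvl_inv Q"
  obtains e where "\<And>u v. eqv e u v \<Longrightarrow> P u \<Longrightarrow> P v" "\<And>u v. eqv e u v \<Longrightarrow> Q u \<Longrightarrow> Q v"
proof -
  obtain i j where "\<And>u v. eqv i u v \<Longrightarrow> P u \<Longrightarrow> P v" "\<And>u v. eqv j u v \<Longrightarrow> Q u \<Longrightarrow> Q v"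
    using assms unfolding lvl_inv_def by blast
  then show thesis using that[of "max i j"] eqv_mono by (meson max.cobounded1 max.cobounded2)
qed

lemma lvl_inv_conj: "lvl_inv P \<Longrightarrow> lvl_inv Q \<Longrightarrow> lvl_inv (\<lambda>u. P u \<and> Q u)"
  by (erule (1) lvl_inv_max) (unfold lvl_inv_def, blast)

lemma lvl_inv_disj: "lvl_inv P \<Longrightarrow> lvl_inv Q \<Longrightarrow> lvl_inv (\<lambda>u. P u \<or> Q u)"
  by (erule (1) lvl_inv_max) (unfold lvl_inv_def, blast)

lemma lvl_inv_not: "lvl_inv P \<Longrightarrow> lvl_inv (\<lambda>u. \<not> P u)"
  unfolding lvl_inv_def using eqv_sym by blast

lemma lvl_inv_Ball: "finite S \<Longrightarrow> (\<And>y. y \<in> S \<Longrightarrow> lvl_inv (P y)) \<Longrightarrow> lvl_inv (\<lambda>u. \<forall>y\<in>S. P y u)"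
proof (induction S rule: finite_induct)
  case empty
  then show ?case by (auto simp: lvl_inv_def)
next
  case (insert y S)
  then show ?case using lvl_inv_conj[of "P y" "\<lambda>u. \<forall>y\<in>S. P y u"] by simp
qed

lemma lvl_inv_Def: "Def X \<Longrightarrow> lvl_inv (\<lambda>u. u \<in> X)"
  unfolding Def_def lvl_inv_def lvl_closed_def eqv_def by blast

lemma lvl_inv_eqv: "lvl_inv (\<lambda>u. eqv d u t)"
  unfolding lvl_inv_def using eqv_sym eqv_trans by blast

lemma lvl_inv_bis: "lvl_inv (\<lambda>u. bis u t)"
proof -
  obtain D where "\<forall>u. eqv D u t \<longrightarrow> bis u t" using eqv_imp_bis by blast
  then have "\<forall>u v. eqv D u v \<longrightarrow> bis u t \<longrightarrow> bis v t"
    using eqv_sym eqv_trans unfolding bis_def by blast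
  then show ?thesis unfolding lvl_inv_def by blast
qed

lemma lvl_inv_in_cone: "lvl_inv (\<lambda>u. y \<in> cone u)"
proof -
  obtain e where e: "\<And>u v. eqv e u v \<Longrightarrow> bis u y \<Longrightarrow> bis v y"
    using lvl_inv_bis unfolding lvl_inv_def by blast
  have "y \<in> cone v" if uv: "eqv (Suc e) u v" and y: "y \<in> cone u" for u v
  proof -
    obtain u' where u': "u' \<in> pts u" "bis y u'" using y unfolding cone_def by blast
    then obtain v' where "v' \<in> pts v" "eqv e u' v'"
      using uv unfolding eqv_def[of "Suc e"] le_Suc_iff by blast
    then show ?thesis using e u' bis_sym unfolding cone_def by blast
  qed
  then show ?thesis unfolding lvl_inv_def by blast
qed

lemma Def_all_pts:
  assumes "lvl_inv P"
  shows "Def {u. \<forall>x\<in>pts u. P x}"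
proof -
  obtain e where e: "\<And>u v. eqv e u v \<Longrightarrow> P u \<Longrightarrow> P v" using assms unfolding lvl_inv_def by blast
  have "lvl_closed (Suc e) {u. \<forall>x\<in>pts u. P x}"
    unfolding lvl_closed_def le_Suc_iff using e eqv_sym by blast
  then show ?thesis unfolding Def_def by blast
qed

section \<open>Definable sets are the truth sets of formulas\<close>

definition formable :: "tree set \<Rightarrow> bool"
  where "formable X \<longleftrightarrow> (\<exists>\<phi>\<in>F n. X = {t. t \<tturnstile> \<phi>})"

lemma formable_Un: "formable X \<Longrightarrow> formable Y \<Longrightarrow> formable (X \<union> Y)"
proof -
  assume "formable X" "formable Y"
  then obtain \<phi> \<psi> where "\<phi> \<in> F n" "\<psi> \<in> F n" "X = {t. t \<tturnstile> \<phi>}" "Y = {t. t \<tturnstile> \<psi>}"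
    unfolding formable_def by blast
  then show ?thesis unfolding formable_def by (intro bexI[of _ "Or \<phi> \<psi>"]) (auto simp: F_def)
qed

lemma formable_Int: "formable X \<Longrightarrow> formable Y \<Longrightarrow> formable (X \<inter> Y)"
proof -
  assume "formable X" "formable Y"
  then obtain \<phi> \<psi> where "\<phi> \<in> F n" "\<psi> \<in> F n" "X = {t. t \<tturnstile> \<phi>}" "Y = {t. t \<tturnstile> \<psi>}"
    unfolding formable_def by blast
  then show ?thesis unfolding formable_def by (intro bexI[of _ "And \<phi> \<psi>"]) (auto simp: F_def)
qed

lemma formable_imp: "formable X \<Longrightarrow> formable Y \<Longrightarrow> formable {t. \<forall>u\<in>pts t. u \<in> X \<longrightarrow> u \<in> Y}"
proof -
  assume "formable X" "formable Y"
  then obtain \<phi> \<psi> where "\<phi> \<in> F n" "\<psi> \<in> F n" "X = {t. t \<tturnstile> \<phi>}" "Y = {t. t \<tturnstile> \<psi>}"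
    unfolding formable_def by blast
  then show ?thesis unfolding formable_def by (intro bexI[of _ "Imp \<phi> \<psi>"]) (auto simp: F_def)
qed

lemma formable_empty: "formable {}"
  unfolding formable_def by (intro bexI[of _ Bot]) (auto simp: F_def)

lemma formable_UNIV: "formable UNIV"
  unfolding formable_def by (intro bexI[of _ Top]) (auto simp: F_def)

lemma formable_Union: "finite \<X> \<Longrightarrow> \<forall>X\<in>\<X>. formable X \<Longrightarrow> formable (\<Union>\<X>)"
  by (induction \<X> rule: finite_induct) (auto intro: formable_empty formable_Un)

lemma formable_Inter: "finite \<X> \<Longrightarrow> \<forall>X\<in>\<X>. formable X \<Longrightarrow> formable (\<Inter>\<X>)"
  by (induction \<X> rule: finite_induct) (auto intro: formable_UNIV formable_Int)

lemma formable_val: "formable {u. val t \<subseteq> val u}"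
proof -
  have "formable {u. u \<tturnstile> Var i}" if "i \<in> val t" for i
    unfolding formable_def using that by (intro bexI[of _ "Var i"]) (auto simp: F_def val_def)
  then have "formable (\<Inter>((\<lambda>i. {u. u \<tturnstile> Var i}) ` val t))"
    by (intro formable_Inter) auto
  moreover have "{u. val t \<subseteq> val u} = (\<Inter>((\<lambda>i. {u. u \<tturnstile> Var i}) ` val t))"
    by (auto simp: val_def)
  ultimately show ?thesis by simp
qed

text \<open>A tree is below \<open>t\<close> at level \<open>Suc d\<close> if it forces the
  generators forced by \<open>t\<close> and avoids every \<open>d\<close>-type absent from
  \<open>t\<close>. There are finitely many such types, and avoiding the type of \<open>s\<close> is
  the implication from \<open>C d s\<close> to \<open>lower d s\<close>.\<close>

lemma formable_C: "formable (C d t)"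
proof (induction d arbitrary: t)
  case 0
  show ?case using formable_val by (simp add: C_def)
next
  case (Suc d)
  have lower: "formable (lower d s)" for s
  proof -
    have "formable (\<Union>(C d ` lower d s))"
      using Suc finite_C_image by (intro formable_Union) auto
    then show ?thesis using lvl_closed_eq_Union[OF lvl_closed_lower] by metis
  qed
  have avoid: "formable {u. \<forall>x\<in>pts u. \<not> eqv d x s}" for s
  proof -
    have "{u. \<forall>x\<in>pts u. \<not> eqv d x s} = {u. \<forall>x\<in>pts u. x \<in> C d s \<longrightarrow> x \<in> lower d s}"
      by (auto simp: C_def lower_def eqv_def)
    then show ?thesis using formable_imp[OF Suc lower] by simp
  qed
  obtain R where R: "finite R" "\<And>t. \<exists>r\<in>R. eqv d t r" using finite_eqv by blast
  let ?R = "{s\<in>R. \<forall>x\<in>pts t. \<not> eqv d x s}"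
  have "C (Suc d) t = {u. val t \<subseteq> val u} \<inter> \<Inter>((\<lambda>s. {u. \<forall>x\<in>pts u. \<not> eqv d x s}) ` ?R)"
    (is "_ = ?rhs")
  proof
    show "C (Suc d) t \<subseteq> ?rhs"
      unfolding C_def le_Suc_iff using eqv_sym eqv_trans by blast
    show "?rhs \<subseteq> C (Suc d) t"
    proof
      fix u assume u: "u \<in> ?rhs"
      have "\<exists>t'\<in>pts t. eqv d x t'" if "x \<in> pts u" for x
      proof -
        obtain s where "s \<in> R" "eqv d x s" using R by blast
        then have "s \<notin> ?R" using u that by blast
        then show ?thesis using \<open>s \<in> R\<close> \<open>eqv d x s\<close> eqv_sym eqv_trans by blast
      qed
      then show "u \<in> C (Suc d) t" using u by (auto simp: C_def le_Suc_iff)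
    qed
  qed
  moreover have "formable ?rhs"
    using formable_val avoid R by (intro formable_Int formable_Inter) auto
  ultimately show ?case by simp
qed

lemma formable_iff_Def: "formable X \<longleftrightarrow> Def X"
proof
  assume "Def X"
  then obtain d where "lvl_closed d X" unfolding Def_def by blast
  then have "X = \<Union>(C d ` X)" by (rule lvl_closed_eq_Union)
  moreover have "formable (\<Union>(C d ` X))"
    using formable_C finite_C_image by (intro formable_Union) auto
  ultimately show "formable X" by simp
next
  have "Def {t. t \<tturnstile> \<phi>}" if "\<phi> \<in> F n" for \<phi>
    using that
  proof (induction \<phi>)
    case (Var i)
    then have "{t. t \<tturnstile> Var i} = {t. i \<in> val t}" by (auto simp: val_def F_def)
    then have "lvl_closed 0 {t. t \<tturnstile> Var i}" by (auto simp: lvl_closed_def)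
    then show ?case unfolding Def_def by blast
  next
    case Bot
    then show ?case by (auto simp: Def_def lvl_closed_def)
  next
    case Top
    then show ?case by (auto simp: Def_def lvl_closed_def)
  next
    case (And \<phi> \<psi>)
    then show ?case using Def_Int by (auto simp: F_def Collect_conj_eq)
  next
    case (Or \<phi> \<psi>)
    then show ?case using Def_Un by (auto simp: F_def Collect_disj_eq)
  next
    case (Imp \<phi> \<psi>)
    then have "Def {t. t \<tturnstile> \<phi>}" "Def {t. t \<tturnstile> \<psi>}" by (auto simp: F_def)
    from this[THEN lvl_inv_Def]
    have "lvl_inv (\<lambda>u. \<not> u \<tturnstile> \<phi> \<or> u \<tturnstile> \<psi>)"
      by (intro lvl_inv_disj lvl_inv_not) auto
    from Def_all_pts[OF this] show ?case by simp
  qed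
  then show "formable X \<Longrightarrow> Def X" by (auto simp: formable_def)
qed

end

section \<open>Join-irreducible definable sets\<close>

context gens
begin

text \<open>Bounds are taken in genuine cones and not at a level, so the notion is independent of
  the depth at which \<open>X\<close> is viewed. Nonempty directed sets are prime: inside a finite
  union of definable sets they lie inside one of them.\<close>

definition directed :: "tree set \<Rightarrow> bool"
  where "directed X \<longleftrightarrow> (\<forall>u\<in>X. \<forall>v\<in>X. \<exists>w\<in>X. u \<in> cone w \<and> v \<in> cone w)"

definition JJ :: "tree set set"
  where "JJ = {X. X \<noteq> {} \<and> Def X \<and> directed X}"

definition JJ1 :: "tree set set"
  where "JJ1 = {X \<in> JJ. finite {Y \<in> JJ. Y \<noteq> X \<and> Y \<subseteq> X}}"

definition JJ2 :: "tree set set"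
  where "JJ2 = {X \<in> JJ - JJ1. \<forall>Y\<in>JJ - JJ1. Y \<subseteq> X \<longrightarrow> Y = X}"

definition JJ3 :: "tree set set"
  where "JJ3 = JJ - (JJ1 \<union> JJ2)"

lemma Def_lower [simp]: "Def (lower d t)"
  using lvl_closed_lower unfolding Def_def by blast

lemma JJ_Def: "X \<in> JJ \<Longrightarrow> Def X"
  by (simp add: JJ_def)

lemma JJ_ne: "X \<in> JJ \<Longrightarrow> X \<noteq> {}"
  by (simp add: JJ_def)

lemma JJ_subset_Un:
  assumes "X \<in> JJ" "Def Y" "Def Z" "X \<subseteq> Y \<union> Z"
  shows "X \<subseteq> Y \<or> X \<subseteq> Z"
proof (rule ccontr)
  assume "\<not> (X \<subseteq> Y \<or> X \<subseteq> Z)"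
  then obtain u v where uv: "u \<in> X" "u \<notin> Y" "v \<in> X" "v \<notin> Z" by blast
  then obtain w where w: "w \<in> X" "u \<in> cone w" "v \<in> cone w"
    using assms(1) unfolding JJ_def directed_def by blast
  have "w \<notin> Y" using Def_cone_subset[OF assms(2)] w uv by blast
  moreover have "w \<notin> Z" using Def_cone_subset[OF assms(3)] w uv by blast
  ultimately show False using w assms(4) by blast
qed

lemma JJ_subset_Union:
  assumes "X \<in> JJ" "finite \<Y>" "\<And>Y. Y \<in> \<Y> \<Longrightarrow> Def Y" "X \<subseteq> \<Union>\<Y>"
  shows "\<exists>Y\<in>\<Y>. X \<subseteq> Y"
  using assms(2,3,4)
proof (induction \<Y> rule: finite_induct)
  case empty
  then show ?case using JJ_ne[OF assms(1)] by simp
next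
  case (insert Y \<Y>)
  have "X \<subseteq> Y \<or> X \<subseteq> \<Union>\<Y>"
    using insert.prems insert.hyps by (intro JJ_subset_Un[OF assms(1)] Def_Union) auto
  then show ?case using insert by auto
qed

text \<open>\<open>X\<close> is a union of finitely many principal sets of level \<open>d\<close>,
  and primeness singles out one. Any level at which \<open>X\<close> is closed will do, so the level
  can be adapted to finitely many other sets.\<close>

lemma JJ_eq_C:
  assumes "X \<in> JJ" "lvl_closed d X"
  shows "\<exists>t\<in>X. X = C d t"
proof -
  have "X \<subseteq> \<Union>(C d ` X)" using lvl_closed_eq_Union[OF assms(2)] by simp
  then have "\<exists>Y\<in>C d ` X. X \<subseteq> Y"
    by (rule JJ_subset_Union[OF assms(1) finite_C_image, rotated]) auto
  then obtain t where "t \<in> X" "X \<subseteq> C d t" by auto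
  then show ?thesis using lvl_closed_C_subset[OF assms(2)] by blast
qed

lemma C_JJ [simp]: "C d t \<in> JJ"
proof -
  have "\<exists>w\<in>C d t. u \<in> cone w \<and> v \<in> cone w" if "u \<in> C d t" "v \<in> C d t" for u v
  proof
    \<comment> \<open>Keeping \<open>t\<close> itself among the kids makes the covering condition
      trivial.\<close>
    have "eqv d (Node (val t) [t, u, v]) t"
    proof (rule root_eqv)
      fix k t' assume "t' \<in> pts t"
      then have "\<exists>y\<in>pts t. eqv k t' y" using eqv_refl by blast
      then show "eqv k t' t \<or> (\<exists>m\<in>set [t, u, v]. \<exists>y\<in>pts m. eqv k t' y)" by simp
    qed (use that in \<open>auto simp: C_def\<close>)
    then show "Node (val t) [t, u, v] \<in> C d t" by (simp add: C_def eqv_def)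
    show "u \<in> cone (Node (val t) [t, u, v]) \<and> v \<in> cone (Node (val t) [t, u, v])"
      by (auto simp: cone_Node)
  qed
  moreover have "C d t \<noteq> {}" using C_self by blast
  ultimately show ?thesis by (simp add: JJ_def directed_def)
qed

lemma cone_JJ [simp]: "cone t \<in> JJ"
  using cone_eq_C C_JJ by metis

text \<open>A definable set is invariant under bisimilarity, so inside \<open>cone s\<close> it is
  determined by the points of \<open>s\<close> that it contains.\<close>

lemma finite_below_cone: "finite {Y. Def Y \<and> Y \<subseteq> cone s}"
proof (rule finite_subset)
  let ?f = "\<lambda>S. {u. \<exists>v\<in>S. bis u v}"
  show "{Y. Def Y \<and> Y \<subseteq> cone s} \<subseteq> ?f ` Pow (pts s)"
  proof
    fix Y assume "Y \<in> {Y. Def Y \<and> Y \<subseteq> cone s}"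
    then have Y: "Def Y" "Y \<subseteq> cone s" by auto
    have "Y = ?f (pts s \<inter> Y)"
    proof
      show "Y \<subseteq> ?f (pts s \<inter> Y)"
      proof
        fix u assume u: "u \<in> Y"
        then obtain v where v: "v \<in> pts s" "bis u v" using Y(2) unfolding cone_def by blast
        then have "v \<in> Y" using Def_cone_subset[OF Y(1) u] bis_cone[OF bis_sym] by blast
        then show "u \<in> ?f (pts s \<inter> Y)" using v by blast
      qed
      show "?f (pts s \<inter> Y) \<subseteq> Y" using Def_cone_subset[OF Y(1)] bis_cone by blast
    qed
    then show "Y \<in> ?f ` Pow (pts s)" by blast
  qed
qed simp

text \<open>If few irreducibles lie below \<open>X\<close>, then \<open>X\<close> is the union of
  finitely many cones and, being prime, lies in one of them. Counting is thereby replaced by a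
  containment that smaller sets inherit.\<close>

lemma JJ1_iff:
  assumes "X \<in> JJ"
  shows "X \<in> JJ1 \<longleftrightarrow> (\<exists>s. X \<subseteq> cone s)"
proof
  assume "X \<in> JJ1"
  then have "finite (insert X {Y \<in> JJ. Y \<noteq> X \<and> Y \<subseteq> X})" unfolding JJ1_def by simp
  moreover have "cone ` X \<subseteq> insert X {Y \<in> JJ. Y \<noteq> X \<and> Y \<subseteq> X}"
    using Def_cone_subset[OF JJ_Def[OF assms]] by auto
  ultimately have "finite (cone ` X)" by (rule finite_subset[rotated])
  from JJ_subset_Union[OF assms this] show "\<exists>s. X \<subseteq> cone s" using cone_self by fastforce
next
  assume "\<exists>s. X \<subseteq> cone s"
  then obtain s where "X \<subseteq> cone s" ..
  then have "{Y \<in> JJ. Y \<noteq> X \<and> Y \<subseteq> X} \<subseteq> {Y. Def Y \<and> Y \<subseteq> cone s}" using JJ_Def by blast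
  then show "X \<in> JJ1" unfolding JJ1_def using assms finite_below_cone finite_subset by blast
qed

lemma infinite_up: "X \<in> JJ - JJ1 \<Longrightarrow> Y \<in> JJ \<Longrightarrow> X \<subseteq> Y \<Longrightarrow> Y \<in> JJ - JJ1"
  using JJ1_iff[of X] JJ1_iff[of Y] by (meson Diff_iff order_trans)

lemma JJ2_minimal: "X \<in> JJ2 \<Longrightarrow> Y \<in> JJ - JJ1 \<Longrightarrow> Y \<subseteq> X \<Longrightarrow> Y = X"
  by (simp add: JJ2_def)

lemma JJ3_up:
  assumes "X \<in> JJ3" "Y \<in> JJ" "X \<subseteq> Y"
  shows "Y \<in> JJ3"
proof -
  have X: "X \<in> JJ - JJ1" "X \<notin> JJ2" using assms(1) by (auto simp: JJ3_def)
  then have "Y \<in> JJ - JJ1" using infinite_up assms by simp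
  moreover have "Y \<notin> JJ2" using JJ2_minimal[of Y X] X assms(3) by auto
  ultimately show ?thesis by (simp add: JJ3_def)
qed

lemma JJ3_JJ: "X \<in> JJ3 \<Longrightarrow> X \<in> JJ"
  by (simp add: JJ3_def)

lemma JJ2_JJ: "X \<in> JJ2 \<Longrightarrow> X \<in> JJ - JJ1"
  by (simp add: JJ2_def)

lemma JJ3_I:
  assumes "Y \<in> JJ2" "Y \<subseteq> X" "X \<noteq> Y" "X \<in> JJ"
  shows "X \<in> JJ3"
proof -
  have "X \<in> JJ - JJ1" using infinite_up[OF JJ2_JJ] assms by simp
  moreover have "X \<notin> JJ2" using JJ2_minimal[of X Y] JJ2_JJ assms by auto
  ultimately show ?thesis by (simp add: JJ3_def)
qed

section \<open>The Rieger--Nishimura ladder\<close>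

text \<open>From index 3 on, each point sees its second and third predecessors but not the first.
  Index 0 is the extra point \<open>x\<close>; all others carry the label \<open>v\<close> and lie
  over the base \<open>ms\<close>.\<close>

fun ladder :: "nat set \<Rightarrow> tree list \<Rightarrow> tree \<Rightarrow> nat \<Rightarrow> tree" where
  "ladder v ms x 0 = x"
| "ladder v ms x (Suc 0) = Node v ms"
| "ladder v ms x (Suc (Suc 0)) = Node v (x # ms)"
| "ladder v ms x (Suc (Suc (Suc k))) = Node v (ladder v ms x (Suc k) # ladder v ms x k # ms)"

end

text \<open>The base \<open>ms\<close> alone gives a root the type of \<open>t\<close>, so all roots
  put over it within \<open>C d t\<close> have this type too. The point \<open>x\<close> is minimal
  outside the base and adds a single bisimilarity class to \<open>N\<close>.\<close>

locale RN = gens +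
  fixes d :: nat and t :: tree and ms :: "tree list" and x :: tree
  assumes ms: "set ms \<subseteq> lower d t"
    and root: "eqv d (Node (val t) ms) t"
    and x: "x \<in> lower d t"
    and x_new: "x \<notin> (\<Union>m\<in>set ms. cone m)"
    and x_pts: "\<And>y. y \<in> pts x \<Longrightarrow> y \<noteq> x \<Longrightarrow> y \<in> (\<Union>m\<in>set ms. cone m)"
begin

abbreviation r :: "nat \<Rightarrow> tree"
  where "r \<equiv> ladder (val t) ms x"

abbreviation N :: "tree set"
  where "N \<equiv> \<Union>m\<in>set ms. cone m"

text \<open>The condition is imposed on all points to make the set definable. Requiring all of
  \<open>ms\<close> below each point of type \<open>t\<close> excludes points over a mere part of
  the base, so that \<open>N\<close> and the ladder exhaust the set.\<close>

definition rho :: "tree set"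
  where "rho = {u. le d u t \<and>
    (\<forall>v\<in>pts u. v \<in> N \<union> cone x \<or> eqv d v t \<and> (\<forall>m\<in>set ms. m \<in> cone v))}"

lemma N_lower: "N \<union> cone x \<subseteq> lower d t"
proof -
  have "cone m \<subseteq> lower d t" if "m \<in> set ms" for m
    using that ms by (intro Def_cone_subset Def_lower) auto
  then show ?thesis using Def_cone_subset[OF Def_lower x] by auto
qed

lemma Def_N: "Def N"
  by (rule Def_Union) auto

lemma Def_Nx: "Def (N \<union> cone x)"
  using Def_N by (simp add: Def_Un)

lemma cone_x: "cone x \<subseteq> N \<union> {u. bis u x}"
proof
  fix u assume "u \<in> cone x"
  then obtain y where y: "y \<in> pts x" "bis u y" unfolding cone_def by blast
  show "u \<in> N \<union> {u. bis u x}"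
  proof (cases "y = x")
    case False
    then have "y \<in> N" using x_pts y by blast
    then have "cone y \<subseteq> N" using Def_cone_subset[OF Def_N] by blast
    then show ?thesis using bis_cone y by blast
  qed (use y in simp)
qed

lemma r_all: "le d (r k) t \<and> (k > 0 \<longrightarrow> eqv d (r k) t)"
proof (induction k rule: less_induct)
  case (less k)
  have msle: "le d m t" if "m \<in> set ms" for m using ms that by (auto simp: lower_def)
  have xle: "le d x t" using x by (simp add: lower_def)
  consider "k = 0" | "k = Suc 0" | "k = Suc (Suc 0)" | j where "k = Suc (Suc (Suc j))"
    by (metis not0_implies_Suc)
  then show ?case
  proof cases
    case 1
    then show ?thesis using xle by simp
  next
    case 2
    then show ?thesis using root by (simp add: eqv_def)
  next
    case 3
    have "eqv d (Node (val t) (x # ms)) t"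
      by (rule root_extend[OF root]) (auto simp: msle xle)
    then show ?thesis using 3 by (simp add: eqv_def)
  next
    case (4 j)
    have "le d (r (Suc j)) t" "le d (r j) t" using less 4 by auto
    then have "eqv d (Node (val t) (r (Suc j) # r j # ms)) t"
      by (intro root_extend[OF root]) (auto simp: msle)
    then show ?thesis using 4 by (simp add: eqv_def)
  qed
qed

lemma r_val: "k > 0 \<Longrightarrow> val (r k) = val t"
  using r_all eqv_val by blast

lemma r_pos_not_lower: "k > 0 \<Longrightarrow> r k \<notin> lower d t"
  using r_all by (simp add: lower_def eqv_def)

lemma cone_r_Suc3: "cone (r (Suc (Suc (Suc k)))) =
    {u. bis u (r (Suc (Suc (Suc k))))} \<union> (cone (r (Suc k)) \<union> cone (r k) \<union> N)"
  by (simp add: cone_Node Un_assoc)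

lemma r_in_pts: "j + 2 \<le> k \<Longrightarrow> r j \<in> pts (r k)"
proof (induction k rule: less_induct)
  case (less k)
  consider "k = Suc (Suc 0)" | i where "k = Suc (Suc (Suc i))"
    using less.prems by (metis add_2_eq_Suc' le_zero_eq nat.distinct(1) not0_implies_Suc not_less_eq_eq)
  then show ?case
  proof cases
    case 1
    then have "j = 0" using less.prems by simp
    then show ?thesis using 1 by simp
  next
    case (2 i)
    consider "j = Suc i" | "j = i" | "j + 2 \<le> Suc i" using less.prems 2 by linarith
    then show ?thesis
    proof cases
      case 3
      then have "r j \<in> pts (r (Suc i))" using less.IH[of "Suc i"] 2 by simp
      then show ?thesis using 2 by simp
    qed (use 2 in simp_all)
  qed
qed

lemma ms_in_cone_r: "k > 0 \<Longrightarrow> m \<in> set ms \<Longrightarrow> m \<in> cone (r k)"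
proof -
  assume "k > 0" "m \<in> set ms"
  then have "m \<in> pts (r k)"
    by (cases "(val t, ms, x, k)" rule: ladder.cases) auto
  then show ?thesis by (rule cone_pts)
qed

text \<open>The two claims support each other. If \<open>r (i + 3)\<close> were under an earlier
  \<open>r j\<close>, so would be \<open>r (i + 1)\<close> and \<open>r i\<close>. The first claim
  excludes every \<open>j\<close> before \<open>i + 1\<close>, and the second excludes
  \<open>i + 1\<close> and \<open>i + 2\<close>.\<close>

lemma r_distinct:
  "(\<forall>j<k. r k \<notin> cone (r j)) \<and> (k > 0 \<longrightarrow> r (k - 1) \<notin> cone (r k))"
proof (induction k rule: less_induct)
  case (less k)
  have IH1: "r i \<notin> cone (r j)" if "i < k" "j < i" for i j using less that by blast
  have IH2: "r i \<notin> cone (r (Suc i))" if "Suc i < k" for i using less[OF that] by simp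
  have rx: "r 0 = x" by simp
  have posN: "r i \<notin> N \<union> cone x" if "i > 0" for i using r_pos_not_lower[OF that] N_lower by blast
  have x1: "x \<notin> cone (r 1)"
  proof -
    have "\<not> bis x (r 1)"
    proof
      assume "bis x (r 1)"
      then have "cone (r 1) = cone x" using cone_bis by blast
      then show False using posN[of 1] cone_self[of "r 1"] by simp
    qed
    then show ?thesis using x_new by (auto simp: cone_Node)
  qed
  consider "k = 0" | "k = Suc 0" | "k = Suc (Suc 0)" | i where "k = Suc (Suc (Suc i))"
    by (metis not0_implies_Suc)
  then show ?case
  proof cases
    case 1
    then show ?thesis by simp
  next
    case 2
    then show ?thesis using posN[of 1] x1 by auto
  next
    case 3
    have "x \<in> cone (r 2)" using r_in_pts[of 0 2] cone_pts by simp
    then have a: "r 2 \<notin> cone (r 1)" using x1 cone_trans[of "r 2" "r 1"] by blast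
    have b: "r 1 \<notin> cone (r 2)"
    proof
      assume "r 1 \<in> cone (r 2)"
      moreover have "cone (r 2) = {u. bis u (r 2)} \<union> (cone x \<union> N)"
        by (simp add: numeral_2_eq_2 cone_Node)
      ultimately have "bis (r 1) (r 2)" using posN[of 1] by auto
      then show False using a bis_cone bis_sym by blast
    qed
    have "r 2 \<notin> cone (r 0)" using posN[of 2] by simp
    then show ?thesis using a b 3 by (auto simp: numeral_2_eq_2 less_Suc_eq)
  next
    case (4 i)
    have in1: "r (Suc i) \<in> cone (r k)" and in2: "r i \<in> cone (r k)"
      using r_in_pts cone_pts 4 by simp_all
    have a: "r k \<notin> cone (r j)" if jk: "j < k" for j
    proof
      assume "r k \<in> cone (r j)"
      then have sub: "r (Suc i) \<in> cone (r j)" "r i \<in> cone (r j)" using cone_trans in1 in2 by blast+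
      consider "j < Suc i" | "j = Suc i" | "j = Suc (Suc i)" using jk 4 by linarith
      then show False
      proof cases
        case 1
        then show False using IH1[of "Suc i" j] sub 4 by simp
      next
        case 2
        then show False using IH2[of i] sub 4 by simp
      next
        case 3
        then show False using IH2[of "Suc i"] sub 4 by simp
      qed
    qed
    have "r (Suc (Suc i)) \<notin> cone (r k)"
    proof
      assume "r (Suc (Suc i)) \<in> cone (r k)"
      moreover have "r (Suc (Suc i)) \<notin> cone (r (Suc i))" "r (Suc (Suc i)) \<notin> cone (r i)"
        using IH1 4 by simp_all
      moreover have "r (Suc (Suc i)) \<notin> N" using posN by blast
      ultimately have "bis (r (Suc (Suc i))) (r k)"
        using cone_r_Suc3[of i] 4 by blast
      then show False using a[of "Suc (Suc i)"] bis_cone bis_sym 4 by blast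
    qed
    then show ?thesis using a 4 by simp
  qed
qed

lemma r_inj: "bis (r i) (r j) \<Longrightarrow> i = j"
  using r_distinct[of i] r_distinct[of j] bis_cone bis_sym by (metis linorder_neqE_nat)

lemma finite_r_class: "finite {j. bis v (r j)}"
proof (cases "\<exists>i. bis v (r i)")
  case True
  then obtain i where i: "bis v (r i)" ..
  have "j = i" if "bis v (r j)" for j using r_inj[OF bis_trans[OF bis_sym[OF that] i]] .
  then have "{j. bis v (r j)} \<subseteq> {i}" by auto
  then show ?thesis by (rule finite_subset) simp
qed simp

lemma r_cover_all: "u \<in> N \<union> {v. bis v (r j)} \<Longrightarrow> j + 2 \<le> k \<Longrightarrow> u \<in> cone (r k)"
proof -
  assume u: "u \<in> N \<union> {v. bis v (r j)}" and jk: "j + 2 \<le> k"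
  show "u \<in> cone (r k)"
  proof (cases "u \<in> N")
    case True
    then obtain m where "m \<in> set ms" "u \<in> cone m" by blast
    then show ?thesis using ms_in_cone_r[of k m] cone_trans[of m "r k"] jk by auto
  next
    case False
    then have "u \<in> cone (r j)" using u bis_cone by blast
    moreover have "r j \<in> cone (r k)" using r_in_pts[OF jk] cone_pts by blast
    ultimately show ?thesis using cone_trans by blast
  qed
qed

lemma r_in_rho: "r k \<in> rho"
proof (induction k rule: less_induct)
  case (less k)
  have below: "v \<in> N \<union> cone x \<or> eqv d v t \<and> (\<forall>m\<in>set ms. m \<in> cone v)"
    if "v \<in> pts (r j)" "j < k" for v j using less[OF that(2)] that(1) unfolding rho_def by blast
  have "v \<in> N \<union> cone x \<or> eqv d v t \<and> (\<forall>m\<in>set ms. m \<in> cone v)" if v: "v \<in> pts (r k)" for v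
  proof (cases "v = r k \<and> k > 0")
    case True
    then show ?thesis using r_all[of k] ms_in_cone_r[of k] by auto
  next
    case False
    then consider "v \<in> pts x" | m where "m \<in> set ms" "v \<in> pts m" | j where "j < k" "v \<in> pts (r j)"
    proof (cases "(val t, ms, x, k)" rule: ladder.cases)
      case (4 v' ms' x' i)
      then have "v \<in> pts (r (Suc i)) \<or> v \<in> pts (r i) \<or> (\<exists>m\<in>set ms. v \<in> pts m)"
        using v False by auto
      moreover have "Suc i < k" "i < k" using 4 by auto
      ultimately show ?thesis using that by metis
    qed (use that v False in auto)
    then show ?thesis using below cone_pts by cases blast+
  qed
  then show ?case using r_all unfolding rho_def by blast
qed

lemma rho_pts: "u \<in> rho \<Longrightarrow> v \<in> pts u \<Longrightarrow> v \<in> rho"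
  unfolding rho_def using pts_trans le_pts le_trans by blast

text \<open>By induction on the size, the points strictly below \<open>u\<close> are in
  \<open>N\<close> or on the ladder. So \<open>u\<close> is determined by the set \<open>K\<close>
  of ladder indices below it, and of \<open>K\<close> it is enough to know the maximum and whether
  the preceding index occurs.\<close>

lemma rho_classify: "u \<in> rho \<Longrightarrow> u \<in> N \<or> (\<exists>k. bis u (r k))"
proof (induction "size u" arbitrary: u rule: less_induct)
  case less
  show ?case
  proof (cases "u \<in> N \<union> cone x")
    case True
    then show ?thesis using cone_x ladder.simps(1)[of "val t" ms x] by (metis UnE mem_Collect_eq subsetD)
  next
    case False
    then have e: "eqv d u t" and mu: "\<And>m. m \<in> set ms \<Longrightarrow> m \<in> cone u"
      using less.prems unfolding rho_def by auto
    have vu: "val (r k) = val u" if "k > 0" for k using eqv_val[OF e] r_val[OF that] by simp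
    define K where "K = {j. \<exists>v\<in>pts u. v \<noteq> u \<and> bis v (r j)}"
    have proper: "v \<in> N \<or> (\<exists>j\<in>K. bis v (r j))" if "v \<in> pts u" "v \<noteq> u" for v
      using less.hyps[of v] rho_pts[OF less.prems that(1)] pts_size[OF that(1)] that
      unfolding K_def by blast
    have K_cone: "r j \<in> cone u" if "j \<in> K" for j
      using that bis_sym unfolding K_def cone_def by blast
    have up: "cone y \<subseteq> cone u" if "y \<in> cone u" for y using cone_trans that by blast
    have match: "bis u (r k)"
      if k: "k > 0" and 1: "\<And>j. j \<in> K \<Longrightarrow> r j \<in> cone (r k)"
        and 2: "\<And>v. v \<in> pts (r k) \<Longrightarrow> v = r k \<or> v \<in> cone u" for k
    proof (rule bisI)
      show "val u = val (r k)" using vu[OF k] by simp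
      show "v = u \<or> v \<in> cone (r k)" if v: "v \<in> pts u" for v
      proof (cases "v = u")
        case False
        from proper[OF v False] show ?thesis
        proof
          assume "v \<in> N"
          then obtain m where "m \<in> set ms" "v \<in> cone m" by blast
          then show ?thesis using ms_in_cone_r[OF k] cone_trans by blast
        next
          assume "\<exists>j\<in>K. bis v (r j)"
          then show ?thesis using 1 cone_trans bis_cone by blast
        qed
      qed simp
    qed (rule 2)
    have ms_up: "v \<in> cone u" if "m \<in> set ms" "v \<in> pts m" for m v
      using up[OF mu[OF that(1)]] cone_pts[OF that(2)] by blast
    have K_up: "v \<in> cone u" if "j \<in> K" "v \<in> pts (r j)" for j v
      using up[OF K_cone[OF that(1)]] cone_pts[OF that(2)] by blast
    have "K \<subseteq> (\<Union>v\<in>pts u. {j. bis v (r j)})" unfolding K_def by blast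
    then have "finite K" using finite_r_class finite_pts by (meson finite_UN finite_subset)
    show ?thesis
    proof (cases "K = {}")
      case True
      have "bis u (r 1)" using True ms_up by (intro match) auto
      then show ?thesis by blast
    next
      case False
      define m where "m = Max K"
      have mK: "m \<in> K" and le_m: "\<And>j. j \<in> K \<Longrightarrow> j \<le> m"
        using \<open>finite K\<close> False by (auto simp: m_def)
      \<comment> \<open>Index 0 is separate because \<open>x\<close> does not have the type of
        \<open>t\<close>, so \<open>u\<close> cannot collapse to it.\<close>
      consider "m = 0" | "m > 0" "m - 1 \<in> K" | "m > 0" "m - 1 \<notin> K" by blast
      then show ?thesis
      proof cases
        case 1
        have "bis u (r 2)"
        proof (rule match)
          show "r j \<in> cone (r 2)" if "j \<in> K" for j
            using le_m[OF that] 1 r_in_pts[of 0 2] cone_pts by simp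
          show "v = r 2 \<or> v \<in> cone u" if "v \<in> pts (r 2)" for v
            using that ms_up K_up[OF mK] 1 by (auto simp: numeral_2_eq_2)
        qed simp
        then show ?thesis by blast
      next
        case 2
        then obtain i where i: "m = Suc i" "i \<in> K" by (cases m) auto
        have "bis u (r (m + 2))"
        proof (rule match)
          show "r j \<in> cone (r (m + 2))" if "j \<in> K" for j
            using le_m[OF that] r_in_pts[of j "m + 2"] cone_pts by simp
          show "v = r (m + 2) \<or> v \<in> cone u" if "v \<in> pts (r (m + 2))" for v
            using that ms_up K_up[OF mK] K_up[OF i(2)] i by auto
        qed simp
        then show ?thesis by blast
      next
        \<comment> \<open>Here the root of \<open>u\<close> is redundant: every other index in
          \<open>K\<close> is at most \<open>m - 2\<close> and hence already under
          \<open>r m\<close>.\<close>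
        case 3
        have "bis u (r m)"
        proof (rule match)
          show "r j \<in> cone (r m)" if "j \<in> K" for j
          proof (cases "j = m")
            case False
            then have "j + 2 \<le> m" using le_m[OF that] that 3
              by (metis Suc_leI add_2_eq_Suc' diff_Suc_1 le_less less_Suc_eq_le not_less_eq_eq)
            then show ?thesis using r_in_pts cone_pts by blast
          qed simp
          show "v = r m \<or> v \<in> cone u" if "v \<in> pts (r m)" for v
            using K_up[OF mK that] by simp
        qed (rule 3)
        then show ?thesis by blast
      qed
    qed
  qed
qed

lemma Def_rho: "Def rho"
proof -
  have "lvl_inv (\<lambda>v. v \<in> N \<union> cone x \<or> eqv d v t \<and> (\<forall>m\<in>set ms. m \<in> cone v))"
    by (intro lvl_inv_disj lvl_inv_conj lvl_inv_Ball lvl_inv_Def lvl_inv_eqv lvl_inv_in_cone Def_Nx) simp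
  from Def_Int[OF Def_C[of d t] Def_all_pts[OF this]] show ?thesis
    unfolding rho_def C_def by (simp add: Collect_conj_eq)
qed

lemma rho_cofinal: "u \<in> rho \<Longrightarrow> \<exists>j. \<forall>k. j + 2 \<le> k \<longrightarrow> u \<in> cone (r k)"
  using rho_classify r_cover_all by blast

lemma rho_JJ: "rho \<in> JJ"
proof -
  have "\<exists>w\<in>rho. u \<in> cone w \<and> v \<in> cone w" if uv: "u \<in> rho" "v \<in> rho" for u v
  proof -
    obtain i j where "\<forall>k. i + 2 \<le> k \<longrightarrow> u \<in> cone (r k)" "\<forall>k. j + 2 \<le> k \<longrightarrow> v \<in> cone (r k)"
      using rho_cofinal uv by meson
    then have "u \<in> cone (r (i + j + 2))" "v \<in> cone (r (i + j + 2))" by auto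
    then show ?thesis using r_in_rho by blast
  qed
  moreover have "rho \<noteq> {}" using r_in_rho by blast
  ultimately show ?thesis using Def_rho by (simp add: JJ_def directed_def)
qed

lemma rho_infinite: "rho \<notin> JJ1"
proof
  assume "rho \<in> JJ1"
  then obtain s where s: "rho \<subseteq> cone s" using JJ1_iff[OF rho_JJ] by blast
  have "k \<in> (\<Union>v\<in>pts s. {k. bis v (r k)})" for k
  proof -
    have "r k \<in> cone s" using s r_in_rho by blast
    then obtain v where "v \<in> pts s" "bis (r k) v" unfolding cone_def by blast
    then show ?thesis using bis_sym by auto
  qed
  then have "UNIV \<subseteq> (\<Union>v\<in>pts s. {k. bis v (r k)})" by auto
  then have "finite (UNIV :: nat set)"
    using finite_r_class finite_pts by (meson finite_UN finite_subset)
  then show False by simp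
qed

text \<open>A definable subset with ladder points of unbounded index contains everything, since
  rungs see all rungs at distance 2 or more below them. Otherwise its indices stop before some
  \<open>j\<close>, and it lies in \<open>cone (r (j + 2))\<close>.\<close>

lemma rho_minimal:
  assumes "Y \<in> JJ - JJ1" "Y \<subseteq> rho"
  shows "Y = rho"
proof -
  have DY: "Def Y" using assms JJ_Def by blast
  have "\<exists>k\<ge>j. r k \<in> Y" for j
  proof (rule ccontr)
    assume A: "\<not> (\<exists>k\<ge>j. r k \<in> Y)"
    have "u \<in> cone (r (j + 2))" if u: "u \<in> Y" for u
    proof -
      have "u \<in> N \<or> (\<exists>k. bis u (r k))" using rho_classify u assms(2) by blast
      then show ?thesis
      proof
        assume "u \<in> N"
        then show ?thesis using r_cover_all[of u j] by blast
      next
        assume "\<exists>k. bis u (r k)"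
        then obtain k where k: "bis u (r k)" ..
        then have "r k \<in> Y" using Def_cone_subset[OF DY u] bis_cone[OF bis_sym] by blast
        then have "k + 2 \<le> j + 2" using A by (meson add_le_mono1 linear)
        then show ?thesis using r_cover_all[of u k] k by blast
      qed
    qed
    then have "Y \<in> JJ1" using JJ1_iff assms by blast
    then show False using assms by blast
  qed
  then have "rho \<subseteq> Y" using rho_cofinal Def_cone_subset[OF DY] by (meson subset_iff)
  then show ?thesis using assms by blast
qed

lemma rho_JJ2: "rho \<in> JJ2"
  unfolding JJ2_def using rho_JJ rho_infinite rho_minimal by blast

text \<open>Points of type \<open>t\<close> are outside \<open>lower d t\<close>, so the finitely
  generated base is all that remains. This later distinguishes a ladder from the sets closed at
  level \<open>d\<close>.\<close>

lemma rho_lower: "rho \<inter> lower d t \<subseteq> N \<union> cone x"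
  unfolding rho_def lower_def eqv_def by auto

lemma rho_C: "rho \<subseteq> C d t"
  unfolding rho_def C_def by auto

end

section \<open>Infinite join-irreducibles\<close>

context gens
begin

lemma JJ1_I:
  assumes "X \<in> JJ" "finite S" "X \<subseteq> \<Union>(cone ` S)"
  shows "X \<in> JJ1"
proof -
  have "\<exists>Y\<in>cone ` S. X \<subseteq> Y"
    using assms by (intro JJ_subset_Union[OF assms(1)]) auto
  then show ?thesis using JJ1_iff[OF assms(1)] by auto
qed

text \<open>One representative of each \<open>d\<close>-type occurring in \<open>lower d t\<close>
  is enough: a point of \<open>t\<close> outside \<open>lower d t\<close> has the type of
  \<open>t\<close> and is matched with the root.\<close>

lemma lower_generators:
  "\<exists>ms. set ms \<subseteq> lower d t \<and> eqv d (Node (val t) ms) t"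
proof -
  obtain R where R: "finite R" "\<And>t. \<exists>r\<in>R. eqv d t r" using finite_eqv by blast
  let ?R = "{r \<in> R. \<exists>m\<in>lower d t. eqv d m r}"
  have "\<forall>r\<in>?R. \<exists>m. m \<in> lower d t \<and> eqv d m r" by blast
  from bchoice[OF this] obtain f where f: "\<forall>r\<in>?R. f r \<in> lower d t \<and> eqv d (f r) r" ..
  have "finite (f ` ?R)" using R(1) by simp
  from finite_list[OF this] obtain ms where ms: "set ms = f ` ?R" ..
  have low: "set ms \<subseteq> lower d t" unfolding ms using f by auto
  have "eqv d (Node (val t) ms) t"
  proof (rule root_eqv)
    show "le d m t" if "m \<in> set ms" for m using that low by (auto simp: lower_def)
    fix k t' assume k: "k < d" "t' \<in> pts t"
    show "eqv k t' t \<or> (\<exists>m\<in>set ms. \<exists>v\<in>pts m. eqv k t' v)"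
    proof (cases "t' \<in> lower d t")
      case False
      then have "eqv d t' t" using le_pts[OF k(2)] by (simp add: lower_def eqv_def)
      then show ?thesis using eqv_mono k by simp
    next
      case True
      obtain r where r: "r \<in> R" "eqv d t' r" using R(2) by blast
      then have "r \<in> ?R" using True by blast
      then have "f r \<in> set ms" "eqv d (f r) r" using f ms by auto
      then have "eqv k t' (f r)" using r eqv_sym eqv_trans eqv_mono k by (meson less_imp_le)
      then show ?thesis using \<open>f r \<in> set ms\<close> pts_refl by blast
    qed
  qed
  then show ?thesis using low by blast
qed

text \<open>The difficult case is that \<open>lower d t\<close> is finitely generated. If every tree
  of type \<open>t\<close> saw all of it, any two such trees would be bisimilar and
  \<open>C d t\<close> would be finitely generated as well. So some \<open>u\<close> of that type
  misses a part, and the points of \<open>u\<close> in \<open>lower d t\<close> form the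
  base.\<close>

lemma infinite_gap:
  assumes "C d t \<notin> JJ1"
  shows "\<exists>ms. set ms \<subseteq> lower d t \<and> eqv d (Node (val t) ms) t \<and>
    \<not> lower d t \<subseteq> (\<Union>m\<in>set ms. cone m)"
proof -
  obtain ms where ms: "set ms \<subseteq> lower d t" "eqv d (Node (val t) ms) t"
    using lower_generators by blast
  show ?thesis
  proof (cases "lower d t \<subseteq> (\<Union>m\<in>set ms. cone m)")
    case False
    then show ?thesis using ms by blast
  next
    case True
    have "\<exists>u. eqv d u t \<and> \<not> lower d t \<subseteq> cone u"
    proof (rule ccontr)
      assume "\<not> ?thesis"
      then have all: "lower d t \<subseteq> cone u" if "eqv d u t" for u using that by blast
      have step: "\<exists>y\<in>pts v. eqv k x y"
        if IH: "\<And>u v. eqv d u t \<Longrightarrow> eqv d v t \<Longrightarrow> eqv k u v"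
          and uv: "eqv d u t" "eqv d v t" and x: "x \<in> pts u" for k u v x
      proof (cases "x \<in> lower d t")
        case True
        then have "x \<in> cone v" using all[OF uv(2)] by blast
        then show ?thesis unfolding cone_def bis_def by blast
      next
        case False
        have "le d x t" using le_pts[OF x] uv(1) le_trans unfolding eqv_def by blast
        then have "eqv d x t" using False by (simp add: lower_def eqv_def)
        then show ?thesis using IH[OF _ uv(2)] pts_refl by blast
      qed
      have "eqv k u v" if "eqv d u t" "eqv d v t" for k u v
        using that
      proof (induction k arbitrary: u v)
        case 0
        then show ?case using eqv_val by (simp add: eqv_def)
      next
        case (Suc k)
        have "val u = val v" using eqv_val Suc.prems by simp
        then show ?case
          using step[OF Suc.IH] Suc.prems by (simp add: eqv_def[of "Suc k"] le_Suc_iff)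
      qed
      then have "bis u t" if "eqv d u t" for u using that by (simp add: bis_def)
      then have "C d t \<subseteq> \<Union>(cone ` set (t # ms))"
        using True bis_cone by (auto simp: C_def lower_def eqv_def)
      then show False using assms JJ1_I[OF C_JJ finite_set] by blast
    qed
    then obtain u where u: "eqv d u t" "\<not> lower d t \<subseteq> cone u" by blast
    obtain us where us: "set us = pts u \<inter> lower d t" using finite_list[of "pts u \<inter> lower d t"] by auto
    have "eqv d (Node (val t) us) t"
    proof (rule root_eqv)
      show "le d m t" if "m \<in> set us" for m using that us by (auto simp: lower_def)
      fix k t' assume k: "k < d" "t' \<in> pts t"
      have "le d t u" using u by (simp add: eqv_def)
      from le_ptsD[OF this k(2,1)] obtain v where v: "v \<in> pts u" "eqv k t' v" by blast
      show "eqv k t' t \<or> (\<exists>m\<in>set us. \<exists>v\<in>pts m. eqv k t' v)"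
      proof (cases "v \<in> lower d t")
        case True
        then show ?thesis using v us pts_refl by blast
      next
        case False
        have "le d v t" using le_pts[OF v(1)] u(1) le_trans unfolding eqv_def by blast
        then have "eqv k v t" using False k eqv_mono[of d v t k] by (simp add: lower_def eqv_def)
        then show ?thesis using v eqv_trans by blast
      qed
    qed
    moreover have "(\<Union>m\<in>set us. cone m) \<subseteq> cone u"
      using us cone_trans cone_pts by blast
    ultimately show ?thesis using u us by (intro exI[of _ us]) blast
  qed
qed

lemma ladder_below:
  assumes "C d t \<notin> JJ1"
  shows "\<exists>\<rho>\<in>JJ2. \<rho> \<subseteq> C d t \<and> (\<exists>S. finite S \<and> \<rho> \<inter> lower d t \<subseteq> \<Union>(cone ` S))"
proof -
  obtain ms where ms: "set ms \<subseteq> lower d t" "eqv d (Node (val t) ms) t"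
    "\<not> lower d t \<subseteq> (\<Union>m\<in>set ms. cone m)"
    using infinite_gap[OF assms] by blast
  let ?P = "\<lambda>x. x \<in> lower d t \<and> x \<notin> (\<Union>m\<in>set ms. cone m)"
  from ms(3) obtain x0 where "?P x0" by blast
  \<comment> \<open>Least size puts the proper points of \<open>x\<close> into the cones of the
    base, as the locale demands.\<close>
  from ex_has_least_nat[of ?P, OF this, of size] obtain x where
    x: "?P x" and least: "\<And>y. ?P y \<Longrightarrow> size x \<le> size y" by blast
  interpret RN n d t ms x
  proof
    fix y assume y: "y \<in> pts x" "y \<noteq> x"
    then have "size y < size x" using pts_size by blast
    moreover have "y \<in> lower d t" using Def_pts[OF _ _ y(1)] x by simp
    ultimately show "y \<in> (\<Union>m\<in>set ms. cone m)" using least[of y] by auto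
  qed (use ms x in auto)
  have "rho \<inter> lower d t \<subseteq> \<Union>(cone ` set (x # ms))" using rho_lower by auto
  then show ?thesis using rho_JJ2 rho_C by blast
qed

lemma JJ2_below: "X \<in> JJ - JJ1 \<Longrightarrow> \<exists>Y\<in>JJ2. Y \<subseteq> X"
proof -
  assume X: "X \<in> JJ - JJ1"
  then obtain d where "lvl_closed d X" using JJ_Def unfolding Def_def by blast
  then obtain t where "X = C d t" using JJ_eq_C X by blast
  then show ?thesis using ladder_below[of d t] X by auto
qed

lemma JJ1_below: "X \<in> JJ \<Longrightarrow> \<exists>Y\<in>JJ1. Y \<subseteq> X"
proof -
  assume X: "X \<in> JJ"
  then obtain t where t: "t \<in> X" using JJ_ne by blast
  have "cone t \<in> JJ1" using JJ1_iff[OF cone_JJ] by blast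
  then show ?thesis using Def_cone_subset[OF JJ_Def[OF X] t] by blast
qed

section \<open>The top element and the number of ladders\<close>

lemma UNIV_JJ: "UNIV \<in> JJ"
proof -
  have "C 0 (Node {} []) = UNIV" by (auto simp: C_def val_def)
  then show ?thesis using C_JJ by metis
qed

text \<open>At level 0 and over the empty base, the valuations \<open>{1}\<close> and
  \<open>{1, 2}\<close> span a ladder that misses the tree forcing no generator. Two generators
  leave this room; with one, the ladder from \<open>{}\<close> and \<open>{1}\<close> would already
  contain every tree.\<close>

lemma UNIV_JJ3:
  assumes "n \<ge> 2"
  shows "UNIV \<in> JJ3"
proof -
  have v: "val (Node {1} []) = {1}" "val (Node {1, 2} []) = {1, 2}" "val (Node {} []) = {}"
    using assms by (auto simp: val_def)
  interpret RN n 0 "Node {1} []" "[]" "Node {1, 2} []"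
    by unfold_locales (auto simp: v lower_def eqv_def simp del: One_nat_def)
  have "Node {} [] \<notin> rho" using rho_C v by (auto simp: C_def)
  then show ?thesis using JJ3_I[OF rho_JJ2 _ _ UNIV_JJ] by auto
qed

text \<open>A proper subset of the top that is closed at level \<open>d\<close> lies in
  \<open>lower d t\<close>, whereas the ladder built at level \<open>d\<close> meets
  \<open>lower d t\<close> in a finitely generated set. So that ladder is not closed at level
  \<open>d\<close>, and no single level holds all members of \<open>JJ2\<close>.\<close>

lemma infinite_JJ2:
  assumes "n \<ge> 2"
  shows "infinite JJ2"
proof
  assume "finite JJ2"
  then obtain d where d: "\<forall>X\<in>JJ2. lvl_closed d X" using common_level[of JJ2 0] JJ2_JJ JJ_Def by blast
  have "lvl_closed d UNIV" by (simp add: lvl_closed_def)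
  then obtain t where t: "UNIV = C d t" using JJ_eq_C[OF UNIV_JJ] by blast
  have U: "UNIV \<in> JJ3" by (rule UNIV_JJ3[OF assms])
  then have "C d t \<notin> JJ1" using t by (simp add: JJ3_def)
  from ladder_below[OF this] obtain \<rho> S where \<rho>: "\<rho> \<in> JJ2" "finite S" "\<rho> \<inter> lower d t \<subseteq> \<Union>(cone ` S)"
    by blast
  have J: "\<rho> \<in> JJ" "\<rho> \<notin> JJ1" using JJ2_JJ[OF \<rho>(1)] by auto
  have "\<rho> \<subseteq> lower d t"
  proof
    fix u assume u: "u \<in> \<rho>"
    have "u \<in> C d t" using t by blast
    moreover have "\<not> le d t u"
    proof
      assume "le d t u"
      then have "t \<in> \<rho>" using u d \<rho>(1) unfolding lvl_closed_def by blast
      then have "C d t \<subseteq> \<rho>" using d \<rho>(1) lvl_closed_C_subset by blast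
      then have "\<rho> = UNIV" using t by auto
      then show False using U \<rho>(1) by (simp add: JJ3_def)
    qed
    ultimately show "u \<in> lower d t" by (simp add: C_def lower_def)
  qed
  then have "\<rho> \<subseteq> \<Union>(cone ` S)" using \<rho>(3) by blast
  then show False using J JJ1_I \<rho>(2) by blast
qed

text \<open>The new element \<open>b\<close> below \<open>c = C d t\<close> consists of the points of type \<open>t\<close> over
  a definable set \<open>M\<close>.  Its part \<open>j\<close> makes \<open>b\<close> infinite, and the finitely generated part only
  serves to give new roots the right type; both are invisible among the elements of \<open>JJ3\<close>.
  Excluding the single point \<open>t\<close> makes \<open>b\<close> a proper subset of \<open>c\<close>.\<close>

lemma JJ3_extension:
  assumes A: "finite A" "A \<subseteq> JJ3" and c: "c \<in> JJ3"
    and D: "finite D" "D \<subseteq> JJ3" "\<And>X. X \<in> D \<Longrightarrow> X \<subset> c"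
  shows "\<exists>b\<in>JJ3. b \<subset> c \<and> (\<forall>X\<in>D. X \<subseteq> b \<and> \<not> b \<subseteq> X) \<and>
    (\<forall>a\<in>A. \<forall>p\<in>JJ3. \<not> c \<subseteq> a \<longrightarrow> p \<subseteq> a \<longrightarrow> p \<subseteq> b \<longrightarrow> (\<exists>X\<in>D. p \<subseteq> X))"
proof -
  have "c \<in> JJ - JJ1" "c \<notin> JJ2" using c by (auto simp: JJ3_def)
  then obtain j where j: "j \<in> JJ2" "j \<subset> c" using JJ2_below by blast
  have jJ: "j \<in> JJ" "j \<notin> JJ1" using JJ2_JJ[OF j(1)] by auto
  \<comment> \<open>The level also closes the members of \<open>A\<close>: a tree of type
    \<open>t\<close> in such a set then forces all of \<open>c\<close> into it.\<close>
  have "\<exists>d\<ge>0. \<forall>X\<in>insert c (insert j (A \<union> D)). lvl_closed d X"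
    using A D c jJ JJ3_JJ JJ_Def by (intro common_level) auto
  then obtain d where d: "\<And>X. X \<in> insert c (insert j (A \<union> D)) \<Longrightarrow> lvl_closed d X" by blast
  have "\<exists>t\<in>c. c = C d t" using c JJ3_JJ d by (intro JJ_eq_C) auto
  then obtain t where t: "c = C d t" by blast
  have sub_lower: "X \<subseteq> lower d t" if X: "lvl_closed d X" "X \<subset> c" for X
  proof
    fix u assume u: "u \<in> X"
    have "\<not> le d t u"
    proof
      assume "le d t u"
      then have "t \<in> X" using u X(1) unfolding lvl_closed_def by blast
      then show False using lvl_closed_C_subset[OF X(1)] t X(2) by blast
    qed
    moreover have "le d u t" using u X(2) t by (auto simp: C_def)
    ultimately show "u \<in> lower d t" by (simp add: lower_def)
  qed
  obtain ms where ms: "set ms \<subseteq> lower d t" "eqv d (Node (val t) ms) t"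
    using lower_generators by blast
  define \<M> where "\<M> = D \<union> {j} \<union> cone ` set ms"
  have fin\<M>: "finite \<M>" using D by (simp add: \<M>_def)
  have Def\<M>: "Def X" if "X \<in> \<M>" for X
    using that D(2) JJ3_JJ JJ_Def jJ by (auto simp: \<M>_def)
  have "X \<subseteq> lower d t" if X: "X \<in> \<M>" for X
  proof -
    consider "X \<in> D" | "X = j" | m where "m \<in> set ms" "X = cone m" using X by (auto simp: \<M>_def)
    then show ?thesis
    proof cases
      case 1
      then show ?thesis using D(3) d by (intro sub_lower) auto
    next
      case 2
      then show ?thesis using j(2) d by (intro sub_lower) auto
    next
      case 3
      then show ?thesis using Def_cone_subset[OF Def_lower] ms(1) by blast
    qed
  qed
  then have Mlow: "\<Union>\<M> \<subseteq> lower d t" by blast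
  have DefM: "Def (\<Union>\<M>)" using Def_Union[OF fin\<M>] Def\<M> by blast
  \<comment> \<open>Such a point exists because \<open>j\<close> is not finitely generated. Placed
    under every glued root, it keeps that root from being bisimilar to \<open>t\<close>.\<close>
  obtain y where y: "y \<in> j" "y \<notin> cone t" using jJ JJ1_iff by blast
  define b where "b = {u. le d u t \<and> (\<forall>v\<in>pts u. v \<in> \<Union>\<M> \<or> eqv d v t \<and> \<not> bis v t)}"
  have "lvl_inv (\<lambda>v. v \<in> \<Union>\<M> \<or> eqv d v t \<and> \<not> bis v t)"
    by (intro lvl_inv_disj lvl_inv_conj lvl_inv_not lvl_inv_Def lvl_inv_eqv lvl_inv_bis DefM)
  from Def_Int[OF Def_C[of d t] Def_all_pts[OF this]] have Def_b: "Def b"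
    unfolding b_def C_def by (simp add: Collect_conj_eq)
  have Mb: "\<Union>\<M> \<subseteq> b"
    using Mlow Def_pts[OF DefM] by (auto simp: b_def lower_def)
  have yb: "y \<in> b" using y(1) Mb by (auto simp: \<M>_def)
  have msb: "set ms \<subseteq> b" using Mb by (force simp: \<M>_def)
  have glue: "\<exists>w\<in>b. eqv d w t \<and> u \<in> cone w \<and> v \<in> cone w" if uv: "u \<in> b" "v \<in> b" for u v
  proof -
    define w where "w = Node (val t) (u # v # y # ms)"
    have wt: "eqv d w t"
      unfolding w_def using uv yb msb by (intro root_extend[OF ms(2)]) (auto simp: b_def)
    have "y \<in> cone w" by (auto simp: w_def cone_Node)
    then have "\<not> bis w t" using y(2) cone_bis by blast
    moreover have "z \<in> \<Union>\<M> \<or> eqv d z t \<and> \<not> bis z t" if z: "z \<in> pts w" "z \<noteq> w" for z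
    proof -
      obtain s where "s \<in> b" "z \<in> pts s" using z uv yb msb by (auto simp: w_def)
      then show ?thesis unfolding b_def by blast
    qed
    ultimately have "w \<in> b" using wt unfolding b_def by (auto simp: eqv_def)
    moreover have "u \<in> cone w" "v \<in> cone w" by (auto simp: w_def cone_Node)
    ultimately show ?thesis using wt by blast
  qed
  have bJ: "b \<in> JJ" using Def_b yb glue unfolding JJ_def directed_def by blast
  obtain w where w: "w \<in> b" "eqv d w t" using glue[OF yb yb] by blast
  have nb: "\<not> b \<subseteq> X" if "X \<subseteq> lower d t" for X
    using w that by (auto simp: lower_def eqv_def)
  have "t \<notin> \<Union>\<M>" using Mlow by (auto simp: lower_def)
  then have "t \<notin> b" unfolding b_def using bis_refl pts_refl by blast
  moreover have "b \<subseteq> c" unfolding t C_def b_def by blast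
  ultimately have bc: "b \<subset> c" using t by auto
  have "j \<subseteq> b" using Mb by (auto simp: \<M>_def)
  moreover have "b \<noteq> j" using nb[OF sub_lower[OF d j(2)]] by blast
  ultimately have b3: "b \<in> JJ3" using JJ3_I[OF j(1)] bJ by blast
  have "\<And>X. X \<in> D \<Longrightarrow> X \<subseteq> b \<and> \<not> b \<subseteq> X"
    using Mb nb[OF sub_lower[OF d D(3)]] by (auto simp: \<M>_def)
  moreover have "\<exists>X\<in>D. p \<subseteq> X"
    if p: "a \<in> A" "p \<in> JJ3" "\<not> c \<subseteq> a" "p \<subseteq> a" "p \<subseteq> b" for a p
  proof -
    \<comment> \<open>A point of \<open>p\<close> of type \<open>t\<close> would give
      \<open>c \<subseteq> a\<close>, so \<open>p\<close> stays inside \<open>\<Union>\<M>\<close>,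
      and primeness selects one member of the family. Neither \<open>j\<close> nor a cone can
      contain a member of \<open>JJ3\<close>.\<close>
    have "p \<subseteq> \<Union>\<M>"
    proof
      fix u assume u: "u \<in> p"
      have "\<not> le d t u"
      proof
        assume "le d t u"
        moreover have "lvl_closed d a" using d p(1) by blast
        ultimately have "t \<in> a" using u p(4) unfolding lvl_closed_def by blast
        then show False using lvl_closed_C_subset[OF \<open>lvl_closed d a\<close>] p(3) t by blast
      qed
      then have "\<not> eqv d u t" by (simp add: eqv_def)
      moreover have "u \<in> b" using u p(5) by blast
      ultimately show "u \<in> \<Union>\<M>" unfolding b_def using pts_refl by blast
    qed
    from JJ_subset_Union[OF JJ3_JJ[OF p(2)] fin\<M> Def\<M> this] obtain X where
      X: "X \<in> \<M>" "p \<subseteq> X" by blast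
    have "X \<noteq> j" using JJ3_up[OF p(2) jJ(1)] j(1) X by (auto simp: JJ3_def)
    moreover have "X \<notin> cone ` set ms"
      using JJ1_iff[OF JJ3_JJ[OF p(2)]] p(2) X(2) by (auto simp: JJ3_def)
    ultimately show ?thesis using X by (auto simp: \<M>_def)
  qed
  ultimately show ?thesis using bc by (intro bexI[OF _ b3] conjI ballI impI) simp_all
qed

section \<open>Join-irreducible elements of the free Heyting algebra\<close>

definition Mod :: "form set \<Rightarrow> tree set"
  where "Mod a = {t. \<exists>\<phi>\<in>a. t \<tturnstile> \<phi>}"

lemma H_cases: "a \<in> H n \<Longrightarrow> (\<And>\<phi>. \<phi> \<in> F n \<Longrightarrow> a = prov_equiv n `` {\<phi>} \<Longrightarrow> P) \<Longrightarrow> P"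
  unfolding H_def by (rule quotientE)

lemma H_cls: "\<phi> \<in> F n \<Longrightarrow> prov_equiv n `` {\<phi>} \<in> H n"
  unfolding H_def by (rule quotientI)

lemma Mod_cls:
  assumes "\<phi> \<in> F n"
  shows "Mod (prov_equiv n `` {\<phi>}) = {t. t \<tturnstile> \<phi>}"
proof -
  have "\<phi> \<in> prov_equiv n `` {\<phi>}" using assms by (auto simp: prov_equiv_def intro: prov.Ax)
  moreover have "t \<tturnstile> \<phi>" if "\<psi> \<in> prov_equiv n `` {\<phi>}" "t \<tturnstile> \<psi>" for \<psi> t
    using that prov_iff_forces by (auto simp: prov_equiv_def)
  ultimately show ?thesis unfolding Mod_def by blast
qed

lemma H_le_iff:
  assumes "a \<in> H n" "b \<in> H n"
  shows "(a, b) \<in> H_le n \<longleftrightarrow> Mod a \<subseteq> Mod b"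
  using assms by (elim H_cases) (auto simp: H_le_class_iff Mod_cls prov_iff_forces)

lemma Mod_inj:
  assumes "a \<in> H n" "b \<in> H n" "Mod a = Mod b"
  shows "a = b"
  using assms(1)
proof (rule H_cases)
  fix \<phi> assume \<phi>: "\<phi> \<in> F n" "a = prov_equiv n `` {\<phi>}"
  show ?thesis using assms(2)
  proof (rule H_cases)
    fix \<psi> assume \<psi>: "\<psi> \<in> F n" "b = prov_equiv n `` {\<psi>}"
    have "{t. t \<tturnstile> \<phi>} = {t. t \<tturnstile> \<psi>}" using \<phi> \<psi> assms(3) Mod_cls by simp
    then have "(\<phi>, \<psi>) \<in> prov_equiv n"
      using \<phi>(1) \<psi>(1) by (auto simp: prov_equiv_def prov_iff_forces)
    then show ?thesis using \<phi> \<psi> equiv_class_eq[OF equiv_prov_equiv] by blast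
  qed
qed

lemma Mod_Def: "a \<in> H n \<Longrightarrow> Def (Mod a)"
  by (elim H_cases) (auto simp: Mod_cls formable_iff_Def[symmetric] formable_def)

lemma Mod_surj:
  assumes "Def X"
  obtains a where "a \<in> H n" "Mod a = X"
proof -
  obtain \<phi> where "\<phi> \<in> F n" "X = {t. t \<tturnstile> \<phi>}"
    using assms unfolding formable_iff_Def[symmetric] formable_def by blast
  then show thesis using that H_cls Mod_cls by metis
qed

lemma H_bot: "H_bot n \<in> H n" "Mod (H_bot n) = {}"
proof -
  have "Bot \<in> F n" by (simp add: F_def)
  then show "H_bot n \<in> H n" "Mod (H_bot n) = {}" by (auto simp: H_bot_def Mod_cls H_cls)
qed

lemma H_join:
  assumes "a \<in> H n" "b \<in> H n"
  shows "H_join n a b \<in> H n" "Mod (H_join n a b) = Mod a \<union> Mod b"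
proof -
  have "H_join n a b \<in> H n \<and> Mod (H_join n a b) = Mod a \<union> Mod b"
    using assms(1)
  proof (rule H_cases)
    fix \<phi> assume \<phi>: "\<phi> \<in> F n" "a = prov_equiv n `` {\<phi>}"
    show ?thesis using assms(2)
    proof (rule H_cases)
      fix \<psi> assume \<psi>: "\<psi> \<in> F n" "b = prov_equiv n `` {\<psi>}"
      have "Or \<phi> \<psi> \<in> F n" using \<phi> \<psi> by (simp add: F_def)
      then show ?thesis using \<phi> \<psi> by (auto simp: H_join_class Mod_cls H_cls)
    qed
  qed
  then show "H_join n a b \<in> H n" "Mod (H_join n a b) = Mod a \<union> Mod b" by auto
qed

text \<open>Irreducibility for two sets extends to finite unions, in particular to the principal
  sets at a level where \<open>X\<close> is closed. Directedness is then inherited from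
  \<open>C_JJ\<close>.\<close>

lemma irreducible_JJ:
  assumes "Def X" "X \<noteq> {}"
    and irr: "\<And>Y Z. Def Y \<Longrightarrow> Def Z \<Longrightarrow> X = Y \<union> Z \<Longrightarrow> X = Y \<or> X = Z"
  shows "X \<in> JJ"
proof -
  obtain d where d: "lvl_closed d X" using assms(1) unfolding Def_def by blast
  have fin: "X \<in> \<Y>" if "finite \<Y>" "\<And>Y. Y \<in> \<Y> \<Longrightarrow> Def Y" "X = \<Union>\<Y>" for \<Y>
    using that
  proof (induction \<Y> rule: finite_induct)
    case empty
    then show ?case using assms(2) by simp
  next
    case (insert Y \<Y>)
    have "X = Y \<or> X = \<Union>\<Y>"
      using insert.prems insert.hyps by (intro irr Def_Union) auto
    then show ?case
    proof
      assume "X = \<Union>\<Y>"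
      moreover have "\<And>Z. Z \<in> \<Y> \<Longrightarrow> Def Z" using insert.prems(1) by simp
      ultimately have "X \<in> \<Y>" using insert.IH by blast
      then show ?thesis by simp
    qed simp
  qed
  have "X \<in> C d ` X"
    using lvl_closed_eq_Union[OF d] finite_C_image by (intro fin) auto
  then show ?thesis by auto
qed

lemma J_iff: "a \<in> J n \<longleftrightarrow> a \<in> H n \<and> Mod a \<in> JJ"
proof
  assume a: "a \<in> J n"
  then have aH: "a \<in> H n" by (simp add: J_def)
  have "Mod a \<noteq> {}" using a Mod_inj[OF aH H_bot(1)] H_bot(2) by (auto simp: J_def)
  moreover have "Mod a = Y \<or> Mod a = Z" if YZ: "Def Y" "Def Z" "Mod a = Y \<union> Z" for Y Z
  proof -
    obtain b c where bc: "b \<in> H n" "Mod b = Y" "c \<in> H n" "Mod c = Z" using YZ Mod_surj by metis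
    then have "a = H_join n b c" using YZ H_join Mod_inj aH by metis
    then have "a = b \<or> a = c" using a bc(1,3) unfolding J_def by blast
    then show ?thesis using bc(2,4) by auto
  qed
  ultimately show "a \<in> H n \<and> Mod a \<in> JJ" using irreducible_JJ[of "Mod a"] Mod_Def[OF aH] aH by metis
next
  assume a: "a \<in> H n \<and> Mod a \<in> JJ"
  have "a = b \<or> a = c" if bc: "b \<in> H n" "c \<in> H n" "a = H_join n b c" for b c
  proof -
    have "Mod a = Mod b \<union> Mod c" using H_join bc by simp
    then have "Mod a = Mod b \<or> Mod a = Mod c"
      using JJ_subset_Un[of "Mod a" "Mod b" "Mod c"] a bc Mod_Def by auto
    then show ?thesis using Mod_inj[of a b] Mod_inj[of a c] a bc(1,2) by auto
  qed
  moreover have "a \<noteq> H_bot n" using a H_bot JJ_ne by auto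
  ultimately show "a \<in> J n" using a by (simp add: J_def)
qed

lemma J_le_iff: "a \<in> J n \<Longrightarrow> b \<in> J n \<Longrightarrow> (a, b) \<in> H_le n \<longleftrightarrow> Mod a \<subseteq> Mod b"
  using H_le_iff J_iff by blast

lemma J_inj: "a \<in> J n \<Longrightarrow> b \<in> J n \<Longrightarrow> Mod a = Mod b \<longleftrightarrow> a = b"
  using Mod_inj J_iff by blast

lemma J_surj: "X \<in> JJ \<Longrightarrow> \<exists>a\<in>J n. Mod a = X"
  using Mod_surj[of X] JJ_Def[of X] J_iff by metis

lemma J1_iff: "a \<in> J1 n \<longleftrightarrow> a \<in> J n \<and> Mod a \<in> JJ1"
proof -
  have "finite {b \<in> J n. b \<noteq> a \<and> (b, a) \<in> H_le n} \<longleftrightarrow> finite {Y \<in> JJ. Y \<noteq> Mod a \<and> Y \<subseteq> Mod a}"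
    if a: "a \<in> J n"
  proof -
    have "{Y \<in> JJ. Y \<noteq> Mod a \<and> Y \<subseteq> Mod a} = Mod ` {b \<in> J n. b \<noteq> a \<and> (b, a) \<in> H_le n}"
    proof (intro equalityI subsetI)
      fix Y assume Y: "Y \<in> {Y \<in> JJ. Y \<noteq> Mod a \<and> Y \<subseteq> Mod a}"
      then obtain b where "b \<in> J n" "Mod b = Y" using J_surj by blast
      then show "Y \<in> Mod ` {b \<in> J n. b \<noteq> a \<and> (b, a) \<in> H_le n}"
        using Y J_le_iff[OF _ a] by (intro image_eqI[of _ _ b]) auto
    next
      fix Y assume "Y \<in> Mod ` {b \<in> J n. b \<noteq> a \<and> (b, a) \<in> H_le n}"
      then show "Y \<in> {Y \<in> JJ. Y \<noteq> Mod a \<and> Y \<subseteq> Mod a}"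
        using J_le_iff[OF _ a] J_inj[OF _ a] J_iff by auto
    qed
    moreover have "inj_on Mod {b \<in> J n. b \<noteq> a \<and> (b, a) \<in> H_le n}"
      using J_inj by (auto simp: inj_on_def)
    ultimately show ?thesis by (simp add: finite_image_iff)
  qed
  moreover have "a \<in> J n \<Longrightarrow> Mod a \<in> JJ" using J_iff by blast
  ultimately show ?thesis by (auto simp: J1_def JJ1_def)
qed

lemma J2_iff: "a \<in> J2 n \<longleftrightarrow> a \<in> J n \<and> Mod a \<in> JJ2"
proof -
  have "(\<forall>b\<in>J n - J1 n. (b, a) \<in> H_le n \<longrightarrow> b = a) \<longleftrightarrow> (\<forall>Y\<in>JJ - JJ1. Y \<subseteq> Mod a \<longrightarrow> Y = Mod a)"
    if a: "a \<in> J n"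
  proof (intro iffI ballI impI)
    fix Y assume L: "\<forall>b\<in>J n - J1 n. (b, a) \<in> H_le n \<longrightarrow> b = a" and Y: "Y \<in> JJ - JJ1" "Y \<subseteq> Mod a"
    obtain b where b: "b \<in> J n" "Mod b = Y" using J_surj[of Y] Y(1) by blast
    then show "Y = Mod a" using L Y J1_iff J_le_iff[OF _ a] by auto
  next
    fix b assume R: "\<forall>Y\<in>JJ - JJ1. Y \<subseteq> Mod a \<longrightarrow> Y = Mod a" and b: "b \<in> J n - J1 n" "(b, a) \<in> H_le n"
    then have "Mod b \<in> JJ - JJ1" "Mod b \<subseteq> Mod a" using J_iff J1_iff J_le_iff[OF _ a] by auto
    then have "Mod b = Mod a" using R by blast
    then show "b = a" using J_inj[OF _ a, of b] b by simp
  qed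
  then show ?thesis
    using J_iff[of a] J1_iff[of a] by (cases "a \<in> J n") (simp_all add: J2_def JJ2_def)
qed

lemma J3_iff: "a \<in> J3 n \<longleftrightarrow> a \<in> J n \<and> Mod a \<in> JJ3"
  using J_iff[of a] J1_iff[of a] J2_iff[of a] by (auto simp: J3_def JJ3_def)

end

section \<open>Partial isomorphisms of bounded quasisemilattices\<close>

lemma po_refl: "Partial_order r \<Longrightarrow> x \<in> Field r \<Longrightarrow> (x, x) \<in> r"
  by (auto simp: order_on_defs refl_on_def)

lemma po_trans: "Partial_order r \<Longrightarrow> (x, y) \<in> r \<Longrightarrow> (y, z) \<in> r \<Longrightarrow> (x, z) \<in> r"
  by (auto simp: order_on_defs dest: transD)

lemma po_antisym: "Partial_order r \<Longrightarrow> (x, y) \<in> r \<Longrightarrow> (y, x) \<in> r \<Longrightarrow> x = y"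
  by (auto simp: order_on_defs dest: antisymD)

lemma finite_maximal:
  assumes r: "Partial_order r" and "finite S" "S \<noteq> {}"
  shows "\<exists>m\<in>S. \<forall>y\<in>S. (m, y) \<in> r \<longrightarrow> y = m"
  using assms(2,3)
proof (induction S rule: finite_ne_induct)
  case (insert z S)
  then obtain m where m: "m \<in> S" "\<And>y. y \<in> S \<Longrightarrow> (m, y) \<in> r \<Longrightarrow> y = m" by blast
  show ?case
  proof (cases "(m, z) \<in> r")
    case True
    have "y = z" if "y \<in> insert z S" "(z, y) \<in> r" for y
      using that m(2)[of y] po_trans[OF r True, of y] po_antisym[OF r True] by auto
    then show ?thesis by blast
  next
    case False
    then show ?thesis using m by blast
  qed
qed simp

lemma finite_minimal:
  assumes "Partial_order r" and "finite S" "S \<noteq> {}"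
  shows "\<exists>m\<in>S. \<forall>y\<in>S. (y, m) \<in> r \<longrightarrow> y = m"
  using finite_maximal[of "r\<inverse>" S] assms by simp

section \<open>Maximal common lower bounds\<close>

lemma max_lower_bounds_iff:
  "m \<in> max_lower_bounds r p q \<longleftrightarrow> (m, p) \<in> r \<and> (m, q) \<in> r \<and>
    (\<forall>y. (y, p) \<in> r \<longrightarrow> (y, q) \<in> r \<longrightarrow> (m, y) \<in> r \<longrightarrow> y = m)"
  by (auto simp: max_lower_bounds_def common_lower_bounds_def FieldI1)

lemma max_lower_bounds_commute: "max_lower_bounds r p q = max_lower_bounds r q p"
  by (auto simp: max_lower_bounds_iff)

lemma qsl_po: "qsl r \<Longrightarrow> Partial_order r"
  by (simp add: qsl_def)

lemma qsl_max:
  assumes "qsl r" "(x, p) \<in> r" "(x, q) \<in> r"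
  obtains m where "m \<in> max_lower_bounds r p q" "(x, m) \<in> r"
proof -
  have "p \<in> Field r" "q \<in> Field r" "x \<in> common_lower_bounds r p q"
    using assms by (auto simp: common_lower_bounds_def FieldI1 FieldI2)
  then show thesis using that assms(1) unfolding qsl_def by blast
qed

text \<open>An interpolant above a maximal lower bound equals it, so \<open>B\<close> contains all
  maximal lower bounds; being finite, \<open>B\<close> also has a maximal interpolant above any
  given lower bound. Interpolants are easier to exhibit than maximal bounds.\<close>

lemma qsl_of_interpolation:
  assumes r: "Partial_order r"
    and ip: "\<And>A. finite A \<Longrightarrow> A \<subseteq> Field r \<Longrightarrow> \<exists>B. finite B \<and> A \<subseteq> B \<and> B \<subseteq> Field r \<and>
      (\<forall>p\<in>B. \<forall>q\<in>B. \<forall>x. (x, p) \<in> r \<longrightarrow> (x, q) \<in> r \<longrightarrow>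
        (\<exists>y\<in>B. (x, y) \<in> r \<and> (y, p) \<in> r \<and> (y, q) \<in> r))"
  shows "qsl r" "qsl_locally_finite r"
proof -
  have sub: "max_lower_bounds r p q \<subseteq> B"
    if "\<forall>x. (x, p) \<in> r \<longrightarrow> (x, q) \<in> r \<longrightarrow> (\<exists>y\<in>B. (x, y) \<in> r \<and> (y, p) \<in> r \<and> (y, q) \<in> r)" for p q B
    using that by (fastforce simp: max_lower_bounds_iff)
  have "finite (max_lower_bounds r p q) \<and>
      (\<forall>x\<in>common_lower_bounds r p q. \<exists>m\<in>max_lower_bounds r p q. (x, m) \<in> r)"
    if pq: "p \<in> Field r" "q \<in> Field r" for p q
  proof -
    obtain B where B: "finite B" "\<forall>x. (x, p) \<in> r \<longrightarrow> (x, q) \<in> r \<longrightarrow>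
        (\<exists>y\<in>B. (x, y) \<in> r \<and> (y, p) \<in> r \<and> (y, q) \<in> r)"
      using ip[of "{p, q}"] pq by auto
    have "\<exists>m\<in>max_lower_bounds r p q. (x, m) \<in> r" if x: "(x, p) \<in> r" "(x, q) \<in> r" for x
    proof -
      let ?S = "{y \<in> B. (x, y) \<in> r \<and> (y, p) \<in> r \<and> (y, q) \<in> r}"
      have "finite ?S" "?S \<noteq> {}" using B x by auto
      then obtain m where m: "m \<in> ?S" "\<And>y. y \<in> ?S \<Longrightarrow> (m, y) \<in> r \<Longrightarrow> y = m"
        using finite_maximal[OF r, of ?S] by blast
      have "y = m" if y: "(y, p) \<in> r" "(y, q) \<in> r" "(m, y) \<in> r" for y
      proof -
        obtain z where z: "z \<in> B" "(y, z) \<in> r" "(z, p) \<in> r" "(z, q) \<in> r" using B(2) y by blast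
        then have mz: "(m, z) \<in> r" using po_trans[OF r y(3)] by blast
        then have "z \<in> ?S" using z m(1) po_trans[OF r] by blast
        then have "z = m" using m(2) mz by blast
        then show ?thesis using po_antisym[OF r y(3)] z by blast
      qed
      then show ?thesis using m(1) by (auto simp: max_lower_bounds_iff)
    qed
    then show ?thesis
      using finite_subset[OF sub[OF B(2)] B(1)] by (simp add: common_lower_bounds_def)
  qed
  then show "qsl r" using r by (simp add: qsl_def)
  have "max_lower_bound_closed r B" if "\<forall>p\<in>B. \<forall>q\<in>B. \<forall>x. (x, p) \<in> r \<longrightarrow> (x, q) \<in> r \<longrightarrow>
        (\<exists>y\<in>B. (x, y) \<in> r \<and> (y, p) \<in> r \<and> (y, q) \<in> r)" for B
    unfolding max_lower_bound_closed_def using that by (intro ballI sub) blast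
  then show "qsl_locally_finite r" unfolding qsl_locally_finite_def using ip by meson
qed

lemma finite_qsl:
  assumes "Partial_order r" "finite (Field r)"
  shows "qsl r" "qsl_locally_finite r"
proof -
  have "\<exists>B. finite B \<and> A \<subseteq> B \<and> B \<subseteq> Field r \<and>
      (\<forall>p\<in>B. \<forall>q\<in>B. \<forall>x. (x, p) \<in> r \<longrightarrow> (x, q) \<in> r \<longrightarrow>
        (\<exists>y\<in>B. (x, y) \<in> r \<and> (y, p) \<in> r \<and> (y, q) \<in> r))" if "A \<subseteq> Field r" for A
    using that assms(2) po_refl[OF assms(1)] by (intro exI[of _ "Field r"]) (blast intro: FieldI1)
  then show "qsl r" "qsl_locally_finite r" using qsl_of_interpolation[OF assms(1)] by auto
qed

text \<open>A finite relation instead of a function makes the notion symmetric under converse, so a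
  back step is a forth step for the converse.\<close>

definition partial_iso :: "'a rel \<Rightarrow> 'b rel \<Rightarrow> ('a \<times> 'b) set \<Rightarrow> bool"
  where "partial_iso s r g \<longleftrightarrow> finite g \<and> sub_bqsl s (Domain g) \<and> sub_bqsl r (Range g) \<and>
    (\<forall>x y x' y'. (x, y) \<in> g \<longrightarrow> (x', y') \<in> g \<longrightarrow> ((x, x') \<in> s \<longleftrightarrow> (y, y') \<in> r))"

text \<open>In a one-point extension of \<open>A\<close> the new element is determined by the set \<open>D\<close> of elements
  below it and the set \<open>U\<close> of elements above it, which has a least element unless it is empty.  The
  last clause says that \<open>insert b A\<close> is again closed under maximal lower bounds.\<close>

definition one_point_ext :: "'a rel \<Rightarrow> bool"
  where "one_point_ext r \<longleftrightarrow> (\<forall>A D U. finite A \<and> sub_bqsl r A \<and> D \<subseteq> A \<and>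
      (\<exists>m\<in>D. is_minimum r m) \<and> (\<forall>x\<in>A. \<forall>y\<in>D. (x, y) \<in> r \<longrightarrow> x \<in> D) \<and> D \<inter> U = {} \<and>
      (\<forall>x\<in>D. \<forall>y\<in>U. (x, y) \<in> r) \<and> (U = {} \<or> (\<exists>c\<in>A. U = {a \<in> A. (c, a) \<in> r})) \<longrightarrow>
    (\<exists>b\<in>Field r. (\<forall>a\<in>A. ((b, a) \<in> r \<longleftrightarrow> a \<in> U) \<and> ((a, b) \<in> r \<longleftrightarrow> a \<in> D)) \<and>
      (\<forall>a\<in>A - U. \<forall>p. (p, a) \<in> r \<longrightarrow> (p, b) \<in> r \<longrightarrow> (\<exists>\<delta>\<in>D. (p, \<delta>) \<in> r))))"

lemma one_point_extI:
  assumes "\<And>A D U. finite A \<Longrightarrow> sub_bqsl r A \<Longrightarrow> D \<subseteq> A \<Longrightarrow> \<exists>m\<in>D. is_minimum r m \<Longrightarrow>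
      \<forall>x\<in>A. \<forall>y\<in>D. (x, y) \<in> r \<longrightarrow> x \<in> D \<Longrightarrow> D \<inter> U = {} \<Longrightarrow> \<forall>x\<in>D. \<forall>y\<in>U. (x, y) \<in> r \<Longrightarrow>
      U = {} \<or> (\<exists>c\<in>A. U = {a \<in> A. (c, a) \<in> r}) \<Longrightarrow>
    \<exists>b\<in>Field r. (\<forall>a\<in>A. ((b, a) \<in> r \<longleftrightarrow> a \<in> U) \<and> ((a, b) \<in> r \<longleftrightarrow> a \<in> D)) \<and>
      (\<forall>a\<in>A - U. \<forall>p. (p, a) \<in> r \<longrightarrow> (p, b) \<in> r \<longrightarrow> (\<exists>\<delta>\<in>D. (p, \<delta>) \<in> r))"
  shows "one_point_ext r"
  unfolding one_point_ext_def by (intro allI impI, elim conjE) (rule assms)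

lemma partial_iso_order:
  "partial_iso s r g \<Longrightarrow> (x, y) \<in> g \<Longrightarrow> (x', y') \<in> g \<Longrightarrow> (x, x') \<in> s \<longleftrightarrow> (y, y') \<in> r"
  unfolding partial_iso_def by blast

lemma partial_iso_converse: "partial_iso s r g \<Longrightarrow> partial_iso r s (g\<inverse>)"
  unfolding partial_iso_def by auto

lemma partial_iso_Field: "partial_iso s r g \<Longrightarrow> (x, y) \<in> g \<Longrightarrow> x \<in> Field s \<and> y \<in> Field r"
  unfolding partial_iso_def sub_bqsl_def by blast

lemma partial_iso_functional:
  assumes "Partial_order s" "Partial_order r" "partial_iso s r g" "(x, y) \<in> g" "(x, y') \<in> g"
  shows "y = y'"
proof -
  have "(x, x) \<in> s" using po_refl[OF assms(1)] partial_iso_Field[OF assms(3,4)] by blast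
  then have "(y, y') \<in> r" "(y', y) \<in> r"
    using partial_iso_order[OF assms(3)] assms(4,5) by blast+
  then show ?thesis using po_antisym[OF assms(2)] by blast
qed

lemma is_minimum_unique: "Partial_order r \<Longrightarrow> is_minimum r m \<Longrightarrow> is_minimum r m' \<Longrightarrow> m = m'"
  by (rule po_antisym) (auto simp: is_minimum_def)

lemma partial_iso_minimum:
  assumes s: "Partial_order s" and r: "Partial_order r" and g: "partial_iso s r g"
    and xy: "(x, y) \<in> g" and x: "is_minimum s x"
  shows "is_minimum r y"
proof -
  obtain m' where m': "m' \<in> Range g" "is_minimum r m'"
    using g unfolding partial_iso_def sub_bqsl_def by blast
  then obtain z where z: "(z, m') \<in> g" by blast
  have "z \<in> Field s" using partial_iso_Field[OF g z] ..
  then have "(x, z) \<in> s" using x unfolding is_minimum_def by blast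
  then have "(y, m') \<in> r" using partial_iso_order[OF g xy z] by blast
  moreover have "(m', y) \<in> r" using m'(2) partial_iso_Field[OF g xy] unfolding is_minimum_def by blast
  ultimately have "y = m'" using po_antisym[OF r] by blast
  then show ?thesis using m' by simp
qed

text \<open>Some maximal lower bound above \<open>m'\<close> exists in \<open>r\<close> and lies in
  the range by closure. Pulled back, it is a lower bound above \<open>m\<close> and so equals
  \<open>m\<close>.\<close>

lemma partial_iso_max_lower_bounds:
  assumes s: "qsl s" and r: "qsl r" and g: "partial_iso s r g"
    and p: "(p, p') \<in> g" and q: "(q, q') \<in> g" and m: "(m, m') \<in> g"
    and mm: "m \<in> max_lower_bounds s p q"
  shows "m' \<in> max_lower_bounds r p' q'"
proof -
  note ord = partial_iso_order[OF g]
  have lb: "(m', p') \<in> r" "(m', q') \<in> r"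
    using mm ord[OF m p] ord[OF m q] by (auto simp: max_lower_bounds_iff)
  obtain k' where k': "k' \<in> max_lower_bounds r p' q'" "(m', k') \<in> r"
    using qsl_max[OF r lb] by blast
  have "k' \<in> Range g"
    using g p q k'(1) unfolding partial_iso_def sub_bqsl_def max_lower_bound_closed_def by blast
  then obtain k where k: "(k, k') \<in> g" by blast
  have "(k, p) \<in> s" "(k, q) \<in> s" "(m, k) \<in> s"
    using k' ord[OF k p] ord[OF k q] ord[OF m k] by (auto simp: max_lower_bounds_iff)
  then have "k = m" using mm by (auto simp: max_lower_bounds_iff)
  then have "k' = m'" using partial_iso_functional[OF qsl_po[OF s] qsl_po[OF r] g] k m by blast
  then show ?thesis using k' by simp
qed

lemma forth_step:
  assumes s: "qsl s" and r: "qsl r" and ext: "one_point_ext r" and g: "partial_iso s r g"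
    and b: "b \<in> Field s" "b \<notin> Domain g" and cl: "max_lower_bound_closed s (insert b (Domain g))"
  shows "\<exists>y. partial_iso s r (insert (b, y) g)"
proof -
  note so = qsl_po[OF s] and ro = qsl_po[OF r]
  note ord = partial_iso_order[OF g]
  have inj: "x = x'" if "(x, y) \<in> g" "(x', y) \<in> g" for x x' y
    using partial_iso_functional[OF ro so partial_iso_converse[OF g]] that by blast
  have g': "finite g" "sub_bqsl s (Domain g)" "sub_bqsl r (Range g)"
    using g by (auto simp: partial_iso_def)
  define D where "D = {y. \<exists>x. (x, y) \<in> g \<and> (x, b) \<in> s}"
  define U where "U = {y. \<exists>x. (x, y) \<in> g \<and> (b, x) \<in> s}"
  obtain m0 y0 where m0: "is_minimum s m0" "(m0, y0) \<in> g" using g'(2) unfolding sub_bqsl_def by blast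
  have "(m0, b) \<in> s" using m0(1) b(1) unfolding is_minimum_def by blast
  then have minD: "\<exists>m\<in>D. is_minimum r m"
    using partial_iso_minimum[OF so ro g m0(2,1)] m0(2) unfolding D_def by blast
  have down: "\<forall>x\<in>Range g. \<forall>y\<in>D. (x, y) \<in> r \<longrightarrow> x \<in> D"
  proof (intro ballI impI)
    fix x y assume "x \<in> Range g" "y \<in> D" and xy: "(x, y) \<in> r"
    then obtain u v where uv: "(u, x) \<in> g" "(v, y) \<in> g" "(v, b) \<in> s" unfolding D_def by blast
    then have "(u, b) \<in> s" using ord[OF uv(1,2)] xy po_trans[OF so] by blast
    then show "x \<in> D" using uv unfolding D_def by blast
  qed
  have disj: "D \<inter> U = {}"
  proof (rule ccontr)
    assume "D \<inter> U \<noteq> {}"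
    then obtain y x x' where "(x, y) \<in> g" "(x, b) \<in> s" "(x', y) \<in> g" "(b, x') \<in> s"
      unfolding D_def U_def by blast
    then have "x = b" using inj po_antisym[OF so] by blast
    then show False using b(2) \<open>(x, y) \<in> g\<close> by blast
  qed
  have DU: "\<forall>x\<in>D. \<forall>y\<in>U. (x, y) \<in> r"
    unfolding D_def U_def using ord po_trans[OF so] by blast
  \<comment> \<open>A minimal domain element \<open>c\<close> above \<open>b\<close> is the least
    one: for another such \<open>x\<close>, a maximal lower bound of \<open>c\<close> and
    \<open>x\<close> above \<open>b\<close> is in the domain by closure and so equals
    \<open>c\<close>.\<close>
  have princ: "U = {} \<or> (\<exists>c\<in>Range g. U = {a \<in> Range g. (c, a) \<in> r})"
  proof (cases "U = {}")
    case False
    let ?S = "{x \<in> Domain g. (b, x) \<in> s}"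
    have "finite ?S" using g'(1) by (simp add: finite_Domain)
    moreover have "?S \<noteq> {}" using False unfolding U_def by blast
    ultimately obtain c where c: "c \<in> ?S" "\<And>y. y \<in> ?S \<Longrightarrow> (y, c) \<in> s \<Longrightarrow> y = c"
      using finite_minimal[OF so, of ?S] by blast
    have least: "(c, x) \<in> s" if x: "x \<in> ?S" for x
    proof -
      have bc: "(b, c) \<in> s" "(b, x) \<in> s" using c(1) x by auto
      obtain m where m: "m \<in> max_lower_bounds s c x" "(b, m) \<in> s"
        using qsl_max[OF s bc] by blast
      have "m \<in> Domain g"
        using g'(2) c(1) x m(1) unfolding sub_bqsl_def max_lower_bound_closed_def by blast
      then have "m = c" using c(2)[of m] m by (auto simp: max_lower_bounds_iff)
      then show ?thesis using m(1) by (simp add: max_lower_bounds_iff)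
    qed
    obtain c' where c': "(c, c') \<in> g" using c(1) by blast
    have "U = {a \<in> Range g. (c', a) \<in> r}"
    proof (intro equalityI subsetI)
      fix a assume "a \<in> U"
      then obtain x where "(x, a) \<in> g" "(b, x) \<in> s" unfolding U_def by blast
      then show "a \<in> {a \<in> Range g. (c', a) \<in> r}" using least[of x] ord[OF c', of x a] by blast
    next
      fix a assume "a \<in> {a \<in> Range g. (c', a) \<in> r}"
      then obtain x where x: "(x, a) \<in> g" "(c', a) \<in> r" by blast
      then have "(b, x) \<in> s" using ord[OF c' x(1)] c(1) po_trans[OF so] by blast
      then show "a \<in> U" using x unfolding U_def by blast
    qed
    then show ?thesis using c' by blast
  qed simp
  have "D \<subseteq> Range g" unfolding D_def by blast
  moreover have "finite (Range g)" using g'(1) by (simp add: finite_Range)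
  ultimately have "\<exists>y\<in>Field r. (\<forall>a\<in>Range g. ((y, a) \<in> r \<longleftrightarrow> a \<in> U) \<and> ((a, y) \<in> r \<longleftrightarrow> a \<in> D)) \<and>
      (\<forall>a\<in>Range g - U. \<forall>p. (p, a) \<in> r \<longrightarrow> (p, y) \<in> r \<longrightarrow> (\<exists>\<delta>\<in>D. (p, \<delta>) \<in> r))"
    using g'(3) minD down disj DU princ
    by (intro ext[unfolded one_point_ext_def, rule_format]) blast
  then obtain y where y: "y \<in> Field r"
      "\<And>a. a \<in> Range g \<Longrightarrow> (y, a) \<in> r \<longleftrightarrow> a \<in> U" "\<And>a. a \<in> Range g \<Longrightarrow> (a, y) \<in> r \<longleftrightarrow> a \<in> D"
    and y_cl: "\<And>a p. a \<in> Range g \<Longrightarrow> a \<notin> U \<Longrightarrow> (p, a) \<in> r \<Longrightarrow> (p, y) \<in> r \<Longrightarrow> \<exists>\<delta>\<in>D. (p, \<delta>) \<in> r"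
    by blast
  have U_iff: "x' \<in> U \<longleftrightarrow> (b, x) \<in> s" and D_iff: "x' \<in> D \<longleftrightarrow> (x, b) \<in> s" if "(x, x') \<in> g" for x x'
    using that inj unfolding U_def D_def by blast+
  have yy: "max_lower_bounds r y y \<subseteq> {y}"
    using po_refl[OF ro y(1)] by (auto simp: max_lower_bounds_iff)
  \<comment> \<open>For \<open>a\<close> outside \<open>U\<close>, a maximal lower bound
    \<open>m\<close> of \<open>y\<close> and \<open>a\<close> lies under some
    \<open>\<delta>\<close> in \<open>D\<close>. A maximal lower bound of \<open>\<delta>\<close>
    and \<open>a\<close> above \<open>m\<close> is in the range and below \<open>y\<close>, so it is
    \<open>m\<close>.\<close>
  have ya: "max_lower_bounds r y a \<subseteq> insert y (Range g)" if a: "a \<in> Range g" for a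
  proof
    fix m assume m: "m \<in> max_lower_bounds r y a"
    show "m \<in> insert y (Range g)"
    proof (cases "a \<in> U")
      case True
      then have "(y, a) \<in> r" using y(2) a by blast
      then have "y = m" using m po_refl[OF ro y(1)] by (auto simp: max_lower_bounds_iff)
      then show ?thesis by simp
    next
      case False
      have ma: "(m, a) \<in> r" "(m, y) \<in> r" using m by (auto simp: max_lower_bounds_iff)
      obtain \<delta> where \<delta>: "\<delta> \<in> D" "(m, \<delta>) \<in> r" using y_cl[OF a False ma] by blast
      obtain k where k: "k \<in> max_lower_bounds r \<delta> a" "(m, k) \<in> r"
        using qsl_max[OF r \<delta>(2) ma(1)] by blast
      have \<delta>g: "\<delta> \<in> Range g" using \<delta>(1) unfolding D_def by blast
      have "k \<in> Range g"
        using g'(3) \<delta>g a k(1) unfolding sub_bqsl_def max_lower_bound_closed_def by blast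
      moreover have "(k, y) \<in> r" "(k, a) \<in> r"
        using k(1) y(3)[OF \<delta>g] \<delta>(1) po_trans[OF ro] by (auto simp: max_lower_bounds_iff)
      then have "k = m" using m k(2) by (auto simp: max_lower_bounds_iff)
      ultimately show ?thesis by simp
    qed
  qed
  have "sub_bqsl s (Domain (insert (b, y) g))" using g'(2) cl b(1) by (auto simp: sub_bqsl_def)
  moreover have "sub_bqsl r (Range (insert (b, y) g))"
  proof -
    have "max_lower_bounds r p q \<subseteq> insert y (Range g)"
      if pq: "p \<in> insert y (Range g)" "q \<in> insert y (Range g)" for p q
    proof -
      consider "p = y" "q = y" | "p = y" "q \<in> Range g" | "p \<in> Range g" "q = y"
        | "p \<in> Range g" "q \<in> Range g" using pq by blast
      then show ?thesis
      proof cases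
        case 1
        then show ?thesis using yy by blast
      next
        case 2
        then show ?thesis using ya by blast
      next
        case 3
        then show ?thesis using ya max_lower_bounds_commute by metis
      next
        case 4
        then show ?thesis using g'(3) unfolding sub_bqsl_def max_lower_bound_closed_def by blast
      qed
    qed
    then show ?thesis using g'(3) y(1) by (auto simp: sub_bqsl_def max_lower_bound_closed_def)
  qed
  moreover have "(x, x') \<in> s \<longleftrightarrow> (z, z') \<in> r"
    if xz: "(x, z) \<in> insert (b, y) g" "(x', z') \<in> insert (b, y) g" for x x' z z'
  proof -
    consider "x = b" "z = y" "x' = b" "z' = y" | "x = b" "z = y" "(x', z') \<in> g"
      | "(x, z) \<in> g" "x' = b" "z' = y" | "(x, z) \<in> g" "(x', z') \<in> g" using xz by blast
    then show ?thesis
    proof cases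
      case 1
      then show ?thesis using po_refl[OF so b(1)] po_refl[OF ro y(1)] by simp
    next
      case 2
      then show ?thesis using U_iff[OF 2(3)] y(2)[of z'] by blast
    next
      case 3
      then show ?thesis using D_iff[OF 3(1)] y(3)[of z] by blast
    next
      case 4
      then show ?thesis using ord by blast
    qed
  qed
  ultimately have "partial_iso s r (insert (b, y) g)"
    unfolding partial_iso_def using g'(1) by (intro conjI allI impI) simp_all
  then show ?thesis ..
qed

lemma extend_forth:
  assumes s: "qsl s" "qsl_locally_finite s" and r: "qsl r" "one_point_ext r"
    and g: "partial_iso s r g" and x: "x \<in> Field s"
  shows "\<exists>g'. g \<subseteq> g' \<and> partial_iso s r g' \<and> x \<in> Domain g'"
proof -
  note so = qsl_po[OF s(1)]
  have "finite (insert x (Domain g))" "insert x (Domain g) \<subseteq> Field s"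
    using g x by (auto simp: partial_iso_def sub_bqsl_def finite_Domain)
  then obtain B where B: "finite B" "insert x (Domain g) \<subseteq> B" "B \<subseteq> Field s" "max_lower_bound_closed s B"
    using s(2) unfolding qsl_locally_finite_def by meson
  have "Domain g \<subseteq> B \<Longrightarrow> \<exists>g'. g \<subseteq> g' \<and> partial_iso s r g' \<and> B \<subseteq> Domain g'"
    using g
  proof (induction "card (B - Domain g)" arbitrary: g rule: less_induct)
    case less
    show ?case
    proof (cases "B \<subseteq> Domain g")
      case True
      then show ?thesis using less.prems by blast
    next
      case False
      \<comment> \<open>Elements of \<open>B\<close> are added from below: a maximal lower bound of
        \<open>b\<close> with an earlier element lies in \<open>B\<close> and under
        \<open>b\<close>, so it is \<open>b\<close> or already present.\<close>
      then obtain b where b: "b \<in> B - Domain g" "\<And>y. y \<in> B - Domain g \<Longrightarrow> (y, b) \<in> s \<Longrightarrow> y = b"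
        using finite_minimal[OF so, of "B - Domain g"] B(1) by blast
      have below: "m \<in> insert b (Domain g)"
        if "m \<in> max_lower_bounds s p q" "p \<in> B" "q \<in> B" "p = b \<or> q = b" for m p q
      proof -
        have "m \<in> B" using that(1-3) B(4) unfolding max_lower_bound_closed_def by blast
        moreover have "(m, b) \<in> s" using that(1,4) by (auto simp: max_lower_bounds_iff)
        ultimately show ?thesis using b(2)[of m] by blast
      qed
      have "max_lower_bound_closed s (insert b (Domain g))"
        unfolding max_lower_bound_closed_def
      proof (intro ballI subsetI)
        fix p q m assume pq: "p \<in> insert b (Domain g)" "q \<in> insert b (Domain g)"
          and m: "m \<in> max_lower_bounds s p q"
        show "m \<in> insert b (Domain g)"
        proof (cases "p = b \<or> q = b")
          case True
          then show ?thesis using below[OF m] pq b(1) less.prems(1) by blast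
        next
          case False
          then have "p \<in> Domain g" "q \<in> Domain g" using pq by auto
          then show ?thesis using less.prems(2) m
            unfolding partial_iso_def sub_bqsl_def max_lower_bound_closed_def by blast
        qed
      qed
      then obtain y where y: "partial_iso s r (insert (b, y) g)"
        using forth_step[OF s(1) r less.prems(2), of b] b(1) B(3) by blast
      have "card (B - Domain (insert (b, y) g)) < card (B - Domain g)"
        using b(1) B(1) by (intro psubset_card_mono) auto
      moreover have "Domain (insert (b, y) g) \<subseteq> B" using less.prems(1) b(1) by auto
      ultimately obtain g' where "insert (b, y) g \<subseteq> g'" "partial_iso s r g'" "B \<subseteq> Domain g'"
        using less.hyps[OF _ _ y] by blast
      then show ?thesis by blast
    qed
  qed
  then show ?thesis using B(2) by blast
qed

lemma extend_back:
  assumes "qsl r" "qsl_locally_finite r" "qsl s" "one_point_ext s"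
    and "partial_iso s r g" "y \<in> Field r"
  shows "\<exists>g'. g \<subseteq> g' \<and> partial_iso s r g' \<and> y \<in> Range g'"
proof -
  obtain h where h: "g\<inverse> \<subseteq> h" "partial_iso r s h" "y \<in> Domain h"
    using extend_forth[OF assms(1-4) partial_iso_converse[OF assms(5)] assms(6)] by blast
  then show ?thesis using partial_iso_converse[OF h(2)] by (intro exI[of _ "h\<inverse>"]) auto
qed

text \<open>The union \<open>G\<close> may be infinite and so need not be a partial isomorphism.
  What survives, and suffices, is that each finite part of \<open>G\<close> extends to a partial
  isomorphism inside \<open>G\<close>.\<close>

lemma partial_iso_limit:
  assumes "partial_iso s r g0"
    and step: "\<And>g k. partial_iso s r g \<Longrightarrow> \<exists>g'. g \<subseteq> g' \<and> partial_iso s r g' \<and> Q (k :: nat) g'"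
  obtains G where "g0 \<subseteq> G"
    "\<And>S. finite S \<Longrightarrow> S \<subseteq> G \<Longrightarrow> \<exists>g. partial_iso s r g \<and> S \<subseteq> g \<and> g \<subseteq> G"
    "\<And>k. \<exists>g\<subseteq>G. Q k g"
proof -
  have "\<exists>f. \<forall>k. (partial_iso s r (f k) \<and> (k = 0 \<longrightarrow> f k = g0)) \<and>
      (f k \<subseteq> f (Suc k) \<and> Q k (f (Suc k)))"
  proof (rule dependent_nat_choice)
    show "\<exists>g. partial_iso s r g \<and> ((0::nat) = 0 \<longrightarrow> g = g0)" using assms(1) by blast
    fix g and k :: nat assume "partial_iso s r g \<and> (k = 0 \<longrightarrow> g = g0)"
    then show "\<exists>g'. (partial_iso s r g' \<and> (Suc k = 0 \<longrightarrow> g' = g0)) \<and> g \<subseteq> g' \<and> Q k g'"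
      using step[of g k] by auto
  qed
  then obtain f where f: "\<And>k. partial_iso s r (f k)" "f 0 = g0" "\<And>k. f k \<subseteq> f (Suc k)"
    "\<And>k. Q k (f (Suc k))" by blast
  have mono: "f i \<subseteq> f j" if "i \<le> j" for i j using lift_Suc_mono_le[of f] f(3) that by blast
  have some_stage: "\<exists>k. S \<subseteq> f k" if "finite S" "S \<subseteq> (\<Union>k. f k)" for S
    using that
  proof (induction S rule: finite_induct)
    case (insert z S)
    then obtain i j where ij: "S \<subseteq> f i" "z \<in> f j" by auto
    have "insert z S \<subseteq> f (max i j)" using ij mono[of i "max i j"] mono[of j "max i j"] by auto
    then show ?case ..
  qed simp
  have "\<exists>g. partial_iso s r g \<and> S \<subseteq> g \<and> g \<subseteq> (\<Union>k. f k)"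
    if S: "finite S" "S \<subseteq> (\<Union>k. f k)" for S
  proof -
    obtain k where "S \<subseteq> f k" using some_stage[OF S] ..
    then show ?thesis using f(1)[of k] by (intro exI[of _ "f k"]) auto
  qed
  moreover have "\<exists>g\<subseteq>(\<Union>k. f k). Q k g" for k using f(4)[of k] by (intro exI[of _ "f (Suc k)"]) auto
  moreover have "g0 \<subseteq> (\<Union>k. f k)" using f(2) by auto
  ultimately show thesis using that[of "\<Union>k. f k"] by simp
qed

lemma sub_bqsl_minimum:
  assumes "Partial_order r" "is_minimum r m"
  shows "sub_bqsl r {m}"
proof -
  have "k = m" if k: "k \<in> max_lower_bounds r m m" for k
  proof -
    have "(k, m) \<in> r" using k by (simp add: max_lower_bounds_iff)
    moreover from this have "(m, k) \<in> r" using assms(2) FieldI1 unfolding is_minimum_def by metis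
    ultimately show ?thesis using po_antisym[OF assms(1)] by blast
  qed
  then show ?thesis using assms(2) by (auto simp: sub_bqsl_def is_minimum_def max_lower_bound_closed_def)
qed

lemma partial_iso_minima:
  assumes s: "Partial_order s" "is_minimum s m" and r: "Partial_order r" "is_minimum r m'"
  shows "partial_iso s r {(m, m')}"
proof -
  have "(m, m) \<in> s" "(m', m') \<in> r" using s(2) r(2) by (auto simp: is_minimum_def)
  then show ?thesis using sub_bqsl_minimum[OF s] sub_bqsl_minimum[OF r] by (simp add: partial_iso_def)
qed

locale iso_limit =
  fixes s :: "'a rel" and r :: "'b rel" and G
  assumes qs: "qsl s" and qr: "qsl r"
    and G: "\<And>S. finite S \<Longrightarrow> S \<subseteq> G \<Longrightarrow> \<exists>g. partial_iso s r g \<and> S \<subseteq> g \<and> g \<subseteq> G"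
    and total: "Field s \<subseteq> Domain G"
begin

definition f :: "'a \<Rightarrow> 'b"
  where "f x = (SOME y. (x, y) \<in> G)"

lemma G_pair:
  assumes "z \<in> G" "z' \<in> G"
  obtains g where "partial_iso s r g" "z \<in> g" "z' \<in> g" "g \<subseteq> G"
  using G[of "{z, z'}"] assms by auto

lemma G_functional:
  assumes "(x, y) \<in> G" "(x, y') \<in> G"
  shows "y = y'"
  using assms by (rule G_pair) (rule partial_iso_functional[OF qsl_po[OF qs] qsl_po[OF qr]])

lemma f_eq: "(x, y) \<in> G \<Longrightarrow> f x = y"
  unfolding f_def using G_functional by (intro some_equality) auto

lemma f_G:
  assumes "x \<in> Field s"
  shows "(x, f x) \<in> G"
proof -
  obtain y where "(x, y) \<in> G" using total assms by blast
  then show ?thesis using f_eq by simp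
qed

lemma G_Field:
  assumes "(x, y) \<in> G"
  shows "x \<in> Field s" "y \<in> Field r"
proof -
  obtain g where "partial_iso s r g" "(x, y) \<in> g" using assms assms by (rule G_pair)
  then show "x \<in> Field s" "y \<in> Field r" by (auto dest: partial_iso_Field)
qed

lemma f_order:
  assumes "x \<in> Field s" "y \<in> Field s"
  shows "(x, y) \<in> s \<longleftrightarrow> (f x, f y) \<in> r"
  using f_G[OF assms(1)] f_G[OF assms(2)] by (rule G_pair) (rule partial_iso_order)

lemma f_max_lower_bounds:
  assumes p: "p \<in> Field s" and q: "q \<in> Field s"
  shows "max_lower_bounds r (f p) (f q) = f ` max_lower_bounds s p q"
proof -
  obtain g where g: "partial_iso s r g" "(p, f p) \<in> g" "(q, f q) \<in> g" "g \<subseteq> G"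
    using f_G[OF p] f_G[OF q] by (rule G_pair)
  show ?thesis
  proof (intro equalityI subsetI)
    fix m' assume m': "m' \<in> max_lower_bounds r (f p) (f q)"
    then have "m' \<in> Range g"
      using g(1-3) unfolding partial_iso_def sub_bqsl_def max_lower_bound_closed_def by blast
    then obtain m where m: "(m, m') \<in> g" by blast
    have "m \<in> max_lower_bounds s p q"
      using partial_iso_max_lower_bounds[OF qr qs partial_iso_converse[OF g(1)]] g(2,3) m m' by blast
    then show "m' \<in> f ` max_lower_bounds s p q" using f_eq m g(4) by blast
  next
    fix m' assume "m' \<in> f ` max_lower_bounds s p q"
    then obtain m where m: "m' = f m" "m \<in> max_lower_bounds s p q" by blast
    then have "m \<in> Domain g"
      using g(1-3) unfolding partial_iso_def sub_bqsl_def max_lower_bound_closed_def by blast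
    then have "(m, f m) \<in> g" using f_eq g(4) by blast
    then show "m' \<in> max_lower_bounds r (f p) (f q)"
      using partial_iso_max_lower_bounds[OF qs qr g(1-3)] m by blast
  qed
qed

lemma f_bqsl_embedding:
  assumes "(m, m') \<in> G" "is_minimum s m" "is_minimum r m'"
  shows "bqsl_embedding s r f"
  unfolding bqsl_embedding_def
proof (intro conjI allI impI ballI)
  show "f ` Field s \<subseteq> Field r" using f_G G_Field(2) by auto
next
  fix k assume "is_minimum s k"
  then have "k = m" by (rule is_minimum_unique[OF qsl_po[OF qs] _ assms(2)])
  then show "is_minimum r (f k)" using f_eq[OF assms(1)] assms(3) by simp
next
  fix x y assume xy: "x \<in> Field s" "y \<in> Field s"
  show "(x, y) \<in> s \<longleftrightarrow> (f x, f y) \<in> r" by (rule f_order[OF xy])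
  show "max_lower_bounds r (f x) (f y) = f ` max_lower_bounds s x y"
    by (rule f_max_lower_bounds[OF xy])
qed

lemma f_order_iso:
  assumes "Field r \<subseteq> Range G"
  shows "order_iso s r f"
proof -
  have "inj_on f (Field s)"
  proof (rule inj_onI)
    fix x y assume xy: "x \<in> Field s" "y \<in> Field s" "f x = f y"
    have "(f x, f x) \<in> r" using po_refl[OF qsl_po[OF qr]] G_Field(2)[OF f_G[OF xy(1)]] by simp
    then have "(x, y) \<in> s" "(y, x) \<in> s" using f_order xy by simp_all
    then show "x = y" using po_antisym[OF qsl_po[OF qs]] by blast
  qed
  moreover have "f ` Field s = Field r"
  proof (intro equalityI subsetI)
    fix y assume "y \<in> Field r"
    then obtain x where "(x, y) \<in> G" using assms by blast
    then show "y \<in> f ` Field s" using f_eq[of x y] G_Field(1)[of x y] by auto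
  qed (use f_G G_Field(2) in auto)
  ultimately show ?thesis using f_order by (simp add: order_iso_def bij_betw_def)
qed

end

section \<open>Universality and uniqueness by back and forth\<close>

lemma from_nat_into_Field: "is_minimum s m \<Longrightarrow> from_nat_into (Field s) k \<in> Field s"
  by (rule from_nat_into) (auto simp: is_minimum_def)

lemma one_point_ext_universal:
  assumes s: "bqsl s" "qsl_locally_finite s" "countable (Field s)"
    and r: "bqsl r" "one_point_ext r"
  shows "\<exists>f. bqsl_embedding s r f"
proof -
  obtain m m' where m: "is_minimum s m" "is_minimum r m'" using s r unfolding bqsl_def by blast
  have q: "qsl s" "qsl r" using s r by (auto simp: bqsl_def)
  have step: "\<exists>g'. g \<subseteq> g' \<and> partial_iso s r g' \<and> from_nat_into (Field s) k \<in> Domain g'"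
    if "partial_iso s r g" for g k
    using extend_forth[OF q(1) s(2) q(2) r(2) that from_nat_into_Field[OF m(1)]] .
  obtain G where lim: "{(m, m')} \<subseteq> G"
    "\<And>S. finite S \<Longrightarrow> S \<subseteq> G \<Longrightarrow> \<exists>g. partial_iso s r g \<and> S \<subseteq> g \<and> g \<subseteq> G"
    "\<And>k. \<exists>g\<subseteq>G. from_nat_into (Field s) k \<in> Domain g"
    by (rule partial_iso_limit[where Q = "\<lambda>k g. from_nat_into (Field s) k \<in> Domain g",
        OF partial_iso_minima[OF qsl_po[OF q(1)] m(1) qsl_po[OF q(2)] m(2)] step]) (assumption, rule that)
  interpret iso_limit s r G
  proof
    show "Field s \<subseteq> Domain G"
    proof
      fix x assume "x \<in> Field s"
      then obtain k where "from_nat_into (Field s) k = x" using from_nat_into_surj[OF s(3)] by blast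
      then show "x \<in> Domain G" using lim(3)[of k] by blast
    qed
  qed (use q lim in auto)
  show ?thesis using f_bqsl_embedding lim(1) m by blast
qed

text \<open>Started from the pair of minima this gives uniqueness; started from an isomorphism of
  finite sub-bqsls it gives homogeneity.\<close>

lemma back_and_forth:
  assumes s: "bqsl s" "qsl_locally_finite s" "countable (Field s)" "one_point_ext s"
    and r: "bqsl r" "qsl_locally_finite r" "countable (Field r)" "one_point_ext r"
    and g0: "partial_iso s r g0"
  shows "\<exists>f. order_iso s r f \<and> (\<forall>(x, y)\<in>g0. f x = y)"
proof -
  obtain m m' where m: "is_minimum s m" "is_minimum r m'" using s r unfolding bqsl_def by blast
  have q: "qsl s" "qsl r" using s r by (auto simp: bqsl_def)
  have step: "\<exists>g'. g \<subseteq> g' \<and> partial_iso s r g' \<and>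
      (from_nat_into (Field s) k \<in> Domain g' \<and> from_nat_into (Field r) k \<in> Range g')"
    if g: "partial_iso s r g" for g k
  proof -
    obtain h where h: "g \<subseteq> h" "partial_iso s r h" "from_nat_into (Field s) k \<in> Domain h"
      using extend_forth[OF q(1) s(2) q(2) r(4) g from_nat_into_Field[OF m(1)]] by blast
    obtain h' where h': "h \<subseteq> h'" "partial_iso s r h'" "from_nat_into (Field r) k \<in> Range h'"
      using extend_back[OF q(2) r(2) q(1) s(4) h(2) from_nat_into_Field[OF m(2)]] by blast
    have "from_nat_into (Field s) k \<in> Domain h'" using h(3) h'(1) by blast
    then show ?thesis using h(1) h' by blast
  qed
  obtain G where lim: "g0 \<subseteq> G"
    "\<And>S. finite S \<Longrightarrow> S \<subseteq> G \<Longrightarrow> \<exists>g. partial_iso s r g \<and> S \<subseteq> g \<and> g \<subseteq> G"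
    "\<And>k. \<exists>g\<subseteq>G. from_nat_into (Field s) k \<in> Domain g \<and> from_nat_into (Field r) k \<in> Range g"
    by (rule partial_iso_limit[where
        Q = "\<lambda>k g. from_nat_into (Field s) k \<in> Domain g \<and> from_nat_into (Field r) k \<in> Range g",
        OF g0 step]) (assumption, rule that)
  interpret iso_limit s r G
  proof
    show "Field s \<subseteq> Domain G"
    proof
      fix x assume "x \<in> Field s"
      then obtain k where "from_nat_into (Field s) k = x" using from_nat_into_surj[OF s(3)] by blast
      then show "x \<in> Domain G" using lim(3)[of k] by blast
    qed
  qed (use q lim in auto)
  have "Field r \<subseteq> Range G"
  proof
    fix x assume "x \<in> Field r"
    then obtain k where "from_nat_into (Field r) k = x" using from_nat_into_surj[OF r(3)] by blast
    then show "x \<in> Range G" using lim(3)[of k] by blast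
  qed
  then show ?thesis using f_order_iso f_eq lim(1) by blast
qed

lemma Field_Restr: "Partial_order r \<Longrightarrow> A \<subseteq> Field r \<Longrightarrow> Field (Restr r A) = A"
  using po_refl by (fastforce simp: Field_def)

lemma one_point_ext_universal_homogeneous:
  assumes "bqsl r" "countable (Field r)" "qsl_locally_finite r" "one_point_ext r"
  shows "universal_homogeneous_bqsl r"
  unfolding universal_homogeneous_bqsl_def
proof (intro conjI allI impI)
  fix s :: "nat rel" assume "bqsl s \<and> qsl_locally_finite s"
  then show "\<exists>f. bqsl_embedding s r f" using one_point_ext_universal assms by auto
next
  fix A B f assume A: "finite A \<and> finite B \<and> sub_bqsl r A \<and> sub_bqsl r B \<and>
    order_iso (Restr r A) (Restr r B) f"
  have po: "Partial_order r" using assms(1) by (simp add: bqsl_def qsl_def)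
  have F: "Field (Restr r A) = A" "Field (Restr r B) = B"
    using A Field_Restr[OF po] unfolding sub_bqsl_def by blast+
  let ?g = "(\<lambda>x. (x, f x)) ` A"
  have fAB: "f ` A = B" using A F by (simp add: order_iso_def bij_betw_def)
  have "Domain ?g = A" "Range ?g = B" using fAB by (auto simp: Domain_iff Range_iff)
  moreover have "(x, x') \<in> r \<longleftrightarrow> (f x, f x') \<in> r" if "x \<in> A" "x' \<in> A" for x x'
    using A F fAB that by (auto simp: order_iso_def)
  ultimately have "partial_iso r r ?g" using A by (auto simp: partial_iso_def)
  from back_and_forth[OF assms(1,3,2,4) assms(1,3,2,4) this]
  show "\<exists>g. order_iso r r g \<and> (\<forall>x\<in>A. g x = f x)" by auto
qed (use assms in auto)

text \<open>The prescribed extension of \<open>A\<close> is first built as an abstract finite bqsl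
  \<open>s\<close>. Universality embeds it, homogeneity moves the copy of \<open>A\<close> back onto
  \<open>A\<close>, and the image of the added point is the required element.\<close>

lemma universal_homogeneous_one_point_ext:
  assumes uh: "universal_homogeneous_bqsl r"
  shows "one_point_ext r"
proof (rule one_point_extI)
  fix A D U
  assume A: "finite A" "sub_bqsl r A" and D: "D \<subseteq> A" "\<exists>m\<in>D. is_minimum r m"
    and "\<forall>x\<in>A. \<forall>y\<in>D. (x, y) \<in> r \<longrightarrow> x \<in> D" and "D \<inter> U = {}"
    and "\<forall>x\<in>D. \<forall>y\<in>U. (x, y) \<in> r" and U: "U = {} \<or> (\<exists>c\<in>A. U = {a \<in> A. (c, a) \<in> r})"
  then have down: "\<And>x y. x \<in> A \<Longrightarrow> y \<in> D \<Longrightarrow> (x, y) \<in> r \<Longrightarrow> x \<in> D"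
    and DU: "D \<inter> U = {}" "\<And>x y. x \<in> D \<Longrightarrow> y \<in> U \<Longrightarrow> (x, y) \<in> r"
    by blast+
  have q: "qsl r" using uh by (simp add: universal_homogeneous_bqsl_def bqsl_def)
  note po = qsl_po[OF q]
  have AF: "A \<subseteq> Field r" using A(2) by (simp add: sub_bqsl_def)
  have UA: "U \<subseteq> A" using U by auto
  have up: "y \<in> U" if "x \<in> U" "y \<in> A" "(x, y) \<in> r" for x y
    using U that po_trans[OF po] by blast
  \<comment> \<open>The successor leaves 0 free for the added point.\<close>
  define h where "h x = Suc (to_nat_on A x)" for x
  have h_inj: "h x = h y \<longleftrightarrow> x = y" if "x \<in> A" "y \<in> A" for x y
    using that A(1) by (simp add: h_def countable_finite)
  have h0: "h x \<noteq> 0" "0 \<noteq> h x" for x by (simp_all add: h_def)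
  define s where "s = {(h x, h y) | x y. x \<in> A \<and> y \<in> A \<and> (x, y) \<in> r} \<union>
    {(h x, 0) | x. x \<in> D} \<union> {(0, h x) | x. x \<in> U} \<union> {(0, 0)}"
  have s1: "(h x, h y) \<in> s \<longleftrightarrow> (x, y) \<in> r" if "x \<in> A" "y \<in> A" for x y
    using that unfolding s_def by (auto simp: h_inj h0)
  have s2: "(h x, 0) \<in> s \<longleftrightarrow> x \<in> D" if "x \<in> A" for x
    using that subsetD[OF D(1)] unfolding s_def by (auto simp: h_inj h0)
  have s3: "(0, h x) \<in> s \<longleftrightarrow> x \<in> U" if "x \<in> A" for x
    using that subsetD[OF UA] unfolding s_def by (auto simp: h_inj h0)
  have s4: "(0, 0) \<in> s" by (simp add: s_def)
  have s_cases: "a \<in> insert 0 (h ` A)" "b \<in> insert 0 (h ` A)" if "(a, b) \<in> s" for a b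
    using that D(1) UA unfolding s_def by auto
  have s_refl: "(a, a) \<in> s" if "a \<in> insert 0 (h ` A)" for a
    using that s1 s4 po_refl[OF po] AF by auto
  have Fs: "Field s = insert 0 (h ` A)"
  proof (intro equalityI subsetI)
    fix a assume "a \<in> Field s"
    then show "a \<in> insert 0 (h ` A)" unfolding Field_def using s_cases by fast
  next
    fix a assume "a \<in> insert 0 (h ` A)"
    then have "(a, a) \<in> s" by (rule s_refl)
    then show "a \<in> Field s" by (rule FieldI1)
  qed
  have s_trans: "(a, c) \<in> s" if ab: "(a, b) \<in> s" and bc: "(b, c) \<in> s" for a b c
  proof -
    have abc: "a = 0 \<or> (\<exists>x\<in>A. a = h x)" "b = 0 \<or> (\<exists>x\<in>A. b = h x)" "c = 0 \<or> (\<exists>x\<in>A. c = h x)"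
      using s_cases[OF ab] s_cases[OF bc] by auto
    consider "b = 0" "a = 0 \<or> c = 0" | x z where "b = 0" "a = h x" "c = h z" "x \<in> A" "z \<in> A"
      | y where "b = h y" "y \<in> A" "a = 0" "c = 0"
      | y z where "b = h y" "y \<in> A" "a = 0" "c = h z" "z \<in> A"
      | y x where "b = h y" "y \<in> A" "c = 0" "a = h x" "x \<in> A"
      | y x z where "b = h y" "y \<in> A" "a = h x" "c = h z" "x \<in> A" "z \<in> A"
      using abc by blast
    then show ?thesis
    proof cases
      case 1
      then show ?thesis using ab bc by auto
    next
      case (2 x z)
      then have "x \<in> D" "z \<in> U" using ab bc s2 s3 by simp_all
      then show ?thesis using DU(2)[of x z] s1 2 by simp
    next
      case 3
      then show ?thesis using s4 by simp
    next
      case (4 y z)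
      then have "y \<in> U" "(y, z) \<in> r" using ab bc s1 s3 by simp_all
      then show ?thesis using up[of y z] s3 4 by simp
    next
      case (5 y x)
      then have "y \<in> D" "(x, y) \<in> r" using ab bc s1 s2 by simp_all
      then show ?thesis using down[of x y] s2 5 by simp
    next
      case (6 y x z)
      then have "(x, y) \<in> r" "(y, z) \<in> r" using ab bc s1 by simp_all
      then show ?thesis using po_trans[OF po, of x y z] s1 6 by simp
    qed
  qed
  have s_antisym: "a = b" if ab: "(a, b) \<in> s" and ba: "(b, a) \<in> s" for a b
  proof -
    consider "a = 0" "b = 0" | x where "x \<in> A" "a = h x" "b = 0" | y where "y \<in> A" "a = 0" "b = h y"
      | x y where "x \<in> A" "y \<in> A" "a = h x" "b = h y" using s_cases[OF ab] by blast
    then show ?thesis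
    proof cases
      case 1
      then show ?thesis by simp
    next
      case (2 x)
      then have "x \<in> D" "x \<in> U" using ab ba s2 s3 by simp_all
      then show ?thesis using DU(1) by blast
    next
      case (3 y)
      then have "y \<in> D" "y \<in> U" using ab ba s2 s3 by simp_all
      then show ?thesis using DU(1) by blast
    next
      case (4 x y)
      then have "(x, y) \<in> r" "(y, x) \<in> r" using ab ba s1 by simp_all
      then show ?thesis using po_antisym[OF po, of x y] 4 by simp
    qed
  qed
  have sp: "Partial_order s"
    unfolding order_on_defs
  proof (intro conjI refl_onI transI antisymI)
    show "s \<subseteq> Field s \<times> Field s" by (auto intro: FieldI1 FieldI2)
    show "(a, a) \<in> s" if "a \<in> Field s" for a using that s_refl Fs by simp
  qed (fact s_trans s_antisym)+
  have "finite (Field s)" using Fs A(1) by simp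
  note sq = finite_qsl[OF sp this]
  obtain m where m: "m \<in> D" "is_minimum r m" using D(2) by blast
  have min_s: "is_minimum s (h m)"
    using m subsetD[OF D(1) m(1)] subsetD[OF AF] unfolding is_minimum_def Fs by (auto simp: s1 s2)
  then have "bqsl s" using sq(1) unfolding bqsl_def by blast
  then obtain e where e: "bqsl_embedding s r e"
    using uh sq(2) unfolding universal_homogeneous_bqsl_def by blast
  have e_Field: "e a \<in> Field r" if "a \<in> Field s" for a using e that unfolding bqsl_embedding_def by blast
  have e_order: "(e a, e b) \<in> r \<longleftrightarrow> (a, b) \<in> s" if "a \<in> Field s" "b \<in> Field s" for a b
    using e that unfolding bqsl_embedding_def by blast
  have e_max: "max_lower_bounds r (e a) (e b) = e ` max_lower_bounds s a b"
    if "a \<in> Field s" "b \<in> Field s" for a b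
    using e that unfolding bqsl_embedding_def by blast
  have hF: "h x \<in> Field s" if "x \<in> A" for x using Fs that by simp
  have F0: "0 \<in> Field s" using Fs by simp
  define k where "k x = e (h x)" for x
  have k_order: "(k x, k y) \<in> r \<longleftrightarrow> (x, y) \<in> r" if "x \<in> A" "y \<in> A" for x y
    using that by (simp add: k_def e_order hF s1)
  have k_inj: "inj_on k A"
  proof (rule inj_onI)
    fix x y assume xy: "x \<in> A" "y \<in> A" "k x = k y"
    have "(k x, k x) \<in> r" using xy k_order po_refl[OF po] AF by blast
    then have "(x, y) \<in> r" "(y, x) \<in> r" using xy k_order[of x y] k_order[of y x] by simp_all
    then show "x = y" using po_antisym[OF po] by blast
  qed
  have kF: "k ` A \<subseteq> Field r" using hF e_Field by (auto simp: k_def)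
  have "sub_bqsl r (k ` A)"
    unfolding sub_bqsl_def max_lower_bound_closed_def
  proof (intro conjI ballI)
    show "k ` A \<subseteq> Field r" by (rule kF)
    have "is_minimum r (k m)" using e min_s unfolding bqsl_embedding_def k_def by blast
    then show "\<exists>m\<in>k ` A. is_minimum r m" using m D(1) by blast
    fix p' q' assume "p' \<in> k ` A" "q' \<in> k ` A"
    then obtain p q where pq: "p \<in> A" "q \<in> A" "p' = e (h p)" "q' = e (h q)" by (auto simp: k_def)
    have "max_lower_bounds s (h p) (h q) \<subseteq> h ` A"
    proof
      fix z assume z: "z \<in> max_lower_bounds s (h p) (h q)"
      \<comment> \<open>Homogeneity applies once the copy of \<open>A\<close> is closed on its own.
        The added point is not a maximal lower bound of two old ones, because the least element of
        \<open>U\<close> lies strictly between; this is the purpose of the principality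
        clause.\<close>
      have "z \<noteq> 0"
      proof
        assume z0: "z = 0"
        then have "p \<in> U" "q \<in> U" using z s3 pq by (auto simp: max_lower_bounds_iff)
        then obtain c where c: "c \<in> A" "U = {a \<in> A. (c, a) \<in> r}" using U by blast
        then have "c \<in> U" using po_refl[OF po] AF by blast
        then have "(0, h c) \<in> s" using s3 c by blast
        moreover have "(h c, h p) \<in> s" "(h c, h q) \<in> s"
          using \<open>p \<in> U\<close> \<open>q \<in> U\<close> s1 c pq by auto
        ultimately have "h c = 0" using z z0 by (auto simp: max_lower_bounds_iff)
        then show False using h0 by simp
      qed
      moreover have "z \<in> Field s" using z by (auto simp: max_lower_bounds_iff intro: FieldI1)
      ultimately show "z \<in> h ` A" using Fs by simp
    qed
    then show "max_lower_bounds r p' q' \<subseteq> k ` A"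
      using e_max[OF hF[OF pq(1)] hF[OF pq(2)]] pq by (auto simp: k_def)
  qed
  moreover have "order_iso (Restr r (k ` A)) (Restr r A) (inv_into A k)"
    unfolding order_iso_def Field_Restr[OF po kF] Field_Restr[OF po AF]
  proof (intro conjI ballI)
    show "bij_betw (inv_into A k) (k ` A) A"
      using k_inj by (simp add: bij_betw_inv_into inj_on_imp_bij_betw)
    fix x y assume "x \<in> k ` A" "y \<in> k ` A"
    then show "(x, y) \<in> Restr r (k ` A) \<longleftrightarrow> (inv_into A k x, inv_into A k y) \<in> Restr r A"
      using k_inj k_order by auto
  qed
  ultimately have isos: "finite (k ` A) \<and> finite A \<and> sub_bqsl r (k ` A) \<and> sub_bqsl r A \<and>
      order_iso (Restr r (k ` A)) (Restr r A) (inv_into A k)"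
    using A by simp
  have "\<forall>A B f. finite A \<and> finite B \<and> sub_bqsl r A \<and> sub_bqsl r B \<and>
      order_iso (Restr r A) (Restr r B) f \<longrightarrow> (\<exists>g. order_iso r r g \<and> (\<forall>x\<in>A. g x = f x))"
    using uh unfolding universal_homogeneous_bqsl_def by (elim conjE)
  from this[THEN spec, THEN spec, THEN spec, THEN mp, OF isos]
  obtain g where g: "order_iso r r g" "\<forall>x\<in>k ` A. g x = inv_into A k x" by (elim exE conjE)
  have gk: "g (k a) = a" if "a \<in> A" for a using g(2) that k_inj by simp
  have g_order: "(g x, g y) \<in> r \<longleftrightarrow> (x, y) \<in> r" if "x \<in> Field r" "y \<in> Field r" for x y
    using g(1) that unfolding order_iso_def by blast
  have g_surj: "g ` Field r = Field r" using g(1) by (simp add: order_iso_def bij_betw_def)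
  have kFi: "k a \<in> Field r" if "a \<in> A" for a using kF that by blast
  have e0: "e 0 \<in> Field r" using e_Field F0 by blast
  show "\<exists>b\<in>Field r. (\<forall>a\<in>A. ((b, a) \<in> r \<longleftrightarrow> a \<in> U) \<and> ((a, b) \<in> r \<longleftrightarrow> a \<in> D)) \<and>
      (\<forall>a\<in>A - U. \<forall>p. (p, a) \<in> r \<longrightarrow> (p, b) \<in> r \<longrightarrow> (\<exists>\<delta>\<in>D. (p, \<delta>) \<in> r))"
  proof (rule bexI[of _ "g (e 0)"], intro conjI ballI allI impI)
    show "g (e 0) \<in> Field r" using g_surj e0 by blast
    fix a assume a: "a \<in> A"
    have "(g (e 0), a) \<in> r \<longleftrightarrow> (e 0, k a) \<in> r" using g_order[OF e0 kFi[OF a]] gk[OF a] by simp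
    then show "(g (e 0), a) \<in> r \<longleftrightarrow> a \<in> U" using e_order[OF F0 hF[OF a]] s3[OF a] by (simp add: k_def)
    have "(a, g (e 0)) \<in> r \<longleftrightarrow> (k a, e 0) \<in> r" using g_order[OF kFi[OF a] e0] gk[OF a] by simp
    then show "(a, g (e 0)) \<in> r \<longleftrightarrow> a \<in> D" using e_order[OF hF[OF a] F0] s2[OF a] by (simp add: k_def)
  next
    fix a p assume aU: "a \<in> A - U" and p: "(p, a) \<in> r" "(p, g (e 0)) \<in> r"
    then have a: "a \<in> A" "a \<notin> U" by auto
    have "p \<in> Field r" using p(1) by (rule FieldI1)
    then obtain p' where p': "p' \<in> Field r" "p = g p'" using g_surj by blast
    have "(p', e 0) \<in> r" "(p', e (h a)) \<in> r"
      using p p' g_order[OF p'(1) e0] g_order[OF p'(1) kFi[OF a(1)]] gk[OF a(1)] by (simp_all add: k_def)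
    \<comment> \<open>The embedding preserves maximal lower bounds, so \<open>m\<close> comes from
      one in \<open>s\<close>. As \<open>a\<close> is not in \<open>U\<close>, that one is not the
      added point and therefore belongs to \<open>D\<close>.\<close>
    then obtain m where m: "m \<in> max_lower_bounds r (e 0) (e (h a))" "(p', m) \<in> r"
      using qsl_max[OF q] by blast
    then obtain z where z: "m = e z" "z \<in> max_lower_bounds s 0 (h a)"
      using e_max[OF F0 hF[OF a(1)]] by auto
    have "(z, h a) \<in> s" using z(2) by (simp add: max_lower_bounds_iff)
    then have "z \<noteq> 0" using s3[OF a(1)] a(2) by metis
    moreover have "z \<in> Field s" using z(2) by (auto simp: max_lower_bounds_iff intro: FieldI1)
    ultimately obtain \<delta> where \<delta>: "\<delta> \<in> A" "z = h \<delta>" using Fs by auto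
    then have "\<delta> \<in> D" using z(2) s2 by (auto simp: max_lower_bounds_iff)
    moreover have "(p, \<delta>) \<in> r"
      using m(2) z(1) \<delta> g_order[OF p'(1) kFi[OF \<delta>(1)]] gk[OF \<delta>(1)] p'(2) by (simp add: k_def)
    ultimately show "\<exists>\<delta>\<in>D. (p, \<delta>) \<in> r" by blast
  qed
qed

section \<open>The poset of the third part\<close>

context gens
begin

text \<open>This undoes \<open>shift_poset\<close>: the top is dropped, and the empty set, the
  bottom of the lattice, returns as the minimum.\<close>

definition QQ :: "tree set set"
  where "QQ = insert {} (JJ3 - {UNIV})"

text \<open>The existence claim asks for a relation on the natural numbers, so the sets are
  numbered.\<close>

definition code :: "tree set \<Rightarrow> nat"
  where "code = to_nat_on QQ"

definition Qnat :: "nat rel"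
  where "Qnat = {(code X, code Y) | X Y. X \<in> QQ \<and> Y \<in> QQ \<and> X \<subseteq> Y}"

lemma countable_JJ: "countable JJ"
proof (rule countable_subset)
  show "JJ \<subseteq> (\<Union>d. range (C d))"
  proof
    fix X assume X: "X \<in> JJ"
    then obtain d where d: "lvl_closed d X" using JJ_Def unfolding Def_def by blast
    obtain t where "X = C d t" using JJ_eq_C[OF X d] by blast
    then show "X \<in> (\<Union>d. range (C d))" by auto
  qed
  show "countable (\<Union>d. range (C d))" using finite_C by (simp add: countable_finite)
qed

lemma countable_QQ: "countable QQ"
proof -
  have "JJ3 - {UNIV} \<subseteq> JJ" by (auto simp: JJ3_def)
  then have "countable (JJ3 - {UNIV})" by (rule countable_subset) (rule countable_JJ)
  then show ?thesis unfolding QQ_def by (rule countable_insert)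
qed

lemma code_inj: "X \<in> QQ \<Longrightarrow> Y \<in> QQ \<Longrightarrow> code X = code Y \<longleftrightarrow> X = Y"
  unfolding code_def using countable_QQ by simp

lemma Qnat_iff: "X \<in> QQ \<Longrightarrow> Y \<in> QQ \<Longrightarrow> (code X, code Y) \<in> Qnat \<longleftrightarrow> X \<subseteq> Y"
  unfolding Qnat_def using code_inj by auto

lemma Field_Qnat: "Field Qnat = code ` QQ"
  unfolding Qnat_def Field_def by auto

lemma Qnat_cases:
  assumes "(a, b) \<in> Qnat"
  obtains X Y where "X \<in> QQ" "Y \<in> QQ" "a = code X" "b = code Y" "X \<subseteq> Y"
  using assms unfolding Qnat_def by blast

lemma Qnat_po: "Partial_order Qnat"
  unfolding order_on_defs
proof (intro conjI refl_onI transI antisymI)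
  show "Qnat \<subseteq> Field Qnat \<times> Field Qnat" by (auto intro: FieldI1 FieldI2)
  show "(a, a) \<in> Qnat" if "a \<in> Field Qnat" for a
    using that Qnat_iff unfolding Field_Qnat by auto
  fix a b c assume "(a, b) \<in> Qnat" "(b, c) \<in> Qnat"
  then obtain X Y Y' Z where "X \<in> QQ" "Y \<in> QQ" "a = code X" "b = code Y" "X \<subseteq> Y"
    "Y' \<in> QQ" "Z \<in> QQ" "b = code Y'" "c = code Z" "Y' \<subseteq> Z"
    by (auto elim!: Qnat_cases)
  then show "(a, c) \<in> Qnat" using Qnat_iff code_inj[of Y Y'] by auto
next
  fix a b assume "(a, b) \<in> Qnat" "(b, a) \<in> Qnat"
  then obtain X Y where "X \<in> QQ" "Y \<in> QQ" "a = code X" "b = code Y" "X \<subseteq> Y"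
    by (auto elim!: Qnat_cases)
  then show "a = b" using Qnat_iff[of Y X] \<open>(b, a) \<in> Qnat\<close> by auto
qed

lemma empty_QQ: "{} \<in> QQ"
  by (simp add: QQ_def)

lemma Qnat_minimum: "is_minimum Qnat (code {})"
  unfolding is_minimum_def Field_Qnat using empty_QQ Qnat_iff by auto

lemma Qnat_minimum_iff:
  assumes "X \<in> QQ"
  shows "is_minimum Qnat (code X) \<longleftrightarrow> X = {}"
  using is_minimum_unique[OF Qnat_po Qnat_minimum, of "code X"] code_inj[OF empty_QQ assms]
    Qnat_minimum by auto

lemma QQ_Def: "X \<in> QQ \<Longrightarrow> Def X"
  unfolding QQ_def using JJ3_JJ JJ_Def by (auto simp: Def_def lvl_closed_def)

text \<open>At a level where \<open>p\<close> and \<open>q\<close> are closed,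
  \<open>p \<inter> q\<close> is a finite union of principal sets, and a prime \<open>x\<close> lies
  in one of them. That set is again in the third part, which is closed upwards. The level does not
  depend on \<open>x\<close>, so finitely many interpolants serve all lower bounds.\<close>

lemma QQ_interpolation:
  assumes pq: "p \<in> QQ" "q \<in> QQ" "lvl_closed d p" "lvl_closed d q"
    and x: "x \<in> QQ" "x \<subseteq> p" "x \<subseteq> q"
  shows "\<exists>y\<in>QQ. lvl_closed d y \<and> x \<subseteq> y \<and> y \<subseteq> p \<and> y \<subseteq> q"
proof (cases "x = {}")
  case True
  then show ?thesis using empty_QQ by (intro bexI[of _ "{}"]) (auto simp: lvl_closed_def)
next
  case False
  then have x3: "x \<in> JJ3" using x by (simp add: QQ_def)
  have cl: "lvl_closed d (p \<inter> q)" using pq lvl_closed_Int by blast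
  have "x \<subseteq> \<Union>(C d ` (p \<inter> q))" using x(2,3) lvl_closed_eq_Union[OF cl] by blast
  then have "\<exists>Y\<in>C d ` (p \<inter> q). x \<subseteq> Y"
    by (rule JJ_subset_Union[OF JJ3_JJ[OF x3] finite_C_image, rotated]) auto
  then obtain t where t: "t \<in> p \<inter> q" "x \<subseteq> C d t" by blast
  have sub: "C d t \<subseteq> p \<inter> q" using lvl_closed_C_subset[OF cl t(1)] .
  have "C d t \<in> JJ3" using JJ3_up[OF x3 C_JJ t(2)] .
  moreover have "C d t \<noteq> UNIV" using sub pq(1) False x(2) by (auto simp: QQ_def)
  ultimately have "C d t \<in> QQ" by (simp add: QQ_def)
  then show ?thesis using sub t(2) by (intro bexI[of _ "C d t"]) auto
qed

lemma finite_QQ_level: "finite {X \<in> QQ. lvl_closed d X}"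
proof (rule finite_subset)
  show "{X \<in> QQ. lvl_closed d X} \<subseteq> insert {} (range (C d))"
  proof
    fix X assume "X \<in> {X \<in> QQ. lvl_closed d X}"
    then have X: "X = {} \<or> X \<in> JJ" "lvl_closed d X" using JJ3_JJ by (auto simp: QQ_def)
    then show "X \<in> insert {} (range (C d))" using JJ_eq_C[of X d] by auto
  qed
  show "finite (insert {} (range (C d)))" using finite_C by simp
qed

lemma Qnat_qsl: "qsl Qnat" "qsl_locally_finite Qnat"
proof -
  have "\<exists>B. finite B \<and> A \<subseteq> B \<and> B \<subseteq> Field Qnat \<and>
      (\<forall>p\<in>B. \<forall>q\<in>B. \<forall>x. (x, p) \<in> Qnat \<longrightarrow> (x, q) \<in> Qnat \<longrightarrow>
        (\<exists>y\<in>B. (x, y) \<in> Qnat \<and> (y, p) \<in> Qnat \<and> (y, q) \<in> Qnat))"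
    if A: "finite A" "A \<subseteq> Field Qnat" for A
  proof -
    from finite_subset_image[OF A(1) A(2)[unfolded Field_Qnat]]
    obtain A0 where A0: "A0 \<subseteq> QQ" "finite A0" "A = code ` A0" by (elim exE conjE)
    have "\<exists>d\<ge>0. \<forall>X\<in>A0. lvl_closed d X" using A0 QQ_Def by (intro common_level) auto
    then obtain d where d: "\<And>X. X \<in> A0 \<Longrightarrow> lvl_closed d X" by blast
    let ?B = "{X \<in> QQ. lvl_closed d X}"
    have "\<exists>y\<in>code ` ?B. (x, y) \<in> Qnat \<and> (y, p) \<in> Qnat \<and> (y, q) \<in> Qnat"
      if pq: "p \<in> code ` ?B" "q \<in> code ` ?B" and x: "(x, p) \<in> Qnat" "(x, q) \<in> Qnat" for p q x
    proof -
      obtain P Q where P: "P \<in> QQ" "lvl_closed d P" "p = code P"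
        and Q: "Q \<in> QQ" "lvl_closed d Q" "q = code Q" using pq by blast
      obtain X where X: "X \<in> QQ" "x = code X" using x(1) by (rule Qnat_cases)
      have "X \<subseteq> P" "X \<subseteq> Q" using x Qnat_iff X P Q by auto
      from QQ_interpolation[OF P(1) Q(1) P(2) Q(2) X(1) this]
      obtain Y where "Y \<in> QQ" "lvl_closed d Y" "X \<subseteq> Y" "Y \<subseteq> P" "Y \<subseteq> Q" by blast
      then show ?thesis using X P Q Qnat_iff by (intro bexI[of _ "code Y"]) auto
    qed
    moreover have "A \<subseteq> code ` ?B" using A0 d by blast
    moreover have "code ` ?B \<subseteq> Field Qnat" unfolding Field_Qnat by blast
    ultimately show ?thesis using finite_QQ_level[of d] by (intro exI[of _ "code ` ?B"]) simp
  qed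
  then show "qsl Qnat" "qsl_locally_finite Qnat" using qsl_of_interpolation[OF Qnat_po] by auto
qed

lemma Qnat_bqsl: "bqsl Qnat"
  using Qnat_qsl Qnat_minimum unfolding bqsl_def by blast

lemma Qnat_one_point_ext:
  assumes "n \<ge> 2"
  shows "one_point_ext Qnat"
proof (rule one_point_extI)
  fix A D U
  assume A: "finite A" "sub_bqsl Qnat A" and D: "D \<subseteq> A" "\<exists>m\<in>D. is_minimum Qnat m"
    and down: "\<forall>x\<in>A. \<forall>y\<in>D. (x, y) \<in> Qnat \<longrightarrow> x \<in> D" and disj: "D \<inter> U = {}"
    and DU: "\<forall>x\<in>D. \<forall>y\<in>U. (x, y) \<in> Qnat" and U: "U = {} \<or> (\<exists>c\<in>A. U = {a \<in> A. (c, a) \<in> Qnat})"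
  have AF: "A \<subseteq> Field Qnat" using A(2) by (simp add: sub_bqsl_def)
  define A0 D0 where "A0 = {X \<in> QQ. code X \<in> A}" and "D0 = {X \<in> QQ. code X \<in> D}"
  have A0: "A0 \<subseteq> QQ" "A = code ` A0" "\<And>X. X \<in> QQ \<Longrightarrow> code X \<in> A \<longleftrightarrow> X \<in> A0"
    using AF unfolding Field_Qnat A0_def by auto
  have D0: "D0 \<subseteq> QQ" "D = code ` D0" "\<And>X. X \<in> QQ \<Longrightarrow> code X \<in> D \<longleftrightarrow> X \<in> D0"
    using order_trans[OF D(1) AF] unfolding Field_Qnat D0_def by auto
  have DA: "D0 \<subseteq> A0" using D(1) by (auto simp: A0_def D0_def)
  have inj: "inj_on code A0" using A0(1) code_inj by (auto simp: inj_on_def)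
  have finA: "finite A0" using A(1) inj unfolding A0(2) by (simp add: finite_image_iff)
  have finD: "finite D0" using finite_subset[OF DA finA] .
  have emptyD: "{} \<in> D0"
    using D(2) Qnat_minimum_iff D0(1,2) by auto
  \<comment> \<open>An empty \<open>U\<close> is treated as an extension below \<open>UNIV\<close>,
    which belongs to \<open>JJ3\<close> but not to \<open>QQ\<close>.\<close>
  obtain c where c: "c \<in> JJ3" "\<And>X. X \<in> A0 \<Longrightarrow> code X \<in> U \<longleftrightarrow> c \<subseteq> X"
    and Dc: "\<And>X. X \<in> D0 \<Longrightarrow> X \<subset> c"
  proof (cases "U = {}")
    case True
    have ne: "X \<noteq> UNIV" if "X \<in> QQ" for X
    proof (cases "X = {}")
      case False
      then show ?thesis using that by (simp add: QQ_def)
    qed simp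
    show ?thesis
    proof (rule that[of UNIV])
      show "UNIV \<in> JJ3" by (rule UNIV_JJ3[OF assms])
      show "code X \<in> U \<longleftrightarrow> UNIV \<subseteq> X" if "X \<in> A0" for X
        using ne[of X] A0(1) that True by auto
      show "X \<subset> UNIV" if "X \<in> D0" for X using ne[of X] D0(1) that by auto
    qed
  next
    case False
    then obtain c' where c': "c' \<in> A" "U = {a \<in> A. (c', a) \<in> Qnat}" using U by blast
    then obtain c where c: "c \<in> A0" "c' = code c" using A0(2) by blast
    have cQ: "c \<in> QQ" using c A0(1) by blast
    have U_iff: "code X \<in> U \<longleftrightarrow> c \<subseteq> X" if "X \<in> A0" for X
    proof -
      have "X \<in> QQ" using that A0(1) by blast
      then show ?thesis using that c' c(2) Qnat_iff[OF cQ] A0(3) by simp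
    qed
    have cU: "code c \<in> U" using U_iff[OF c(1)] by simp
    have cD: "c \<notin> D0" using disj cU D0(2) by blast
    have strict: "X \<subset> c" if "X \<in> D0" for X
    proof -
      have "(code X, code c) \<in> Qnat" using DU that cU D0(2) by blast
      then have "X \<subseteq> c" using Qnat_iff cQ D0(1) that by blast
      then show ?thesis using cD that by blast
    qed
    have "c \<in> JJ3" using cQ cD emptyD by (auto simp: QQ_def)
    then show ?thesis using that U_iff strict by blast
  qed
  have J3: "X \<in> JJ3" if "X \<in> QQ" "X \<noteq> {}" for X using that by (simp add: QQ_def)
  \<comment> \<open>The empty set is the added minimum and no member of \<open>JJ3\<close>; it is
    set aside here and restored in \<open>cl\<close>.\<close>
  have "\<exists>b\<in>JJ3. b \<subset> c \<and> (\<forall>X\<in>D0 - {{}}. X \<subseteq> b \<and> \<not> b \<subseteq> X) \<and>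
      (\<forall>a\<in>A0 - {{}}. \<forall>p\<in>JJ3. \<not> c \<subseteq> a \<longrightarrow> p \<subseteq> a \<longrightarrow> p \<subseteq> b \<longrightarrow> (\<exists>X\<in>D0 - {{}}. p \<subseteq> X))"
    using finA finD A0(1) D0(1) J3 Dc by (intro JJ3_extension c(1)) auto
  then obtain b where b: "b \<in> JJ3" "b \<subset> c"
    "\<And>X. X \<in> D0 \<Longrightarrow> X \<noteq> {} \<Longrightarrow> X \<subseteq> b \<and> \<not> b \<subseteq> X"
    and b_cl: "\<And>a p. a \<in> A0 \<Longrightarrow> a \<noteq> {} \<Longrightarrow> p \<in> JJ3 \<Longrightarrow> \<not> c \<subseteq> a \<Longrightarrow> p \<subseteq> a \<Longrightarrow> p \<subseteq> b \<Longrightarrow>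
      \<exists>X\<in>D0. X \<noteq> {} \<and> p \<subseteq> X" by (metis (no_types, lifting) Diff_iff singletonD singletonI)
  have bQ: "b \<in> QQ" using b(1,2) by (auto simp: QQ_def)
  have b_ne: "b \<noteq> {}" using b(1) JJ3_JJ JJ_ne by blast
  have cl: "\<exists>X\<in>D0. p \<subseteq> X" if "a \<in> A0" "p \<in> QQ" "\<not> c \<subseteq> a" "p \<subseteq> a" "p \<subseteq> b" for a p
  proof (cases "p = {}")
    case True
    then show ?thesis using emptyD by blast
  next
    case False
    then show ?thesis using b_cl[of a p] J3 that by blast
  qed
  have below: "a \<subseteq> b \<longleftrightarrow> a \<in> D0" if a: "a \<in> A0" for a
  proof
    assume ab: "a \<subseteq> b"
    have aQ: "a \<in> QQ" using a A0(1) by blast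
    have "\<not> c \<subseteq> a" using ab b(2) by blast
    then obtain X where X: "X \<in> D0" "a \<subseteq> X" using cl[OF a aQ] ab by blast
    then have "(code a, code X) \<in> Qnat" using Qnat_iff[OF aQ] D0(1) by blast
    then have "code a \<in> D" using down a A0(2) X(1) D0(2) by blast
    then show "a \<in> D0" using D0(3)[OF aQ] by blast
  next
    assume "a \<in> D0"
    then show "a \<subseteq> b" using b(3)[of a] by blast
  qed
  have above: "b \<subseteq> a \<longleftrightarrow> c \<subseteq> a" if a: "a \<in> A0" for a
  proof
    assume ba: "b \<subseteq> a"
    show "c \<subseteq> a"
    proof (rule ccontr)
      assume "\<not> c \<subseteq> a"
      then obtain X where X: "X \<in> D0" "b \<subseteq> X" using cl[OF a bQ] ba by blast
      then have "X \<noteq> {}" using b_ne by blast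
      then show False using b(3)[OF X(1)] X(2) by blast
    qed
  qed (use b(2) in blast)
  show "\<exists>b\<in>Field Qnat. (\<forall>a\<in>A. ((b, a) \<in> Qnat \<longleftrightarrow> a \<in> U) \<and> ((a, b) \<in> Qnat \<longleftrightarrow> a \<in> D)) \<and>
      (\<forall>a\<in>A - U. \<forall>p. (p, a) \<in> Qnat \<longrightarrow> (p, b) \<in> Qnat \<longrightarrow> (\<exists>\<delta>\<in>D. (p, \<delta>) \<in> Qnat))"
  proof (rule bexI[of _ "code b"], intro conjI ballI allI impI)
    show "code b \<in> Field Qnat" using bQ by (simp add: Field_Qnat)
    fix a' assume "a' \<in> A"
    then obtain a where a: "a \<in> A0" "a' = code a" "a \<in> QQ" using A0 by blast
    show "(code b, a') \<in> Qnat \<longleftrightarrow> a' \<in> U"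
      using Qnat_iff[OF bQ a(3)] above[OF a(1)] c(2)[OF a(1)] a(2) by simp
    show "(a', code b) \<in> Qnat \<longleftrightarrow> a' \<in> D"
      using Qnat_iff[OF a(3) bQ] below[OF a(1)] D0(3)[OF a(3)] a(2) by simp
  next
    fix a' p' assume a': "a' \<in> A - U" and p': "(p', a') \<in> Qnat" "(p', code b) \<in> Qnat"
    then obtain a where a: "a \<in> A0" "a' = code a" "a \<in> QQ" using A0 by blast
    obtain p where p: "p \<in> QQ" "p' = code p" using p'(1) by (rule Qnat_cases)
    have "p \<subseteq> a" "p \<subseteq> b" using p' p a Qnat_iff bQ by auto
    moreover have "\<not> c \<subseteq> a" using c(2)[OF a(1)] a' a(2) by simp
    ultimately obtain X where X: "X \<in> D0" "p \<subseteq> X" using cl[OF a(1) p(1)] by blast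
    then have "(p', code X) \<in> Qnat" using Qnat_iff[OF p(1)] D0(1) p(2) by blast
    then show "\<exists>\<delta>\<in>D. (p', \<delta>) \<in> Qnat" using X(1) D0(2) by blast
  qed
qed

lemma Qnat_universal_homogeneous: "n \<ge> 2 \<Longrightarrow> universal_homogeneous_bqsl Qnat"
  using Qnat_bqsl Qnat_qsl Qnat_one_point_ext
  by (intro one_point_ext_universal_homogeneous) auto

text \<open>Both \<open>Qnat\<close> and \<open>Q\<close> have one-point extensions, so back and
  forth from the pair of minima identifies them. The shift then discards the empty set and restores
  the top as \<open>None\<close>.\<close>

lemma J3_iso_shift_poset:
  assumes n: "n \<ge> 2" and Q: "universal_homogeneous_bqsl Q"
  shows "order_isomorphic (Restr (H_le n) (J3 n)) (shift_poset Q)"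
proof -
  have Qb: "bqsl Q" "countable (Field Q)" "qsl_locally_finite Q"
    using Q by (auto simp: universal_homogeneous_bqsl_def)
  have Qpo: "Partial_order Q" using Qb(1) by (simp add: bqsl_def qsl_def)
  obtain m where m: "is_minimum Q m" using Qb(1) unfolding bqsl_def by blast
  have "countable (Field Qnat)" by simp
  from back_and_forth[OF Qnat_bqsl Qnat_qsl(2) this Qnat_one_point_ext[OF n]
      Qb(1,3,2) universal_homogeneous_one_point_ext[OF Q]
      partial_iso_minima[OF Qnat_po Qnat_minimum Qpo m]]
  obtain g where g: "order_iso Qnat Q g" "g (code {}) = m" by auto
  define k where "k X = g (code X)" for X
  have g_order: "(k X, k Y) \<in> Q \<longleftrightarrow> X \<subseteq> Y" if "X \<in> QQ" "Y \<in> QQ" for X Y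
    using g(1) that Qnat_iff[OF that] by (auto simp: order_iso_def Field_Qnat k_def)
  have gF: "k ` QQ = Field Q"
    using g(1) by (auto simp: order_iso_def bij_betw_def Field_Qnat k_def image_image[symmetric])
  have kmin: "is_minimum Q (k X) \<longleftrightarrow> X = {}" if X: "X \<in> QQ" for X
  proof
    assume "is_minimum Q (k X)"
    then have "k X = k {}" using is_minimum_unique[OF Qpo m] g(2) by (simp add: k_def)
    then have "(k X, k {}) \<in> Q" using m g(2) by (auto simp: is_minimum_def k_def)
    then show "X = {}" using g_order[OF X empty_QQ] by simp
  qed (use m g(2) in \<open>simp add: k_def\<close>)
  have kF: "k X \<in> Field Q" if "X \<in> QQ" for X using gF that by blast
  define f where "f a = (if Mod a = UNIV then None else Some (k (Mod a)))" for a
  have J3Q: "Mod a \<in> QQ" "Mod a \<noteq> {}" if "a \<in> J3 n" "Mod a \<noteq> UNIV" for a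
    using that J3_iff[of a] JJ3_JJ JJ_ne by (auto simp: QQ_def)
  have le: "(a, b) \<in> H_le n \<longleftrightarrow> Mod a \<subseteq> Mod b" if "a \<in> J3 n" "b \<in> J3 n" for a b
    using that J3_iff J_le_iff by blast
  have F1: "Field (Restr (H_le n) (J3 n)) = J3 n"
    using le by (fastforce simp: Field_def)
  have order: "(a, b) \<in> H_le n \<longleftrightarrow> (f a, f b) \<in> shift_poset Q" if ab: "a \<in> J3 n" "b \<in> J3 n" for a b
  proof (cases "Mod a = UNIV")
    case True
    then show ?thesis using le[OF ab] by (auto simp: f_def shift_poset_def)
  next
    case a: False
    note ka = J3Q[OF ab(1) a]
    show ?thesis
    proof (cases "Mod b = UNIV")
      case True
      then show ?thesis
        using le[OF ab] a ka kF[OF ka(1)] kmin[OF ka(1)] by (auto simp: f_def shift_poset_def)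
    next
      case b: False
      note kb = J3Q[OF ab(2) b]
      show ?thesis
        using le[OF ab] a b ka kb kmin[OF ka(1)] kmin[OF kb(1)] g_order[OF ka(1) kb(1)]
        by (auto simp: f_def shift_poset_def)
    qed
  qed
  have F2: "Field (shift_poset Q) = insert None (Some ` {x \<in> Field Q. \<not> is_minimum Q x})"
    using po_refl[OF Qpo] by (fastforce simp: Field_def shift_poset_def)
  have "inj_on f (J3 n)"
  proof (rule inj_onI)
    fix a b assume ab: "a \<in> J3 n" "b \<in> J3 n" "f a = f b"
    have "(f a, f a) \<in> shift_poset Q" using order[OF ab(1,1)] le[OF ab(1,1)] by simp
    then have "Mod a \<subseteq> Mod b" "Mod b \<subseteq> Mod a"
      using order[of a b] order[of b a] le[of a b] le[of b a] ab by simp_all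
    then have "Mod a = Mod b" by blast
    then show "a = b" using J_inj[of a b] J3_iff ab(1,2) by blast
  qed
  moreover have "f ` J3 n = Field (shift_poset Q)"
  proof (intro equalityI subsetI)
    fix z assume "z \<in> f ` J3 n"
    then obtain a where a: "a \<in> J3 n" "z = f a" by blast
    then have "(z, z) \<in> shift_poset Q" using order[OF a(1) a(1)] le[OF a(1) a(1)] by simp
    then show "z \<in> Field (shift_poset Q)" by (rule FieldI1)
  next
    fix z assume z: "z \<in> Field (shift_poset Q)"
    have ex: "\<exists>a\<in>J3 n. Mod a = X" if "X \<in> JJ3" for X
      using J_surj[OF JJ3_JJ[OF that]] J3_iff that by auto
    show "z \<in> f ` J3 n"
    proof (cases z)
      case None
      obtain a where "a \<in> J3 n" "Mod a = UNIV" using ex[OF UNIV_JJ3[OF n]] by blast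
      then show ?thesis using None by (intro image_eqI[of _ _ a]) (auto simp: f_def)
    next
      case (Some y)
      then have y: "y \<in> Field Q" "\<not> is_minimum Q y" using z F2 by auto
      then obtain X where X: "X \<in> QQ" "y = k X" using gF by blast
      then have "X \<in> JJ3" "X \<noteq> UNIV" using y kmin[OF X(1)] JJ3_JJ JJ_ne by (auto simp: QQ_def)
      then obtain a where "a \<in> J3 n" "Mod a = X" using ex by blast
      then show ?thesis using Some X \<open>X \<noteq> UNIV\<close> by (intro image_eqI[of _ _ a]) (auto simp: f_def)
    qed
  qed
  ultimately have "order_iso (Restr (H_le n) (J3 n)) (shift_poset Q) f"
    unfolding order_iso_def F1 bij_betw_def using order by auto
  then show ?thesis by (auto simp: order_isomorphic_def)
qed

section \<open>The second part and the order between the parts\<close>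

lemma countable_J2: "countable (J2 n)"
proof -
  have "inj_on Mod (J2 n)" using J_inj J2_iff unfolding inj_on_def by blast
  moreover have "Mod ` J2 n \<subseteq> JJ" using J2_iff JJ2_JJ by blast
  ultimately show ?thesis using countable_subset[OF _ countable_JJ] countable_image_inj_on by blast
qed

lemma infinite_J2:
  assumes "n \<ge> 2"
  shows "infinite (J2 n)"
proof
  assume "finite (J2 n)"
  moreover have "JJ2 \<subseteq> Mod ` J2 n"
  proof
    fix X assume X: "X \<in> JJ2"
    then obtain a where "a \<in> J n" "Mod a = X" using J_surj JJ2_JJ by blast
    then show "X \<in> Mod ` J2 n" using J2_iff[of a] X by blast
  qed
  ultimately show False using infinite_JJ2[OF assms] finite_surj by blast
qed

lemma antichain_J2: "antichain (H_le n) (J2 n)"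
proof -
  have "a = b" if ab: "a \<in> J2 n" "b \<in> J2 n" "(a, b) \<in> H_le n" for a b
    using ab by (auto simp: J2_def)
  then show ?thesis by (simp add: antichain_def)
qed

lemma J1_below_J2:
  assumes "a \<in> J2 n"
  shows "\<exists>b\<in>J1 n. (b, a) \<in> H_le n"
proof -
  have a: "a \<in> J n" "Mod a \<in> JJ" using assms J2_iff J_iff by blast+
  obtain Y where Y: "Y \<in> JJ1" "Y \<subseteq> Mod a" using JJ1_below[OF a(2)] by blast
  then have "Y \<in> JJ" by (simp add: JJ1_def)
  then obtain b where "b \<in> J n" "Mod b = Y" using J_surj by blast
  then show ?thesis using J1_iff[of b] J_le_iff[OF _ a(1)] Y by blast
qed

lemma J2_below_J3:
  assumes "a \<in> J3 n"
  shows "\<exists>b\<in>J2 n. (b, a) \<in> H_le n"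
proof -
  have a: "a \<in> J n" "Mod a \<in> JJ - JJ1" using assms J3_iff[of a] by (auto simp: JJ3_def)
  obtain Y where Y: "Y \<in> JJ2" "Y \<subseteq> Mod a" using JJ2_below[OF a(2)] by blast
  then have "Y \<in> JJ" using JJ2_JJ by blast
  then obtain b where "b \<in> J n" "Mod b = Y" using J_surj by blast
  then show ?thesis using J2_iff[of b] J_le_iff[OF _ a(1)] Y by blast
qed

lemma J1_down:
  assumes "b \<in> J1 n" "a \<in> J n" "(a, b) \<in> H_le n"
  shows "a \<in> J1 n"
proof -
  have b: "b \<in> J n" "Mod b \<in> JJ" "Mod b \<in> JJ1" using assms(1) J1_iff J_iff by blast+
  have a: "Mod a \<in> JJ" using assms(2) J_iff by blast
  have "Mod a \<subseteq> Mod b" using J_le_iff[OF assms(2) b(1)] assms(3) by blast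
  then have "Mod a \<in> JJ1" using infinite_up[of "Mod a" "Mod b"] a b by blast
  then show ?thesis using J1_iff[of a] assms(2) by blast
qed

lemma J_part_mono:
  assumes ij: "i \<in> {1, 2, 3}" "j \<in> {1, 2, 3}" and x: "x \<in> J_part i n" and y: "y \<in> J_part j n"
    and le: "(x, y) \<in> H_le n"
  shows "i \<le> j"
proof -
  have xJ: "x \<in> J n" using x by (auto simp: J_part_def J1_def J2_def J3_def split: if_splits)
  consider "j = 1" | "j = 2" | "j = 3" using ij by blast
  then show ?thesis
  proof cases
    case 1
    then have "x \<in> J1 n" using y J1_down xJ le by (simp add: J_part_def)
    then show ?thesis using x ij 1 by (auto simp: J_part_def J2_def J3_def split: if_splits)
  next
    case 2
    then have y2: "y \<in> J2 n" using y by (simp add: J_part_def)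
    have "x \<notin> J3 n"
    proof
      assume x3: "x \<in> J3 n"
      then have "x = y" using y2 le by (auto simp: J2_def J3_def)
      then show False using x3 y2 by (simp add: J3_def)
    qed
    then show ?thesis using x ij 2 by (auto simp: J_part_def)
  next
    case 3
    then show ?thesis using ij by auto
  qed
qed

end

theorem mainTheorem1:
  fixes n :: nat
  assumes "n \<ge> 2"
  shows "(countable (J2 n) \<and> infinite (J2 n) \<and> antichain (H_le n) (J2 n) \<and>
      (\<exists>Q::nat rel. universal_homogeneous_bqsl Q) \<and>
      (\<forall>Q::'q rel. universal_homogeneous_bqsl Q \<longrightarrow>
        order_isomorphic (Restr (H_le n) (J3 n)) (shift_poset Q))) \<and>
    ((\<forall>x\<in>J2 n. \<exists>y\<in>J1 n. (y, x) \<in> H_le n) \<and>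
      (\<forall>x\<in>J3 n. \<exists>y\<in>J2 n. (y, x) \<in> H_le n)) \<and>
    (\<forall>i\<in>{1, 2, 3}. \<forall>j\<in>{1, 2, 3}. \<forall>x\<in>J_part i n. \<forall>y\<in>J_part j n.
      (x, y) \<in> H_le n \<longrightarrow> i \<le> j)"
proof -
  interpret gens n .
  show ?thesis
    using assms countable_J2 infinite_J2 antichain_J2 Qnat_universal_homogeneous J3_iso_shift_poset
      J1_below_J2 J2_below_J3 J_part_mono
    by (intro conjI exI[of _ Qnat]) auto
qed

end
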